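(* Let $\lambda,\mu,\nu$ be dominant integral weights of $\mathfrak{sl}_3(\mathbb C)$ satisfying $|\mathbf p_\lambda|+|\mathbf p_\mu|\equiv|\mathbf p_\nu| \pmod 3$. Then $c^{\nu}_{\lambda,\mu}\ne0$ if and only if $c^{N\nu}_{N\lambda,N\mu}\neq0$ for some integer $N>1$.
   Context: For a dominant integral weight $\lambda=\lambda_1\omega_1+\lambda_2\omega_2$ of $\mathfrak{sl}_3(\mathbb C)$ ($\omega_1,\omega_2$ the fundamental weights, $\lambda_i\in\mathbb Z_{\ge0}$), $\mathbf p_\lambda$ is the partition $(\lambda_1+\lambda_2\ge\lambda_2)$, of size $|\mathbf p_\lambda|=\lambda_1+2\lambda_2$. $c^\nu_{\lambda,\mu}$ denotes the multiplicity of the irreducible module $V(\nu)$ in $V(\lambda)\otimes V(\mu)$, where $V(\lambda)$ is the irreducible $\mathfrak{sl}_3(\mathbb C)$-module of highest weight $\lambda$. *)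

theory Defs
  imports "HOL-Analysis.Analysis" "HOL-Library.Function_Algebras" "HOL-Number_Theory.Cong"
begin

definition sl3 :: "(complex^3^3) set" where
  "sl3 = {A. trace A = 0}"

definition lie_bracket :: "complex^3^3 \<Rightarrow> complex^3^3 \<Rightarrow> complex^3^3" where
  "lie_bracket A B = A ** B - B ** A"

definition matrix_scale :: "complex \<Rightarrow> complex^3^3 \<Rightarrow> complex^3^3" where
  "matrix_scale c A = (\<chi> i j. c * A $ i $ j)"

definition matrix_unit :: "3 \<Rightarrow> 3 \<Rightarrow> complex^3^3" where
  "matrix_unit i j = (\<chi> k l. if k = i \<and> l = j then 1 else 0)"

definition cartan :: "(complex^3^3) set" where
  "cartan = {h \<in> sl3. \<forall>i j. i \<noteq> j \<longrightarrow> h $ i $ j = 0}"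

text \<open>The pair \<open>(a, b)\<close> stands for the dominant weight
  \<open>a \<omega>\<^sub>1 + b \<omega>\<^sub>2\<close>. With respect to the upper triangular Borel subalgebra,
  the fundamental weights send \<open>diag(h\<^sub>1, h\<^sub>2, h\<^sub>3)\<close> to
  \<open>h\<^sub>1\<close> and to \<open>h\<^sub>1 + h\<^sub>2\<close>.\<close>

type_synonym dom_weight = "nat \<times> nat"

definition fund_weight1 :: "complex^3^3 \<Rightarrow> complex" where
  "fund_weight1 h = h $ 1 $ 1"

definition fund_weight2 :: "complex^3^3 \<Rightarrow> complex" where
  "fund_weight2 h = h $ 1 $ 1 + h $ 2 $ 2"

definition weight_eval :: "dom_weight \<Rightarrow> complex^3^3 \<Rightarrow> complex" where
  "weight_eval lam h = of_nat (fst lam) * fund_weight1 h + of_nat (snd lam) * fund_weight2 h"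

definition scale_weight :: "nat \<Rightarrow> dom_weight \<Rightarrow> dom_weight" where
  "scale_weight N lam = (N * fst lam, N * snd lam)"

definition weight_partition :: "dom_weight \<Rightarrow> nat list" where
  "weight_partition lam = [fst lam + snd lam, snd lam]"

definition partition_size :: "nat list \<Rightarrow> nat" where
  "partition_size p = sum_list p"

text \<open>Modules live on finite-dimensional complex subspaces of a function space
  \<open>'i \<Rightarrow> complex\<close>. With \<open>'i = nat\<close> every finite-dimensional module is
  isomorphic to one of this kind. The action is only meaningful for elements of
  \<^const>\<open>sl3\<close> and for vectors of the underlying space.\<close>

definition fun_scale :: "complex \<Rightarrow> ('i \<Rightarrow> complex) \<Rightarrow> ('i \<Rightarrow> complex)" where
  "fun_scale c f = (\<lambda>i. c * f i)"

global_interpretation cfun: vector_space fun_scale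
  by unfold_locales (auto simp: fun_scale_def fun_eq_iff algebra_simps)

record 'i rep =
  rep_space :: "('i \<Rightarrow> complex) set"
  rep_act :: "complex^3^3 \<Rightarrow> ('i \<Rightarrow> complex) \<Rightarrow> ('i \<Rightarrow> complex)"

locale sl3_module =
  fixes M :: "'i rep"
  assumes subspace: "cfun.subspace (rep_space M)"
    and finite_dim: "\<exists>B. finite B \<and> rep_space M = cfun.span B"
    and act_closed: "\<lbrakk>x \<in> sl3; v \<in> rep_space M\<rbrakk> \<Longrightarrow> rep_act M x v \<in> rep_space M"
    and act_add: "\<lbrakk>x \<in> sl3; v \<in> rep_space M; w \<in> rep_space M\<rbrakk> \<Longrightarrow>
      rep_act M x (v + w) = rep_act M x v + rep_act M x w"
    and act_scale: "\<lbrakk>x \<in> sl3; v \<in> rep_space M\<rbrakk> \<Longrightarrow>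
      rep_act M x (fun_scale c v) = fun_scale c (rep_act M x v)"
    and add_act: "\<lbrakk>x \<in> sl3; y \<in> sl3; v \<in> rep_space M\<rbrakk> \<Longrightarrow>
      rep_act M (x + y) v = rep_act M x v + rep_act M y v"
    and scale_act: "\<lbrakk>x \<in> sl3; v \<in> rep_space M\<rbrakk> \<Longrightarrow>
      rep_act M (matrix_scale c x) v = fun_scale c (rep_act M x v)"
    and bracket_act: "\<lbrakk>x \<in> sl3; y \<in> sl3; v \<in> rep_space M\<rbrakk> \<Longrightarrow>
      rep_act M (lie_bracket x y) v
        = rep_act M x (rep_act M y v) - rep_act M y (rep_act M x v)"

definition submodule :: "('i \<Rightarrow> complex) set \<Rightarrow> 'i rep \<Rightarrow> bool" where
  "submodule U M \<longleftrightarrow> cfun.subspace U \<and> U \<subseteq> rep_space M \<and>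
     (\<forall>x\<in>sl3. \<forall>u\<in>U. rep_act M x u \<in> U)"

definition restrict_rep :: "'i rep \<Rightarrow> ('i \<Rightarrow> complex) set \<Rightarrow> 'i rep" where
  "restrict_rep M U = M\<lparr>rep_space := U\<rparr>"

definition irreducible_module :: "'i rep \<Rightarrow> bool" where
  "irreducible_module M \<longleftrightarrow> sl3_module M \<and> rep_space M \<noteq> {0} \<and>
     (\<forall>U. submodule U M \<longrightarrow> U = {0} \<or> U = rep_space M)"

definition module_iso :: "'i rep \<Rightarrow> 'j rep \<Rightarrow> (('i \<Rightarrow> complex) \<Rightarrow> ('j \<Rightarrow> complex)) \<Rightarrow> bool" where
  "module_iso M N f \<longleftrightarrow> bij_betw f (rep_space M) (rep_space N) \<and>
     (\<forall>v\<in>rep_space M. \<forall>w\<in>rep_space M. f (v + w) = f v + f w) \<and>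
     (\<forall>c. \<forall>v\<in>rep_space M. f (fun_scale c v) = fun_scale c (f v)) \<and>
     (\<forall>x\<in>sl3. \<forall>v\<in>rep_space M. f (rep_act M x v) = rep_act N x (f v))"

definition isomorphic_modules :: "'i rep \<Rightarrow> 'j rep \<Rightarrow> bool" where
  "isomorphic_modules M N \<longleftrightarrow> (\<exists>f. module_iso M N f)"

text \<open>The root vectors \<open>E\<^sub>1\<^sub>2\<close>, \<open>E\<^sub>2\<^sub>3\<close> and \<open>E\<^sub>1\<^sub>3\<close> span the
  nilradical of the upper triangular Borel subalgebra.\<close>

definition highest_weight_vector :: "'i rep \<Rightarrow> dom_weight \<Rightarrow> ('i \<Rightarrow> complex) \<Rightarrow> bool" where
  "highest_weight_vector M lam v \<longleftrightarrow> v \<in> rep_space M \<and> v \<noteq> 0 \<and>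
     rep_act M (matrix_unit 1 2) v = 0 \<and>
     rep_act M (matrix_unit 2 3) v = 0 \<and>
     rep_act M (matrix_unit 1 3) v = 0 \<and>
     (\<forall>h\<in>cartan. rep_act M h v = fun_scale (weight_eval lam h) v)"

text \<open>\<open>V(lam)\<close> is determined only up to isomorphism; a representative is
  chosen. For dominant \<open>lam\<close> it is finite-dimensional, so choosing among
  finite-dimensional modules is no restriction.\<close>

definition irrep :: "dom_weight \<Rightarrow> nat rep" where
  "irrep lam = (SOME M. irreducible_module M \<and> (\<exists>v. highest_weight_vector M lam v))"

definition tensor :: "('i \<Rightarrow> complex) \<Rightarrow> ('j \<Rightarrow> complex) \<Rightarrow> ('i \<times> 'j \<Rightarrow> complex)" where
  "tensor v w = (\<lambda>(i, j). v i * w j)"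

text \<open>For \<open>t \<in> V \<otimes> W\<close> every slice \<open>t(-, j)\<close> lies in \<open>V\<close> and every
  slice \<open>t(i, -)\<close> lies in \<open>W\<close>, so acting slicewise on the first and on the
  second variable gives \<open>x \<otimes> 1 + 1 \<otimes> x\<close>.\<close>

definition tensor_rep :: "'i rep \<Rightarrow> 'j rep \<Rightarrow> ('i \<times> 'j) rep" where
  "tensor_rep M N =
     \<lparr>rep_space = cfun.span {tensor v w | v w. v \<in> rep_space M \<and> w \<in> rep_space N},
      rep_act = (\<lambda>x t (i, j). rep_act M x (\<lambda>k. t (k, j)) i + rep_act N x (\<lambda>k. t (i, k)) j)\<rparr>"

lemma tensor_rep_act_tensor:
  assumes "sl3_module M" "sl3_module N" "x \<in> sl3" "v \<in> rep_space M" "w \<in> rep_space N"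
  shows "rep_act (tensor_rep M N) x (tensor v w)
    = tensor (rep_act M x v) w + tensor v (rep_act N x w)"
proof -
  have "rep_act M x (\<lambda>k. v k * w j) = fun_scale (w j) (rep_act M x v)" for j
    using sl3_module.act_scale[of M x v "w j"] assms by (simp add: fun_scale_def mult.commute)
  moreover have "rep_act N x (\<lambda>k. v i * w k) = fun_scale (v i) (rep_act N x w)" for i
    using sl3_module.act_scale[of N x w "v i"] assms by (simp add: fun_scale_def)
  ultimately show ?thesis
    by (simp add: tensor_rep_def tensor_def fun_eq_iff) (simp add: fun_scale_def)
qed

definition irreducible_decomposition :: "'i rep \<Rightarrow> ('i \<Rightarrow> complex) set set \<Rightarrow> bool" where
  "irreducible_decomposition M D \<longleftrightarrow> finite D \<and>
     (\<forall>U\<in>D. submodule U M \<and> irreducible_module (restrict_rep M U)) \<and>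
     (\<forall>v\<in>rep_space M. \<exists>!f. f \<in> (\<Pi>\<^sub>E U\<in>D. U) \<and> v = (\<Sum>U\<in>D. f U))"

text \<open>The number of summands isomorphic to a given irreducible module does not depend
  on the chosen decomposition into irreducible submodules, and such a decomposition
  exists by complete reducibility.\<close>

definition module_multiplicity :: "'j rep \<Rightarrow> 'i rep \<Rightarrow> nat" where
  "module_multiplicity V M =
     (let D = (SOME D. irreducible_decomposition M D)
      in card {U \<in> D. isomorphic_modules (restrict_rep M U) V})"

definition tensor_coeff :: "dom_weight \<Rightarrow> dom_weight \<Rightarrow> dom_weight \<Rightarrow> nat" where
  "tensor_coeff lam mu nu = module_multiplicity (irrep nu) (tensor_rep (irrep lam) (irrep mu))"

end

theory Submission
  imports Defs
begin

text \<open>\<open>V(a\<omega>\<^sub>1 + b\<omega>\<^sub>2)\<close> is the submodule generated by the highest weight vector in a tensor power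
  with \<open>a\<close> vector slots and \<open>b\<close> covector slots; the standard Hermitian product makes it
  irreducible and gives complete reducibility. So \<open>c\<close> is nonzero iff there is a nonzero equivariant
  bilinear map \<open>V(\<lambda>) \<times> V(\<mu>) \<rightarrow> V(\<nu>)\<close>. Write \<open>\<nu> = \<lambda> + \<mu> - k\<alpha>\<^sub>1 - l\<alpha>\<^sub>2\<close>. Such a map forces
  \<open>\<nu> - \<lambda>\<close>, \<open>\<nu> - \<mu>\<close> and \<open>\<lambda> + w\<^sub>0\<mu>\<close> to be weights of \<open>V(\<mu>)\<close>, \<open>V(\<lambda>)\<close> and \<open>V(\<nu>)\<close>, which gives
  homogeneous linear inequalities in \<open>k\<close>, \<open>l\<close> and the weights. Conversely, integral solutions of
  these inequalities are nonnegative integral combinations of eight elementary invariants (six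
  contractions of a vector with a covector and two determinants), and the corresponding product of
  contractions is a nonzero map. The inequalities are invariant under scaling, and the congruence
  says that \<open>k\<close> and \<open>l\<close> are integers.\<close>

section \<open>Generators of the Lie algebra and module homomorphisms\<close>

text \<open>\<open>irrep\<close> and \<open>module_multiplicity\<close> are defined by choice, and a
  module comes without a weight decomposition, so V(lam) is only accessible up to isomorphism:
  existence comes from the tensor model, uniqueness from a graph inside a direct sum. Only the
  nonvanishing of c is at stake; by Schur's lemma it is equivalent to the existence of a nonzero
  homomorphism, whichever decomposition was chosen. The delicate point of the converse is that an
  invariant of the full tensor powers may vanish on the irreducible submodules generated by the
  highest words. It is therefore tested on a highest weight vector, a general point of the orbit of
  the other highest weight vector, and a highest weight coordinate, where it is a product of nonzero
  numbers, one per elementary invariant. The eight generators are not independent: one determinant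
  of each kind uses up the same slots as three contractions. Hence every solution can be written
  with at most one kind of determinant, chosen by the sign of k - l. The modulus 3 is the index of
  the root lattice in the weight lattice, and the size of the partition mod 3 is the class of the
  weight.\<close>

lemma matrix_unit_mult:
  "matrix_unit i j ** matrix_unit k l = (if j = k then matrix_unit i l else 0)"
  by (auto simp: matrix_unit_def matrix_matrix_mult_def vec_eq_iff if_distrib [of "\<lambda>x. x * _"] sum.delta
      cong: if_cong)

lemma lie_bracket_matrix_unit:
  "lie_bracket (matrix_unit i j) (matrix_unit k l)
    = (if j = k then matrix_unit i l else 0) - (if l = i then matrix_unit k j else 0)"
  by (simp add: lie_bracket_def matrix_unit_mult)

lemma matrix_unit_sl3 [simp]: "i \<noteq> j \<Longrightarrow> matrix_unit i j \<in> sl3"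
  by (auto simp: sl3_def trace_def matrix_unit_def intro!: sum.neutral)

lemma sl3_add: "x \<in> sl3 \<Longrightarrow> y \<in> sl3 \<Longrightarrow> x + y \<in> sl3"
  by (simp add: sl3_def trace_def sum.distrib)

lemma sl3_scale: "x \<in> sl3 \<Longrightarrow> matrix_scale c x \<in> sl3"
  by (simp add: sl3_def trace_def matrix_scale_def flip: sum_distrib_left)

lemma sl3_bracket: "lie_bracket x y \<in> sl3"
  using trace_mul_sym [of x y] by (simp add: sl3_def lie_bracket_def trace_sub)

lemma cartan_sl3: "h \<in> cartan \<Longrightarrow> h \<in> sl3"
  by (simp add: cartan_def)

definition coroot :: "3 \<Rightarrow> 3 \<Rightarrow> complex^3^3" where
  "coroot i j = matrix_unit i i - matrix_unit j j"

lemma coroot_cartan [simp]: "coroot i j \<in> cartan"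
  by (auto simp: cartan_def coroot_def sl3_def trace_def matrix_unit_def sum_subtractf sum.delta)

lemma coroot_sl3 [simp]: "coroot i j \<in> sl3"
  by (simp add: cartan_sl3)

lemma coroot_bracket: "i \<noteq> j \<Longrightarrow> coroot i j = lie_bracket (matrix_unit i j) (matrix_unit j i)"
  by (simp add: lie_bracket_matrix_unit coroot_def)

lemma matrix_unit_nth [simp]: "matrix_unit i j $ k $ l = (if k = i \<and> l = j then 1 else 0)"
  by (simp add: matrix_unit_def)

lemma coroot_nth [simp]: "coroot i j $ k $ l = (if k = i \<and> l = i then 1 else 0) - (if k = j \<and> l = j then 1 else 0)"
  by (simp add: coroot_def)

lemma matrix_scale_nth [simp]: "matrix_scale c x $ k $ l = c * x $ k $ l"
  by (simp add: matrix_scale_def)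

lemma three_distinct:
  fixes a b c :: 3
  assumes "distinct [a, b, c]"
  shows "UNIV = {a, b, c}"
proof -
  have "x = a \<or> x = b \<or> x = c" for x
    using assms exhaust_3 [of a] exhaust_3 [of b] exhaust_3 [of c] exhaust_3 [of x] by (elim disjE) simp_all
  then show ?thesis by blast
qed

text \<open>A traceless diagonal (p, q, r) is p times the first coroot minus r times the second,
  because q = - p - r. The triple \<open>a\<close>, \<open>b\<close>, \<open>c\<close> is an
  arbitrary ordering of the indices, so that the reversed ordering later yields the opposite Borel
  subalgebra.\<close>

lemma sl3_decompose:
  assumes "x \<in> sl3" and d: "distinct [a, b, c]"
  shows "x = matrix_scale (x $ a $ b) (matrix_unit a b) + matrix_scale (x $ b $ c) (matrix_unit b c)
    + matrix_scale (x $ a $ c) (matrix_unit a c) + matrix_scale (x $ b $ a) (matrix_unit b a)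
    + matrix_scale (x $ c $ b) (matrix_unit c b) + matrix_scale (x $ c $ a) (matrix_unit c a)
    + matrix_scale (x $ a $ a) (coroot a b) + matrix_scale (- x $ c $ c) (coroot b c)"
proof -
  note U = three_distinct [OF d]
  have mem: "i \<in> {a, b, c}" for i by (rule subsetD [OF equalityD1 [OF U] UNIV_I])
  have ne: "a \<noteq> b" "b \<noteq> a" "a \<noteq> c" "c \<noteq> a" "b \<noteq> c" "c \<noteq> b" using d by auto
  have "x $ a $ a + x $ b $ b + x $ c $ c = 0"
    using assms(1) ne unfolding sl3_def trace_def U by (simp add: add.assoc)
  then have tr: "x $ b $ b = - x $ a $ a - x $ c $ c"
    by algebra
  let ?y = "matrix_scale (x $ a $ b) (matrix_unit a b) + matrix_scale (x $ b $ c) (matrix_unit b c)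
    + matrix_scale (x $ a $ c) (matrix_unit a c) + matrix_scale (x $ b $ a) (matrix_unit b a)
    + matrix_scale (x $ c $ b) (matrix_unit c b) + matrix_scale (x $ c $ a) (matrix_unit c a)
    + matrix_scale (x $ a $ a) (coroot a b) + matrix_scale (- x $ c $ c) (coroot b c)"
  have "x $ a $ a = ?y $ a $ a" "x $ a $ b = ?y $ a $ b" "x $ a $ c = ?y $ a $ c"
    using ne by simp_all
  moreover have "x $ b $ a = ?y $ b $ a" "x $ b $ b = ?y $ b $ b" "x $ b $ c = ?y $ b $ c"
    using ne tr by simp_all
  moreover have "x $ c $ a = ?y $ c $ a" "x $ c $ b = ?y $ c $ b" "x $ c $ c = ?y $ c $ c"
    using ne by simp_all
  ultimately have "\<forall>i\<in>{a, b, c}. \<forall>j\<in>{a, b, c}. x $ i $ j = ?y $ i $ j"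
    by (simp only: ball_simps simp_thms)
  then have "\<forall>j\<in>{a, b, c}. x $ i $ j = ?y $ i $ j" for i by (rule bspec) (rule mem)
  then have "x $ i $ j = ?y $ i $ j" for i j by (rule bspec) (rule mem)
  then show ?thesis by (intro iffD2 [OF vec_eq_iff] allI)
qed

text \<open>The four simple root vectors generate the Lie algebra: the remaining root vectors and
  the coroots are brackets of them. Stability of a subspace thus has to be tested on these four
  matrices only.\<close>

lemma sl3_induct [consumes 2, case_names gen add scale bracket]:
  fixes a b c :: 3
  assumes "x \<in> sl3" and d: "distinct [a, b, c]"
    and gen: "\<And>i j. (i, j) \<in> {(a, b), (b, c), (b, a), (c, b)} \<Longrightarrow> P (matrix_unit i j)"
    and add: "\<And>x y. x \<in> sl3 \<Longrightarrow> y \<in> sl3 \<Longrightarrow> P x \<Longrightarrow> P y \<Longrightarrow> P (x + y)"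
    and scale: "\<And>r x. x \<in> sl3 \<Longrightarrow> P x \<Longrightarrow> P (matrix_scale r x)"
    and bracket: "\<And>x y. x \<in> sl3 \<Longrightarrow> y \<in> sl3 \<Longrightarrow> P x \<Longrightarrow> P y \<Longrightarrow> P (lie_bracket x y)"
  shows "P x"
proof -
  have g: "P (matrix_unit a b)" "P (matrix_unit b c)" "P (matrix_unit b a)" "P (matrix_unit c b)"
    by (auto intro: gen)
  have "P (lie_bracket (matrix_unit a b) (matrix_unit b c))"
    "P (lie_bracket (matrix_unit c b) (matrix_unit b a))"
    using d g by (auto intro!: bracket)
  then have ac: "P (matrix_unit a c)" "P (matrix_unit c a)"
    using d by (auto simp: lie_bracket_matrix_unit)
  have h: "P (coroot a b)" "P (coroot b c)"
    using d g by (auto intro!: bracket simp: coroot_bracket)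
  show ?thesis
    by (subst sl3_decompose [OF assms(1) d])
      (intro add scale sl3_add sl3_scale g ac h matrix_unit_sl3 coroot_sl3; use d in auto)
qed

lemma fun_scale_apply [simp]: "fun_scale c f i = c * f i"
  by (simp add: fun_scale_def)

lemma sum_fun_apply: "(\<Sum>a\<in>A. (f a :: 'i \<Rightarrow> 'b::comm_monoid_add)) i = (\<Sum>a\<in>A. f a i)"
  by (induction A rule: infinite_finite_induct) auto

context sl3_module
begin

lemma zero_in [simp]: "0 \<in> rep_space M"
  using subspace by (rule cfun.subspace_0)

lemma add_in: "v \<in> rep_space M \<Longrightarrow> w \<in> rep_space M \<Longrightarrow> v + w \<in> rep_space M"
  using subspace by (rule cfun.subspace_add)

lemma diff_in: "v \<in> rep_space M \<Longrightarrow> w \<in> rep_space M \<Longrightarrow> v - w \<in> rep_space M"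
  using subspace by (rule cfun.subspace_diff)

lemma scale_in: "v \<in> rep_space M \<Longrightarrow> fun_scale c v \<in> rep_space M"
  using subspace by (rule cfun.subspace_scale)

lemma act_zero: "x \<in> sl3 \<Longrightarrow> rep_act M x 0 = 0"
  using act_scale [OF _ zero_in, of x 0] by simp

lemma act_diff: "x \<in> sl3 \<Longrightarrow> v \<in> rep_space M \<Longrightarrow> w \<in> rep_space M \<Longrightarrow>
    rep_act M x (v - w) = rep_act M x v - rep_act M x w"
  using act_add [of x "v - w" w] by (simp add: diff_in)

lemma zero_act: "v \<in> rep_space M \<Longrightarrow> rep_act M 0 v = 0"
proof -
  assume v: "v \<in> rep_space M"
  have "matrix_scale 0 0 = 0" by (simp add: matrix_scale_def vec_eq_iff)
  moreover have "(0 :: complex^3^3) \<in> sl3" by (simp add: sl3_def trace_def)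
  ultimately show ?thesis using scale_act [OF _ v, of 0 0] by simp
qed

lemma sum_in: "(\<And>a. a \<in> A \<Longrightarrow> f a \<in> rep_space M) \<Longrightarrow> (\<Sum>a\<in>A. f a) \<in> rep_space M"
  by (rule cfun.subspace_sum [OF subspace])

lemma act_sum: "x \<in> sl3 \<Longrightarrow> (\<And>a. a \<in> A \<Longrightarrow> f a \<in> rep_space M) \<Longrightarrow>
    rep_act M x (\<Sum>a\<in>A. f a) = (\<Sum>a\<in>A. rep_act M x (f a))"
  by (induction A rule: infinite_finite_induct) (auto simp: act_zero act_add sum_in)

lemma submoduleI:
  assumes d: "distinct [a, b, c]" and U: "cfun.subspace U" "U \<subseteq> rep_space M"
    and gen: "\<And>i j u. (i, j) \<in> {(a, b), (b, c), (b, a), (c, b)} \<Longrightarrow> u \<in> U \<Longrightarrow>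
      rep_act M (matrix_unit i j) u \<in> U"
  shows "submodule U M"
proof -
  have "\<forall>u\<in>U. rep_act M x u \<in> U" if "x \<in> sl3" for x
    using that d
  proof (induction rule: sl3_induct)
    case (add x y)
    show ?case
    proof
      fix u assume u: "u \<in> U"
      then have "rep_act M (x + y) u = rep_act M x u + rep_act M y u"
        using add.hyps U(2) by (intro add_act) auto
      then show "rep_act M (x + y) u \<in> U"
        using add.IH u cfun.subspace_add [OF U(1)] by simp
    qed
  next
    case (scale r x)
    show ?case
    proof
      fix u assume u: "u \<in> U"
      then have "rep_act M (matrix_scale r x) u = fun_scale r (rep_act M x u)"
        using scale.hyps U(2) by (intro scale_act) auto
      then show "rep_act M (matrix_scale r x) u \<in> U"
        using scale.IH u cfun.subspace_scale [OF U(1)] by simp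
    qed
  next
    case (bracket x y)
    show ?case
    proof
      fix u assume u: "u \<in> U"
      then have "rep_act M (lie_bracket x y) u
          = rep_act M x (rep_act M y u) - rep_act M y (rep_act M x u)"
        using bracket.hyps U(2) by (intro bracket_act) auto
      then show "rep_act M (lie_bracket x y) u \<in> U"
        using bracket.IH u cfun.subspace_diff [OF U(1)] by simp
    qed
  qed (use gen in blast)
  then show ?thesis using U by (auto simp: submodule_def)
qed

end

lemma finite_dim_subspace:
  assumes "cfun.subspace U" "U \<subseteq> cfun.span B" "finite B"
  shows "\<exists>C. finite C \<and> U = cfun.span C"
proof -
  obtain C where C: "C \<subseteq> U" "cfun.independent C" "U \<subseteq> cfun.span C"
    using cfun.maximal_independent_subset [of U] by blast
  have "finite C" using cfun.independent_span_bound [of B C] C assms by auto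
  moreover have "cfun.span C \<subseteq> U" using C assms by (simp add: cfun.span_minimal)
  ultimately show ?thesis using C by blast
qed

lemma sl3_module_restrict:
  assumes "sl3_module M" "submodule U M"
  shows "sl3_module (restrict_rep M U)"
proof -
  interpret sl3_module M by fact
  obtain B where "finite B" "rep_space M = cfun.span B" using finite_dim by blast
  then have "\<exists>B. finite B \<and> U = cfun.span B"
    using assms finite_dim_subspace [of U B] by (simp add: submodule_def)
  then show ?thesis
    using assms(2) by unfold_locales
      (auto simp: submodule_def restrict_rep_def subset_iff act_add act_scale add_act scale_act bracket_act)
qed

lemma rep_space_restrict [simp]: "rep_space (restrict_rep M U) = U"
  by (simp add: restrict_rep_def)

lemma rep_act_restrict [simp]: "rep_act (restrict_rep M U) = rep_act M"
  by (simp add: restrict_rep_def)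

lemma submodule_restrict:
  "submodule U M \<Longrightarrow> submodule V (restrict_rep M U) \<longleftrightarrow> submodule V M \<and> V \<subseteq> U"
  by (auto simp: submodule_def)

section \<open>Homomorphisms, isomorphisms and Schur's lemma\<close>

definition module_hom :: "'i rep \<Rightarrow> 'j rep \<Rightarrow> (('i \<Rightarrow> complex) \<Rightarrow> ('j \<Rightarrow> complex)) \<Rightarrow> bool" where
  "module_hom M N f \<longleftrightarrow> f ` rep_space M \<subseteq> rep_space N \<and>
     (\<forall>v\<in>rep_space M. \<forall>w\<in>rep_space M. f (v + w) = f v + f w) \<and>
     (\<forall>c. \<forall>v\<in>rep_space M. f (fun_scale c v) = fun_scale c (f v)) \<and>
     (\<forall>x\<in>sl3. \<forall>v\<in>rep_space M. f (rep_act M x v) = rep_act N x (f v))"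

lemma module_homD:
  assumes "module_hom M N f"
  shows "v \<in> rep_space M \<Longrightarrow> f v \<in> rep_space N"
    and "v \<in> rep_space M \<Longrightarrow> w \<in> rep_space M \<Longrightarrow> f (v + w) = f v + f w"
    and "v \<in> rep_space M \<Longrightarrow> f (fun_scale c v) = fun_scale c (f v)"
    and "x \<in> sl3 \<Longrightarrow> v \<in> rep_space M \<Longrightarrow> f (rep_act M x v) = rep_act N x (f v)"
  using assms by (auto simp: module_hom_def)

lemma module_hom_zero:
  assumes "sl3_module M" "module_hom M N f"
  shows "f 0 = 0"
proof -
  interpret sl3_module M by fact
  show ?thesis using module_homD(2) [OF assms(2) zero_in zero_in] by simp
qed

lemma module_hom_diff:
  assumes "sl3_module M" "module_hom M N f" "v \<in> rep_space M" "w \<in> rep_space M"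
  shows "f (v - w) = f v - f w"
proof -
  interpret sl3_module M by fact
  show ?thesis using module_homD(2) [OF assms(2), of "v - w" w] assms by (simp add: diff_in)
qed

lemma module_hom_sum:
  assumes "sl3_module M" "module_hom M N f" "\<And>a. a \<in> A \<Longrightarrow> g a \<in> rep_space M"
  shows "f (\<Sum>a\<in>A. g a) = (\<Sum>a\<in>A. f (g a))"
proof -
  interpret sl3_module M by fact
  show ?thesis using assms(3)
    by (induction A rule: infinite_finite_induct)
      (auto simp: module_hom_zero [OF assms(1,2)] module_homD(2) [OF assms(2)] sum_in)
qed

lemma module_iso_hom: "module_iso M N f \<Longrightarrow> module_hom M N f"
  by (auto simp: module_iso_def module_hom_def bij_betw_def)

lemma module_isoI: "module_hom M N f \<Longrightarrow> bij_betw f (rep_space M) (rep_space N) \<Longrightarrow> module_iso M N f"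
  by (auto simp: module_iso_def module_hom_def)

lemma module_hom_comp: "module_hom M N f \<Longrightarrow> module_hom N L g \<Longrightarrow> module_hom M L (g \<circ> f)"
  by (auto simp: module_hom_def image_subset_iff)

lemma module_iso_comp: "module_iso M N f \<Longrightarrow> module_iso N L g \<Longrightarrow> module_iso M L (g \<circ> f)"
  by (rule module_isoI [OF module_hom_comp [OF module_iso_hom module_iso_hom]])
    (auto simp: module_iso_def intro: bij_betw_trans)

lemma module_iso_inverse:
  assumes "sl3_module M" "module_iso M N f"
  shows "module_iso N M (inv_into (rep_space M) f)"
proof -
  interpret sl3_module M by fact
  let ?g = "inv_into (rep_space M) f"
  have b: "bij_betw f (rep_space M) (rep_space N)" using assms(2) by (simp add: module_iso_def)
  have fg: "f (?g w) = w" "?g w \<in> rep_space M" if "w \<in> rep_space N" for w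
    using b that by (auto simp: bij_betw_inv_into_right inv_into_into bij_betw_def)
  have gf: "?g (f v) = v" if "v \<in> rep_space M" for v
    using b that by (simp add: bij_betw_inv_into_left)
  note h = module_homD [OF module_iso_hom [OF assms(2)]]
  have "?g (v + w) = ?g v + ?g w" if "v \<in> rep_space N" "w \<in> rep_space N" for v w
    using h(2) [of "?g v" "?g w"] fg that by (metis add_in gf)
  moreover have "?g (fun_scale c v) = fun_scale c (?g v)" if "v \<in> rep_space N" for c v
    using h(3) [of "?g v" c] fg that by (metis scale_in gf)
  moreover have "?g (rep_act N x v) = rep_act M x (?g v)" if "x \<in> sl3" "v \<in> rep_space N" for x v
    using h(4) [of x "?g v"] fg that by (metis act_closed gf)
  ultimately show ?thesis
    using b by (auto simp: module_iso_def bij_betw_inv_into)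
qed

lemma irreducible_module_sl3: "irreducible_module M \<Longrightarrow> sl3_module M"
  by (simp add: irreducible_module_def)

lemma submodule_kernel:
  assumes "sl3_module M" "sl3_module N" "module_hom M N f"
  shows "submodule {v \<in> rep_space M. f v = 0} M"
proof -
  interpret M: sl3_module M by fact
  interpret N: sl3_module N by fact
  note h = module_homD [OF assms(3)]
  show ?thesis
    unfolding submodule_def cfun.subspace_def
    by (auto simp: h module_hom_zero [OF assms(1,3)] M.add_in M.scale_in M.act_closed N.act_zero)
qed

lemma submodule_image:
  assumes "sl3_module M" "sl3_module N" "module_hom M N f"
  shows "submodule (f ` rep_space M) N"
proof -
  interpret M: sl3_module M by fact
  interpret N: sl3_module N by fact
  note h = module_homD [OF assms(3)]
  have "0 \<in> f ` rep_space M" using module_hom_zero [OF assms(1,3)] M.zero_in by (metis imageI)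
  moreover have "f v + f w \<in> f ` rep_space M" if "v \<in> rep_space M" "w \<in> rep_space M" for v w
    using h(2) [OF that] M.add_in [OF that] by (metis imageI)
  moreover have "fun_scale c (f v) \<in> f ` rep_space M" if "v \<in> rep_space M" for v c
    using h(3) [OF that] M.scale_in [OF that] by (metis imageI)
  moreover have "rep_act N x (f v) \<in> f ` rep_space M" if "x \<in> sl3" "v \<in> rep_space M" for v x
    using h(4) [OF that] M.act_closed [OF that] by (metis imageI)
  ultimately show ?thesis
    using h(1) unfolding submodule_def cfun.subspace_def by auto
qed

lemma schur:
  assumes M: "irreducible_module M" and N: "irreducible_module N" and f: "module_hom M N f"
    and nz: "v \<in> rep_space M" "f v \<noteq> 0"
  shows "module_iso M N f"
proof -
  have sl: "sl3_module M" "sl3_module N" using M N by (simp_all add: irreducible_module_sl3)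
  interpret M: sl3_module M by fact
  have ker: "{v \<in> rep_space M. f v = 0} = {0}"
    using M submodule_kernel [OF sl f] nz unfolding irreducible_module_def by blast
  have "f ` rep_space M = rep_space N"
    using N submodule_image [OF sl f] nz unfolding irreducible_module_def by blast
  moreover have "inj_on f (rep_space M)"
  proof (rule inj_onI)
    fix a b assume ab: "a \<in> rep_space M" "b \<in> rep_space M" "f a = f b"
    then have "f (a - b) = 0" by (simp add: module_hom_diff [OF sl(1) f])
    then have "a - b \<in> {0}" using ab ker by (metis (mono_tags, lifting) M.diff_in mem_Collect_eq)
    then show "a = b" by simp
  qed
  ultimately show ?thesis by (intro module_isoI f) (simp add: bij_betw_def)
qed

section \<open>Unitary structure on tensor powers\<close>

definition adjoint_matrix :: "complex^3^3 \<Rightarrow> complex^3^3" where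
  "adjoint_matrix x = (\<chi> i j. cnj (x $ j $ i))"

lemma adjoint_matrix_sl3 [simp]: "x \<in> sl3 \<Longrightarrow> adjoint_matrix x \<in> sl3"
  by (simp add: sl3_def trace_def adjoint_matrix_def flip: cnj_sum)

lemma adjoint_matrix_adjoint [simp]: "adjoint_matrix (adjoint_matrix x) = x"
  by (simp add: adjoint_matrix_def vec_eq_iff)

text \<open>The infinitesimal form of Weyl's unitary trick. Invariance under the compact form is
  expressed through the conjugate transpose, which makes sense for every element of
  \<open>sl3\<close> and gives at once that the orthogonal complement of a submodule is a
  submodule.\<close>

locale unitary_module = sl3_module M for M :: "'i rep" +
  fixes q :: "('i \<Rightarrow> complex) \<Rightarrow> ('i \<Rightarrow> complex) \<Rightarrow> complex"
  assumes q_add: "\<lbrakk>u \<in> rep_space M; v \<in> rep_space M; w \<in> rep_space M\<rbrakk> \<Longrightarrow> q (u + v) w = q u w + q v w"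
    and q_scale: "\<lbrakk>v \<in> rep_space M; w \<in> rep_space M\<rbrakk> \<Longrightarrow> q (fun_scale c v) w = c * q v w"
    and q_sym: "\<lbrakk>v \<in> rep_space M; w \<in> rep_space M\<rbrakk> \<Longrightarrow> q w v = cnj (q v w)"
    and q_definite: "\<lbrakk>v \<in> rep_space M; q v v = 0\<rbrakk> \<Longrightarrow> v = 0"
    and q_adjoint: "\<lbrakk>x \<in> sl3; v \<in> rep_space M; w \<in> rep_space M\<rbrakk> \<Longrightarrow>
      q (rep_act M x v) w = q v (rep_act M (adjoint_matrix x) w)"
begin

lemma q_diff: "\<lbrakk>u \<in> rep_space M; v \<in> rep_space M; w \<in> rep_space M\<rbrakk> \<Longrightarrow> q (u - v) w = q u w - q v w"
  using q_add [of "u - v" v w] by (simp add: diff_in)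

lemma q_zero: "w \<in> rep_space M \<Longrightarrow> q 0 w = 0"
  using q_scale [OF zero_in, of w 0] by simp

lemma q_zero': "w \<in> rep_space M \<Longrightarrow> q w 0 = 0"
  using q_sym [OF zero_in, of w] by (simp add: q_zero)

lemma q_add': "\<lbrakk>u \<in> rep_space M; v \<in> rep_space M; w \<in> rep_space M\<rbrakk> \<Longrightarrow> q w (u + v) = q w u + q w v"
  using q_add [of u v w] q_sym [of "u + v" w] q_sym [of u w] q_sym [of v w] add_in [of u v] by simp

lemma q_scale': "\<lbrakk>v \<in> rep_space M; w \<in> rep_space M\<rbrakk> \<Longrightarrow> q w (fun_scale c v) = cnj c * q w v"
  using q_scale [of v w c] q_sym [of "fun_scale c v" w] q_sym [of v w] scale_in [of v c] by simp

lemma orthogonal_span: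
  assumes v: "v \<in> rep_space M" and B: "B \<subseteq> rep_space M" and o: "\<And>b. b \<in> B \<Longrightarrow> q v b = 0"
    and b: "b \<in> cfun.span B"
  shows "q v b = 0"
proof -
  have "cfun.span B \<subseteq> {b \<in> rep_space M. q v b = 0}"
  proof (rule cfun.span_minimal)
    show "cfun.subspace {b \<in> rep_space M. q v b = 0}"
      using v by (auto simp: cfun.subspace_def q_add' q_scale' q_zero' add_in scale_in)
  qed (use B o in auto)
  then show ?thesis using b by auto
qed

lemma span_in: "B \<subseteq> rep_space M \<Longrightarrow> b \<in> cfun.span B \<Longrightarrow> b \<in> rep_space M"
  using cfun.span_minimal [OF _ subspace] by blast

text \<open>Gram-Schmidt by induction on the spanning set: the new vector is first made orthogonal
  to the old span, and then its component is removed from \<open>v\<close> as well.\<close>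

lemma projection_span:
  assumes "finite B" "B \<subseteq> rep_space M" "v \<in> rep_space M"
  shows "\<exists>u\<in>cfun.span B. \<forall>b\<in>B. q (v - u) b = 0"
  using assms
proof (induction B arbitrary: v)
  case empty
  show ?case by (intro bexI [of _ 0] cfun.span_zero) simp
next
  case (insert b B)
  have b: "b \<in> rep_space M" and B: "B \<subseteq> rep_space M" using insert.prems by auto
  obtain b0 where b0: "b0 \<in> cfun.span B" and bo: "\<forall>c\<in>B. q (b - b0) c = 0"
    using insert.IH [OF B b] by blast
  obtain u0 where u0: "u0 \<in> cfun.span B" and uo: "\<forall>c\<in>B. q (v - u0) c = 0"
    using insert.IH [OF B insert.prems(2)] by blast
  define b' where "b' = b - b0"
  define v' where "v' = v - u0"
  have in_M: "b0 \<in> rep_space M" "u0 \<in> rep_space M" "b' \<in> rep_space M" "v' \<in> rep_space M"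
    using span_in [OF B] b0 u0 b insert.prems by (auto simp: b'_def v'_def diff_in)
  \<comment> \<open>\<open>B\<close> need not be independent; when \<open>b\<close> already lies in
    the span of the others, \<open>b'\<close> is zero and nothing is subtracted.\<close>
  define r where "r = (if q b' b' = 0 then 0 else q v' b' / q b' b')"
  define u where "u = u0 + fun_scale r b'"
  have vu: "v - u = v' - fun_scale r b'"
    by (simp add: u_def v'_def algebra_simps)
  have mono: "cfun.span B \<subseteq> cfun.span (insert b B)" by (rule cfun.span_mono) auto
  have u: "u \<in> cfun.span (insert b B)"
    unfolding u_def b'_def using u0 b0 mono
    by (intro cfun.span_add cfun.span_scale cfun.span_diff) (auto intro: cfun.span_base)
  have c: "q (v - u) c = 0" if "c \<in> B" for c
    using that B bo uo in_M unfolding vu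
    by (subst q_diff) (auto simp: q_scale scale_in b'_def [symmetric] v'_def [symmetric])
  have vuM: "v - u \<in> rep_space M" using vu in_M by (simp add: diff_in scale_in)
  have "q (v - u) b' = 0"
  proof (cases "q b' b' = 0")
    case True
    then have "b' = 0" using q_definite in_M by blast
    then show ?thesis using vuM q_zero' by simp
  next
    case False
    then show ?thesis unfolding vu using in_M
      by (subst q_diff) (auto simp: q_scale scale_in r_def)
  qed
  moreover have "q (v - u) b0 = 0" using orthogonal_span [OF vuM B c b0] by blast
  moreover have "b = b0 + b'" by (simp add: b'_def)
  ultimately have "q (v - u) b = 0" using q_add' [OF in_M(1,3) vuM] by simp
  with c u show ?case by blast
qed

definition ortho :: "('i \<Rightarrow> complex) set \<Rightarrow> ('i \<Rightarrow> complex) set" where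
  "ortho U = {v \<in> rep_space M. \<forall>u\<in>U. q v u = 0}"

lemma ortho_decompose:
  assumes "submodule U M" "v \<in> rep_space M"
  shows "\<exists>u\<in>U. v - u \<in> ortho U"
proof -
  have U: "cfun.subspace U" "U \<subseteq> rep_space M" using assms(1) by (auto simp: submodule_def)
  obtain B where B: "finite B" "U = cfun.span B"
    using finite_dim finite_dim_subspace [OF U(1)] U(2) by metis
  have BM: "B \<subseteq> rep_space M" using B U cfun.span_superset by blast
  obtain u where u: "u \<in> cfun.span B" "\<forall>b\<in>B. q (v - u) b = 0"
    using projection_span [OF B(1) BM assms(2)] by blast
  have m: "v - u \<in> rep_space M" using span_in [OF BM u(1)] assms(2) by (simp add: diff_in)
  then have "v - u \<in> ortho U"
    unfolding ortho_def B(2) using orthogonal_span [OF m BM] u(2) by blast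
  then show ?thesis using u(1) B(2) by blast
qed

lemma ortho_Int:
  assumes "u \<in> ortho U" "u \<in> U"
  shows "u = 0"
  using assms q_definite by (auto simp: ortho_def)

lemma submodule_ortho:
  assumes "submodule U M"
  shows "submodule (ortho U) M"
proof -
  have U: "U \<subseteq> rep_space M" "\<And>x u. x \<in> sl3 \<Longrightarrow> u \<in> U \<Longrightarrow> rep_act M x u \<in> U"
    using assms by (auto simp: submodule_def)
  have "rep_act M x v \<in> ortho U" if "x \<in> sl3" "v \<in> ortho U" for x v
    using that U by (auto simp: ortho_def act_closed q_adjoint subset_iff)
  moreover have "cfun.subspace (ortho U)"
    using U(1) by (auto simp: ortho_def cfun.subspace_def q_add q_scale q_zero add_in scale_in subset_iff)
  ultimately show ?thesis by (auto simp: submodule_def ortho_def)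
qed

lemma ortho_unique:
  assumes U: "submodule U M" and "u \<in> U" "u' \<in> U" "w \<in> ortho U" "w' \<in> ortho U" "u + w = u' + w'"
  shows "u = u'" "w = w'"
proof -
  have "u - u' = w' - w" using assms(6) by (simp add: algebra_simps)
  moreover have "u - u' \<in> U" using U assms by (simp add: submodule_def cfun.subspace_diff)
  moreover have "w' - w \<in> ortho U"
    using submodule_ortho [OF U] assms by (simp add: submodule_def cfun.subspace_diff)
  ultimately have "u - u' = 0" by (metis ortho_Int)
  then show "u = u'" "w = w'" using assms(6) by auto
qed

end

text \<open>A signature lists the tensor slots: \<^const>\<open>True\<close> for \<open>\<complex>\<^sup>3\<close>, \<^const>\<open>False\<close> for its dual.
  Tensors are functions on index words.\<close>

definition slot :: "bool \<Rightarrow> complex^3^3 \<Rightarrow> 3 \<Rightarrow> 3 \<Rightarrow> complex" where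
  "slot s x i j = (if s then x $ i $ j else - x $ j $ i)"

text \<open>The Leibniz rule, one slot at a time: the matrix acts either on the head slot or, with
  the head index frozen, on the remaining slots. The empty signature is the trivial module.\<close>

fun wact :: "bool list \<Rightarrow> complex^3^3 \<Rightarrow> (3 list \<Rightarrow> complex) \<Rightarrow> 3 list \<Rightarrow> complex" where
  "wact [] x t w = 0"
| "wact (s # sg) x t [] = 0"
| "wact (s # sg) x t (i # w) = (\<Sum>j\<in>UNIV. slot s x i j * t (j # w)) + wact sg x (\<lambda>u. t (i # u)) w"

lemma wact_sum:
  "wact sg x (\<lambda>u. \<Sum>k\<in>K. c k * t k u) w = (\<Sum>k\<in>K. c k * wact sg x (t k) w)"
proof (induction sg arbitrary: t w)
  case (Cons s sg)
  show ?case
  proof (cases w)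
    case (Cons i v)
    have "(\<Sum>j\<in>UNIV. slot s x i j * (\<Sum>k\<in>K. c k * t k (j # v)))
        = (\<Sum>k\<in>K. c k * (\<Sum>j\<in>UNIV. slot s x i j * t k (j # v)))"
      by (simp add: sum_distrib_left sum.swap [of _ K] mult.left_commute)
    then show ?thesis
      using Cons.IH [of "\<lambda>k u. t k (i # u)" v] by (simp add: Cons sum.distrib distrib_left)
  qed simp
qed simp

lemma wact_add: "wact sg x (\<lambda>u. t u + t' u) w = wact sg x t w + wact sg x t' w"
  by (induction sg x t w arbitrary: t' rule: wact.induct) (auto simp: distrib_left sum.distrib)

lemma wact_scale: "wact sg x (\<lambda>u. c * t u) w = c * wact sg x t w"
  using wact_sum [of sg x "\<lambda>_. c" "\<lambda>_. t" "{()}"] by simp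

lemma wact_zero [simp]: "wact sg x (\<lambda>u. 0) w = 0"
  using wact_scale [of sg x 0] by simp

lemma slot_add: "slot s (x + y) i j = slot s x i j + slot s y i j"
  by (simp add: slot_def)

lemma slot_scale: "slot s (matrix_scale c x) i j = c * slot s x i j"
  by (simp add: slot_def)

lemma slot_bracket: "slot s (lie_bracket x y) i j
    = (\<Sum>k\<in>UNIV. slot s x i k * slot s y k j) - (\<Sum>k\<in>UNIV. slot s y i k * slot s x k j)"
  by (simp add: slot_def lie_bracket_def matrix_matrix_mult_def mult.commute)

lemma add_wact: "wact sg (x + y) t w = wact sg x t w + wact sg y t w"
  by (induction sg x t w rule: wact.induct) (simp_all add: slot_add distrib_right sum.distrib)

lemma scale_wact: "wact sg (matrix_scale c x) t w = c * wact sg x t w"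
  by (induction sg x t w rule: wact.induct) (simp_all add: slot_scale distrib_left mult.assoc sum_distrib_left)

lemma bracket_wact:
  "wact sg (lie_bracket x y) t w = wact sg x (wact sg y t) w - wact sg y (wact sg x t) w"
proof (induction sg arbitrary: t w)
  case (Cons s sg)
  show ?case
  proof (cases w)
    case (Cons i v)
    \<comment> \<open>The two middle sums, where one matrix hits the head and the other the tail,
      are exchanged by swapping \<open>x\<close> and \<open>y\<close>, so they cancel in the
      commutator.\<close>
    have expand: "wact (s # sg) x (wact (s # sg) y t) (i # v)
      = (\<Sum>j\<in>UNIV. (\<Sum>k\<in>UNIV. slot s x i k * slot s y k j) * t (j # v))
        + (\<Sum>j\<in>UNIV. slot s x i j * wact sg y (\<lambda>u. t (j # u)) v)
        + (\<Sum>j\<in>UNIV. slot s y i j * wact sg x (\<lambda>u. t (j # u)) v)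
        + wact sg x (wact sg y (\<lambda>u. t (i # u))) v" for x y
    proof -
      have "(\<Sum>j\<in>UNIV. slot s x i j * (\<Sum>k\<in>UNIV. slot s y j k * t (k # v)))
        = (\<Sum>j\<in>UNIV. (\<Sum>k\<in>UNIV. slot s x i k * slot s y k j) * t (j # v))"
        by (simp add: sum_distrib_left sum_distrib_right mult.assoc) (rule sum.swap)
      then show ?thesis
        by (simp add: distrib_left sum.distrib wact_add wact_sum)
    qed
    show ?thesis
      unfolding Cons expand
      by (simp add: slot_bracket left_diff_distrib sum_subtractf Cons.IH)
  qed simp
qed simp

definition words :: "nat \<Rightarrow> 3 list set" where
  "words n = {w. length w = n}"

lemma finite_words [simp]: "finite (words n)"
  using finite_lists_length_eq [of "UNIV :: 3 set" n] by (simp add: words_def)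

lemma words_0 [simp]: "words 0 = {[]}"
  by (auto simp: words_def)

lemma sum_words_Suc:
  fixes f :: "3 list \<Rightarrow> 'b::comm_monoid_add"
  shows "(\<Sum>w\<in>words (Suc n). f w) = (\<Sum>i\<in>UNIV. \<Sum>w\<in>words n. f (i # w))"
proof -
  have eq: "words (Suc n) = (\<lambda>(i, w). i # w) ` (UNIV \<times> words n)"
    by (auto simp: words_def length_Suc_conv image_iff)
  have "inj_on (\<lambda>(i, w). i # w) (UNIV \<times> words n)" by (auto simp: inj_on_def)
  then show ?thesis
    by (simp add: eq sum.reindex sum.cartesian_product case_prod_unfold comp_def)
qed

text \<open>One statement for two pairings: c = -1 with all slots negated gives the duality between
  a tensor power and its dual, and c = 1 with a conjugated matrix gives the Hermitian
  adjoint.\<close>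

lemma wact_transpose:
  assumes "list_all2 (\<lambda>s s'. \<forall>i j. slot s x i j = c * slot s' y j i) sg sg'"
  shows "(\<Sum>w\<in>words (length sg). wact sg x t w * t' w)
    = c * (\<Sum>w\<in>words (length sg). t w * wact sg' y t' w)"
  using assms
proof (induction sg sg' arbitrary: t t' rule: list_all2_induct)
  case (Cons s sg s' sg')
  have "(\<Sum>i\<in>UNIV. \<Sum>w\<in>words (length sg). (\<Sum>j\<in>UNIV. slot s x i j * t (j # w)) * t' (i # w))
    = (\<Sum>j\<in>UNIV. \<Sum>w\<in>words (length sg). \<Sum>i\<in>UNIV. slot s x i j * t (j # w) * t' (i # w))"
  proof -
    have "(\<Sum>i\<in>UNIV. \<Sum>w\<in>words (length sg). (\<Sum>j\<in>UNIV. slot s x i j * t (j # w)) * t' (i # w))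
      = (\<Sum>w\<in>words (length sg). \<Sum>i\<in>UNIV. \<Sum>j\<in>UNIV. slot s x i j * t (j # w) * t' (i # w))"
      unfolding sum_distrib_right by (rule sum.swap)
    also have "\<dots> = (\<Sum>w\<in>words (length sg). \<Sum>j\<in>UNIV. \<Sum>i\<in>UNIV. slot s x i j * t (j # w) * t' (i # w))"
      by (rule sum.cong [OF refl], rule sum.swap)
    also have "\<dots> = (\<Sum>j\<in>UNIV. \<Sum>w\<in>words (length sg). \<Sum>i\<in>UNIV. slot s x i j * t (j # w) * t' (i # w))"
      by (rule sum.swap)
    finally show ?thesis .
  qed
  also have "\<dots> = c * (\<Sum>j\<in>UNIV. \<Sum>w\<in>words (length sg). t (j # w) * (\<Sum>i\<in>UNIV. slot s' y j i * t' (i # w)))"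
    using Cons.hyps by (simp add: sum_distrib_left mult_ac)
  finally have 1: "(\<Sum>i\<in>UNIV. \<Sum>w\<in>words (length sg). (\<Sum>j\<in>UNIV. slot s x i j * t (j # w)) * t' (i # w))
    = c * (\<Sum>j\<in>UNIV. \<Sum>w\<in>words (length sg). t (j # w) * (\<Sum>i\<in>UNIV. slot s' y j i * t' (i # w)))" .
  have 2: "(\<Sum>w\<in>words (length sg). wact sg x (\<lambda>u. t (i # u)) w * t' (i # w))
     = c * (\<Sum>w\<in>words (length sg). t (i # w) * wact sg' y (\<lambda>u. t' (i # u)) w)" for i
    using Cons.IH [of "\<lambda>u. t (i # u)" "\<lambda>u. t' (i # u)"] by simp
  show ?case
    by (simp add: sum_words_Suc distrib_left distrib_right sum.distrib 1 2) (simp add: sum_distrib_left)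
qed simp

lemma wact_dual: "(\<Sum>w\<in>words (length sg). wact sg x t w * t' w)
    = - (\<Sum>w\<in>words (length sg). t w * wact (map Not sg) x t' w)"
proof -
  have "list_all2 (\<lambda>s s'. \<forall>i j. slot s x i j = (-1) * slot s' x j i) sg (map Not sg)"
    by (auto simp: list_all2_conv_all_nth slot_def)
  from wact_transpose [OF this, of t t'] show ?thesis by simp
qed

lemma cnj_wact: "cnj (wact sg x t w) = wact sg (\<chi> i j. cnj (x $ i $ j)) (\<lambda>u. cnj (t u)) w"
  by (induction sg x t w rule: wact.induct) (auto simp: slot_def intro!: sum.cong)

definition winner :: "nat \<Rightarrow> (3 list \<Rightarrow> complex) \<Rightarrow> (3 list \<Rightarrow> complex) \<Rightarrow> complex" where
  "winner n t t' = (\<Sum>w\<in>words n. t w * cnj (t' w))"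

lemma winner_adjoint:
  "winner (length sg) (wact sg x t) t' = winner (length sg) t (wact sg (adjoint_matrix x) t')"
proof -
  have "list_all2 (\<lambda>s s'. \<forall>i j. slot s x i j = 1 * slot s' (\<chi> i j. cnj (adjoint_matrix x $ i $ j)) j i) sg sg"
    by (auto simp: list_all2_conv_all_nth slot_def adjoint_matrix_def)
  from wact_transpose [OF this, of t "\<lambda>w. cnj (t' w)"] show ?thesis
    by (simp add: winner_def cnj_wact)
qed

text \<open>The order of a tensor cannot be part of its type, so all tensor powers live on
  \<open>3 list\<close>; requiring zero off the words of the right length makes the space
  finite-dimensional.\<close>

definition word_rep :: "bool list \<Rightarrow> 3 list rep" where
  "word_rep sg = \<lparr>rep_space = {t. \<forall>w. length w \<noteq> length sg \<longrightarrow> t w = 0}, rep_act = wact sg\<rparr>"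

lemma rep_act_word [simp]: "rep_act (word_rep sg) = wact sg"
  by (simp add: word_rep_def)

lemma in_word_rep: "t \<in> rep_space (word_rep sg) \<longleftrightarrow> (\<forall>w. length w \<noteq> length sg \<longrightarrow> t w = 0)"
  by (simp add: word_rep_def)

definition delta :: "'a \<Rightarrow> 'a \<Rightarrow> complex" where
  "delta a b = (if b = a then 1 else 0)"

lemma wact_length: "(\<And>u. length u \<noteq> length sg \<Longrightarrow> t u = 0) \<Longrightarrow> length w \<noteq> length sg \<Longrightarrow> wact sg x t w = 0"
  by (induction sg x t w rule: wact.induct) auto

lemma word_rep_expand:
  assumes "t \<in> rep_space (word_rep sg)"
  shows "t = (\<Sum>w\<in>words (length sg). fun_scale (t w) (delta w))"
  using assms
  by (auto simp: fun_eq_iff sum_fun_apply delta_def in_word_rep if_distrib cong: if_cong)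
    (auto simp: words_def)

lemma delta_in_word_rep: "delta w \<in> rep_space (word_rep sg) \<longleftrightarrow> length w = length sg"
  by (auto simp: in_word_rep delta_def)

lemma word_rep_span: "rep_space (word_rep sg) = cfun.span (delta ` words (length sg))"
proof
  show "rep_space (word_rep sg) \<subseteq> cfun.span (delta ` words (length sg))"
  proof
    fix t assume t: "t \<in> rep_space (word_rep sg)"
    show "t \<in> cfun.span (delta ` words (length sg))"
      by (subst word_rep_expand [OF t])
        (intro cfun.span_sum cfun.span_scale cfun.span_base, auto)
  qed
  show "cfun.span (delta ` words (length sg)) \<subseteq> rep_space (word_rep sg)"
  proof (rule cfun.span_minimal)
    show "cfun.subspace (rep_space (word_rep sg))"
      by (auto simp: cfun.subspace_def in_word_rep)
    show "delta ` words (length sg) \<subseteq> rep_space (word_rep sg)"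
      by (auto simp: delta_in_word_rep words_def)
  qed
qed

lemma sl3_module_word_rep: "sl3_module (word_rep sg)"
proof
  show "cfun.subspace (rep_space (word_rep sg))"
    by (simp add: word_rep_span)
  show "\<exists>B. finite B \<and> rep_space (word_rep sg) = cfun.span B"
    using word_rep_span by (intro exI [of _ "delta ` words (length sg)"]) simp
next
  fix x v assume "v \<in> rep_space (word_rep sg)"
  then show "rep_act (word_rep sg) x v \<in> rep_space (word_rep sg)"
    by (auto simp: in_word_rep intro: wact_length)
next
  fix x :: "complex^3^3" and v w :: "3 list \<Rightarrow> complex"
  show "rep_act (word_rep sg) x (v + w) = rep_act (word_rep sg) x v + rep_act (word_rep sg) x w"
    using wact_add [of sg x v w] by (simp add: fun_eq_iff plus_fun_def)
next
  fix x c v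
  show "rep_act (word_rep sg) x (fun_scale c v) = fun_scale c (rep_act (word_rep sg) x v)"
    using wact_scale [of sg x c v] by (simp add: fun_eq_iff fun_scale_def)
qed (simp_all add: fun_eq_iff add_wact scale_wact bracket_wact)

interpretation word: unitary_module "word_rep sg" "winner (length sg)" for sg
proof -
  interpret sl3_module "word_rep sg" by (rule sl3_module_word_rep)
  show "unitary_module (word_rep sg) (winner (length sg))"
  proof
    fix v assume v: "v \<in> rep_space (word_rep sg)" "winner (length sg) v v = 0"
    have "v w * cnj (v w) = complex_of_real ((cmod (v w))\<^sup>2)" for w
      using complex_norm_square [of "v w"] by simp
    then have "(\<Sum>w\<in>words (length sg). complex_of_real ((cmod (v w))\<^sup>2)) = 0"
      using v(2) by (simp add: winner_def)
    then have "complex_of_real (\<Sum>w\<in>words (length sg). (cmod (v w))\<^sup>2) = 0"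
      by simp
    then have "(\<Sum>w\<in>words (length sg). (cmod (v w))\<^sup>2) = 0"
      by (simp only: of_real_eq_0_iff)
    then have "\<forall>w\<in>words (length sg). (cmod (v w))\<^sup>2 = 0"
      by (subst (asm) sum_nonneg_eq_0_iff) auto
    then show "v = 0"
      using v(1) by (auto simp: fun_eq_iff in_word_rep words_def)
  next
    fix x v w
    show "winner (length sg) (rep_act (word_rep sg) x v) w
      = winner (length sg) v (rep_act (word_rep sg) (adjoint_matrix x) w)"
      by (simp add: winner_adjoint)
  qed (simp_all add: winner_def distrib_right sum.distrib sum_distrib_left mult.assoc,
      simp add: mult.commute)
qed

fun wweight :: "bool list \<Rightarrow> complex^3^3 \<Rightarrow> 3 list \<Rightarrow> complex" where
  "wweight [] h w = 0"
| "wweight (s # sg) h [] = 0"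
| "wweight (s # sg) h (i # w) = slot s h i i + wweight sg h w"

lemma wact_diagonal:
  assumes h: "\<And>i j. i \<noteq> j \<Longrightarrow> h $ i $ j = 0" and "length w = length sg"
  shows "wact sg h t w = wweight sg h w * t w"
  using assms(2)
proof (induction sg arbitrary: t w)
  case (Cons s sg)
  then obtain i v where w: "w = i # v" "length v = length sg" by (cases w) auto
  have "(\<Sum>j\<in>UNIV. slot s h i j * t (j # v)) = (\<Sum>j\<in>{i}. slot s h i j * t (j # v))"
    by (rule sum.mono_neutral_right) (auto simp: slot_def h)
  then show ?case using Cons.IH [OF w(2)] by (simp add: w distrib_right)
qed simp

text \<open>The dual basis covector with index i has minus the weight of the i-th basis vector, so
  the highest covector is the one with index 3. Reversing the order of the indices gives the lowest
  word.\<close>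

definition high_word :: "bool list \<Rightarrow> 3 list" where
  "high_word sg = map (\<lambda>s. if s then 1 else 3) sg"

lemma length_high_word [simp]: "length (high_word sg) = length sg"
  by (simp add: high_word_def)

definition low_word :: "bool list \<Rightarrow> 3 list" where
  "low_word sg = map (\<lambda>s. if s then 3 else 1) sg"

lemma length_low_word [simp]: "length (low_word sg) = length sg"
  by (simp add: low_word_def)

lemma wact_delta_map:
  assumes z: "\<And>s k. slot s x k (f s) = 0"
  shows "wact sg x (delta (map f sg)) = 0"
proof
  fix w
  show "wact sg x (delta (map f sg)) w = 0 w"
  proof (induction sg arbitrary: w)
    case (Cons s sg)
    show ?case
    proof (cases w)
      case (Cons k v)
      have "(\<lambda>u. delta (map f (s # sg)) (k # u)) = (\<lambda>u. (if k = f s then 1 else 0) * delta (map f sg) u)"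
        by (auto simp: delta_def)
      then have "wact sg x (\<lambda>u. delta (map f (s # sg)) (k # u)) v = 0"
        using Cons.IH by (simp only: wact_scale) simp
      moreover have "slot s x k l * delta (map f (s # sg)) (l # v) = 0" for l
        using z by (auto simp: delta_def)
      ultimately show ?thesis by (simp only: Cons wact.simps sum.neutral_const) simp
    qed simp
  qed simp
qed

lemma wact_raise_high: "j \<noteq> 1 \<Longrightarrow> i \<noteq> 3 \<Longrightarrow> wact sg (matrix_unit i j) (delta (high_word sg)) = 0"
  unfolding high_word_def by (rule wact_delta_map) (auto simp: slot_def)

lemma wact_lower_low: "j \<noteq> 3 \<Longrightarrow> i \<noteq> 1 \<Longrightarrow> wact sg (matrix_unit i j) (delta (low_word sg)) = 0"
  unfolding low_word_def by (rule wact_delta_map) (auto simp: slot_def)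

text \<open>The counterpart of \<open>wact_raise_high\<close> for functionals: a lowering operator
  never produces the highest word, so the coordinate at that word kills its image.\<close>

lemma wact_lower_high_coordinate:
  assumes "i \<noteq> 1" "j \<noteq> 3"
  shows "wact sg (matrix_unit i j) t (high_word sg) = 0"
proof (induction sg arbitrary: t)
  case (Cons s sg)
  have "slot s (matrix_unit i j) (if s then 1 else 3) l = 0" for l
    using assms by (auto simp: slot_def)
  then show ?case using Cons by (simp add: high_word_def)
qed (simp add: high_word_def)

lemma wact_diagonal_delta:
  assumes "h \<in> cartan" "length w = length sg"
  shows "wact sg h (delta w) = fun_scale (wweight sg h w) (delta w)"
proof
  fix u
  have h: "\<And>i j. i \<noteq> j \<Longrightarrow> h $ i $ j = 0" using assms by (simp add: cartan_def)
  show "wact sg h (delta w) u = fun_scale (wweight sg h w) (delta w) u"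
  proof (cases "length u = length sg")
    case True
    then show ?thesis using wact_diagonal [OF h True, where t = "delta w"] by (auto simp: delta_def)
  next
    case False
    then show ?thesis using assms by (subst wact_length) (auto simp: delta_def)
  qed
qed

lemma wweight_high_word:
  assumes "h \<in> cartan"
  shows "wweight sg h (high_word sg) = weight_eval (count_list sg True, count_list sg False) h"
proof (induction sg)
  case (Cons s sg)
  \<comment> \<open>By tracelessness minus the third diagonal entry is the second fundamental
    weight, which is why a covector slot counts towards it.\<close>
  have "h $ 3 $ 3 = - h $ 1 $ 1 - h $ 2 $ 2"
    using assms by (simp add: cartan_def sl3_def trace_def sum_3 eq_neg_iff_add_eq_0 algebra_simps)
  then show ?case
    using Cons by (simp add: high_word_def slot_def weight_eval_def fund_weight1_def fund_weight2_def algebra_simps)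
qed (simp add: weight_eval_def)

section \<open>Highest weight theory\<close>

lemma cartan_offdiag: "h \<in> cartan \<Longrightarrow> i \<noteq> j \<Longrightarrow> h $ i $ j = 0"
  by (simp add: cartan_def)

lemma bracket_cartan:
  assumes h: "h \<in> cartan"
  shows "lie_bracket h (matrix_unit k l) = matrix_scale (h $ k $ k - h $ l $ l) (matrix_unit k l)"
proof -
  have "(\<Sum>p\<in>UNIV. h $ m $ p * matrix_unit k l $ p $ n) = (\<Sum>p\<in>{k}. h $ m $ p * matrix_unit k l $ p $ n)" for m n
    by (rule sum.mono_neutral_right) auto
  moreover have "(\<Sum>p\<in>UNIV. matrix_unit k l $ m $ p * h $ p $ n) = (\<Sum>p\<in>{l}. matrix_unit k l $ m $ p * h $ p $ n)" for m n
    by (rule sum.mono_neutral_right) auto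
  ultimately show ?thesis
    by (auto simp: vec_eq_iff lie_bracket_def matrix_matrix_mult_def cartan_offdiag [OF h])
qed

context sl3_module
begin

lemma weight_shift:
  assumes "h \<in> cartan" "k \<noteq> l" "t \<in> rep_space M"
  shows "rep_act M h (rep_act M (matrix_unit k l) t) = rep_act M (matrix_unit k l) (rep_act M h t)
    + fun_scale (h $ k $ k - h $ l $ l) (rep_act M (matrix_unit k l) t)"
proof -
  have "rep_act M (lie_bracket h (matrix_unit k l)) t
    = rep_act M h (rep_act M (matrix_unit k l) t) - rep_act M (matrix_unit k l) (rep_act M h t)"
    using assms by (intro bracket_act) (auto simp: cartan_sl3)
  moreover have "rep_act M (lie_bracket h (matrix_unit k l)) t
    = fun_scale (h $ k $ k - h $ l $ l) (rep_act M (matrix_unit k l) t)"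
    using assms by (simp add: bracket_cartan scale_act)
  ultimately show ?thesis by (simp add: algebra_simps)
qed

text \<open>The least such subspace plays the role of U(n^-) v. The ordering \<open>a\<close>,
  \<open>b\<close>, \<open>c\<close> selects the Borel subalgebra: 1, 2, 3 is the upper triangular
  one, 3, 2, 1 the lower triangular one.\<close>

definition lowering_closed :: "3 \<Rightarrow> 3 \<Rightarrow> 3 \<Rightarrow> ('i \<Rightarrow> complex) \<Rightarrow> ('i \<Rightarrow> complex) set \<Rightarrow> bool" where
  "lowering_closed a b c v K \<longleftrightarrow> cfun.subspace K \<and> K \<subseteq> rep_space M \<and> v \<in> K \<and>
     (\<forall>t\<in>K. rep_act M (matrix_unit b a) t \<in> K \<and> rep_act M (matrix_unit c b) t \<in> K)"

definition lowering_span :: "3 \<Rightarrow> 3 \<Rightarrow> 3 \<Rightarrow> ('i \<Rightarrow> complex) \<Rightarrow> ('i \<Rightarrow> complex) set" where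
  "lowering_span a b c v = \<Inter> {K. lowering_closed a b c v K}"

lemma lowering_span_closed:
  assumes "distinct [a, b, c]" "v \<in> rep_space M"
  shows "lowering_closed a b c v (lowering_span a b c v)"
proof -
  have top: "lowering_closed a b c v (rep_space M)"
    using assms subspace by (auto simp: lowering_closed_def act_closed)
  have "cfun.subspace (lowering_span a b c v)"
    unfolding lowering_span_def by (rule cfun.subspace_Inter) (auto simp: lowering_closed_def)
  moreover have "lowering_span a b c v \<subseteq> rep_space M"
    using top by (auto simp: lowering_span_def)
  ultimately show ?thesis
    by (auto simp: lowering_span_def lowering_closed_def)
qed

lemma lowering_span_least: "lowering_closed a b c v K \<Longrightarrow> lowering_span a b c v \<subseteq> K"
  by (auto simp: lowering_span_def)

text \<open>The commutation part of the PBW argument, carried out by minimality: the elements of the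
  span that an operator maps back into the span again form a lowering closed subspace containing
  \<open>v\<close>, hence they are everything.\<close>

lemma submodule_lowering_span:
  assumes d: "distinct [a, b, c]" and v: "v \<in> rep_space M"
    and e: "rep_act M (matrix_unit a b) v = 0" "rep_act M (matrix_unit b c) v = 0"
    and h: "\<And>h. h \<in> cartan \<Longrightarrow> \<exists>r. rep_act M h v = fun_scale r v"
  shows "submodule (lowering_span a b c v) M"
proof -
  define L where "L = lowering_span a b c v"
  note cl = lowering_span_closed [OF d v, folded L_def]
  have L: "cfun.subspace L" "L \<subseteq> rep_space M" "v \<in> L"
    and f: "\<And>t. t \<in> L \<Longrightarrow> rep_act M (matrix_unit b a) t \<in> L"
    "\<And>t. t \<in> L \<Longrightarrow> rep_act M (matrix_unit c b) t \<in> L"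
    using cl by (auto simp: lowering_closed_def)
  have LM: "t \<in> L \<Longrightarrow> t \<in> rep_space M" for t using L(2) by auto
  have ne: "a \<noteq> b" "b \<noteq> a" "b \<noteq> c" "c \<noteq> b" "a \<noteq> c" "c \<noteq> a" using d by auto
  note L0 = cfun.subspace_0 [OF L(1)] and Ladd = cfun.subspace_add [OF L(1)]
    and Lscale = cfun.subspace_scale [OF L(1)]
  \<comment> \<open>The Cartan part has to precede the raising operators, since commuting a raising
    past a lowering operator leaves a coroot.\<close>
  have hL: "rep_act M h t \<in> L" if hc: "h \<in> cartan" and t: "t \<in> L" for h t
  proof -
    note hs = cartan_sl3 [OF hc]
    have "lowering_closed a b c v {t \<in> L. rep_act M h t \<in> L}"
      unfolding lowering_closed_def
    proof (intro conjI ballI)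
      show "cfun.subspace {t \<in> L. rep_act M h t \<in> L}"
        unfolding cfun.subspace_def
        by (auto simp: L0 Ladd Lscale act_zero [OF hs] act_add [OF hs] act_scale [OF hs] LM)
      show "v \<in> {t \<in> L. rep_act M h t \<in> L}"
        using h [OF hc] L(3) by (auto simp: Lscale)
      fix t assume t: "t \<in> {t \<in> L. rep_act M h t \<in> L}"
      show "rep_act M (matrix_unit b a) t \<in> {t \<in> L. rep_act M h t \<in> L}"
        "rep_act M (matrix_unit c b) t \<in> {t \<in> L. rep_act M h t \<in> L}"
        using t by (auto simp: f weight_shift [OF hc] ne LM intro!: Ladd Lscale)
    qed (use L in auto)
    from lowering_span_least [OF this] show ?thesis using t by (auto simp: L_def)
  qed
  have comm: "rep_act M (matrix_unit i j) (rep_act M (matrix_unit k l) t)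
    = rep_act M (matrix_unit k l) (rep_act M (matrix_unit i j) t)
      + rep_act M (lie_bracket (matrix_unit i j) (matrix_unit k l)) t"
    if "t \<in> L" "i \<noteq> j" "k \<noteq> l" for i j k l t
    using bracket_act [of "matrix_unit i j" "matrix_unit k l" t] that LM by (simp add: algebra_simps)
  let ?K = "{t \<in> L. rep_act M (matrix_unit a b) t \<in> L \<and> rep_act M (matrix_unit b c) t \<in> L}"
  have "lowering_closed a b c v ?K"
    unfolding lowering_closed_def
  proof (intro conjI ballI)
    show "cfun.subspace ?K"
      unfolding cfun.subspace_def using ne
      by (auto simp: L0 Ladd Lscale act_zero act_add act_scale LM)
    show "v \<in> ?K" using L(3) L0 e by simp
    fix t assume t: "t \<in> ?K"
    have tL: "t \<in> L" and te: "rep_act M (matrix_unit a b) t \<in> L" "rep_act M (matrix_unit b c) t \<in> L"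
      using t by auto
    have br: "lie_bracket (matrix_unit a b) (matrix_unit b a) = coroot a b"
      "lie_bracket (matrix_unit b c) (matrix_unit c b) = coroot b c"
      "lie_bracket (matrix_unit a b) (matrix_unit c b) = 0"
      "lie_bracket (matrix_unit b c) (matrix_unit b a) = 0"
      using ne by (auto simp: lie_bracket_matrix_unit coroot_def)
    have "rep_act M (matrix_unit a b) (rep_act M (matrix_unit b a) t) \<in> L"
      "rep_act M (matrix_unit b c) (rep_act M (matrix_unit b a) t) \<in> L"
      unfolding comm [OF tL ne(1) ne(2)] comm [OF tL ne(3) ne(2)] br zero_act [OF LM [OF tL]]
      using te tL by (auto intro!: Ladd f hL L0)
    then show "rep_act M (matrix_unit b a) t \<in> ?K" using f(1) [OF tL] by simp
    have "rep_act M (matrix_unit a b) (rep_act M (matrix_unit c b) t) \<in> L"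
      "rep_act M (matrix_unit b c) (rep_act M (matrix_unit c b) t) \<in> L"
      unfolding comm [OF tL ne(1) ne(4)] comm [OF tL ne(3) ne(4)] br zero_act [OF LM [OF tL]]
      using te tL by (auto intro!: Ladd f hL L0)
    then show "rep_act M (matrix_unit c b) t \<in> ?K" using f(2) [OF tL] by simp
  qed (use L in auto)
  from lowering_span_least [OF this, folded L_def]
  have "submodule L M"
    using L f by (intro submoduleI [OF d]) auto
  then show ?thesis by (simp add: L_def)
qed

text \<open>\<open>peel r n\<close> is \<open>(h - r + n) \<cdots> (h - r + 1)\<close> for \<open>h = diag(1, 0, -1)\<close>: it annihilates
  what lies at most \<open>n\<close> steps below eigenvalue \<open>r\<close> and is invertible on eigenvalue \<open>r\<close>.\<close>

primrec peel :: "complex \<Rightarrow> nat \<Rightarrow> ('i \<Rightarrow> complex) \<Rightarrow> ('i \<Rightarrow> complex)" where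
  "peel r 0 t = t"
| "peel r (Suc n) t = rep_act M (coroot 1 3) (peel r n t) + fun_scale (of_nat (Suc n) - r) (peel r n t)"

lemma peel_0: "peel r 0 t = t"
  by simp

lemma peel_Suc: "peel r (Suc n) t
    = rep_act M (coroot 1 3) (peel r n t) + fun_scale (of_nat (Suc n) - r) (peel r n t)"
  by simp

declare peel.simps [simp del] peel_0 [simp] peel_Suc [simp]

lemma peel_in: "t \<in> rep_space M \<Longrightarrow> peel r n t \<in> rep_space M"
  by (induction n) (auto simp: act_closed add_in scale_in)

lemma peel_add: "s \<in> rep_space M \<Longrightarrow> t \<in> rep_space M \<Longrightarrow> peel r n (s + t) = peel r n s + peel r n t"
  by (induction n) (auto simp: act_add peel_in cfun.scale_right_distrib)

lemma peel_scale: "t \<in> rep_space M \<Longrightarrow> peel r n (fun_scale z t) = fun_scale z (peel r n t)"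
  by (induction n) (auto simp: act_scale peel_in cfun.scale_right_distrib mult.commute)

lemma peel_mono: "peel r n t = 0 \<Longrightarrow> peel r (n + k) t = 0"
  by (induction k) (auto simp: act_zero)

text \<open>With h = diag(1, 0, -1), both simple lowering operators decrease the eigenvalue by 1.
  Moving one of them to the left replaces each factor h - r + m by h - r + m - 1, so the factor for
  m = 1 turns into h - r and the others form a shorter product.\<close>

lemma peel_lower:
  assumes t: "t \<in> rep_space M" and ij: "(i, j) \<in> {(2, 1), (3, 2)}"
  shows "peel r (Suc n) (rep_act M (matrix_unit i j) t)
    = rep_act M (matrix_unit i j) (rep_act M (coroot 1 3) (peel r n t) - fun_scale r (peel r n t))"
proof (induction n)
  have ne: "i \<noteq> j" and w: "coroot 1 3 $ i $ i - coroot 1 3 $ j $ j = -1" using ij by auto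
  have shift: "rep_act M (coroot 1 3) (rep_act M (matrix_unit i j) s)
      = rep_act M (matrix_unit i j) (rep_act M (coroot 1 3) s) - rep_act M (matrix_unit i j) s"
    if "s \<in> rep_space M" for s
    using weight_shift [OF coroot_cartan ne that, of 1 3] by (simp only: w) (simp add: fun_eq_iff)
  {
    case 0
    have "rep_act M (coroot 1 3) (rep_act M (matrix_unit i j) t)
        + fun_scale (of_nat (Suc 0) - r) (rep_act M (matrix_unit i j) t)
      = rep_act M (matrix_unit i j) (rep_act M (coroot 1 3) t - fun_scale r t)"
      by (simp add: act_diff act_scale scale_in act_closed t ne shift)
        (rule ext, simp add: algebra_simps)
    then show ?case unfolding peel_0 peel_Suc .
  next
    case (Suc n)
    let ?s = "peel r n t" and ?h = "rep_act M (coroot 1 3)" and ?f = "rep_act M (matrix_unit i j)"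
    have s: "?s \<in> rep_space M" "?h ?s \<in> rep_space M" "?h (?h ?s) \<in> rep_space M"
      using t by (simp_all add: peel_in act_closed)
    have X: "?h ?s - fun_scale r ?s \<in> rep_space M" using s by (simp add: diff_in scale_in)
    have IH: "peel r (Suc n) (?f t) = ?f (?h ?s - fun_scale r ?s)" using Suc .
    have "peel r (Suc (Suc n)) (?f t)
      = ?h (?f (?h ?s - fun_scale r ?s)) + fun_scale (of_nat (Suc (Suc n)) - r) (?f (?h ?s - fun_scale r ?s))"
      unfolding peel_Suc [of r "Suc n" "?f t"] IH ..
    also have "\<dots> = ?f (?h (?h ?s - fun_scale r ?s)) - ?f (?h ?s - fun_scale r ?s)
        + fun_scale (of_nat (Suc (Suc n)) - r) (?f (?h ?s - fun_scale r ?s))"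
      using shift [OF X] by simp
    also have "\<dots> = ?f (?h (?h ?s + fun_scale (of_nat (Suc n) - r) ?s)
        - fun_scale r (?h ?s + fun_scale (of_nat (Suc n) - r) ?s))"
      by (simp del: of_nat_Suc add: act_diff act_add act_scale scale_in add_in diff_in act_closed s ne)
        (rule ext, simp add: algebra_simps)
    finally show ?case unfolding peel_Suc .
  }
qed

lemma peel_eigen:
  assumes "rep_act M (coroot 1 3) t = fun_scale r t" "t \<in> rep_space M"
  shows "peel r n t = fun_scale (fact n) t"
proof (induction n)
  case (Suc n)
  have "rep_act M (coroot 1 3) (fun_scale (fact n) t) + fun_scale (of_nat (Suc n) - r) (fun_scale (fact n) t)
      = fun_scale (fact (Suc n)) t"
    by (simp add: act_scale assms) (rule ext, simp add: algebra_simps)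
  then show ?case unfolding peel_Suc Suc .
qed simp

text \<open>Everything strictly below the top is annihilated by some \<open>peel\<close>, and the
  top itself is the line of \<open>v\<close>. Annihilating polynomials replace weight spaces here,
  because the coroot is not known to act diagonalizably on an abstract module.\<close>

lemma lowering_span_top:
  assumes v: "v \<in> rep_space M" "rep_act M (coroot 1 3) v = fun_scale r v"
    and t: "t \<in> lowering_span 1 2 3 v" "rep_act M (coroot 1 3) t = fun_scale r t"
  shows "\<exists>z. t = fun_scale z v"
proof -
  define Z where "Z = {t \<in> rep_space M. \<exists>n. peel r n t = 0}"
  have ZI: "t \<in> Z" if "t \<in> rep_space M" "peel r n t = 0" for t n using that by (auto simp: Z_def)
  have Z0: "0 \<in> Z" using ZI [OF zero_in, of 0] by simp
  have Zscale: "fun_scale z t \<in> Z" if "t \<in> Z" for z t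
    using that by (auto simp: Z_def scale_in peel_scale)
  have Zadd: "s + t \<in> Z" if st: "s \<in> Z" "t \<in> Z" for s t
  proof -
    obtain m where m: "peel r m s = 0" using st(1) unfolding Z_def by blast
    obtain n where n: "peel r n t = 0" using st(2) unfolding Z_def by blast
    show ?thesis using st peel_mono [OF m, of n] peel_mono [OF n, of m]
      by (intro ZI [of _ "m + n"]) (auto simp: Z_def add_in peel_add add.commute)
  qed
  have Zlow: "rep_act M (matrix_unit i j) t \<in> Z" if tZ: "t \<in> Z" and that: "(i, j) \<in> {(2, 1), (3, 2)}" for i j t
  proof -
    obtain n where n: "peel r n t = 0" and tM: "t \<in> rep_space M" using tZ by (auto simp: Z_def)
    have "peel r (Suc n) (rep_act M (matrix_unit i j) t) = 0"
      unfolding peel_lower [OF tM that] n using that by (auto simp: act_zero)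
    then show ?thesis using that tM by (intro ZI [of _ "Suc n"]) (auto simp: act_closed)
  qed
  have vlow: "rep_act M (matrix_unit i j) v \<in> Z" if "(i, j) \<in> {(2, 1), (3, 2)}" for i j
  proof -
    have "peel r (Suc 0) (rep_act M (matrix_unit i j) v) = 0"
      unfolding peel_lower [OF v(1) that] using that v by (auto simp: act_zero)
    then show ?thesis using that v by (intro ZI [of _ "Suc 0"]) (auto simp: act_closed)
  qed
  \<comment> \<open>The line of \<open>v\<close> plus the lower part \<open>Z\<close>: lowering
    sends \<open>v\<close> and \<open>Z\<close> into \<open>Z\<close>, so \<open>K\<close> is
    lowering closed and contains the whole span.\<close>
  define K where "K = {t \<in> rep_space M. \<exists>z. t - fun_scale z v \<in> Z}"
  have Klow: "rep_act M (matrix_unit i j) t \<in> K" if tK: "t \<in> K" and that: "(i, j) \<in> {(2, 1), (3, 2)}" for i j t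
  proof -
    obtain z where z: "t - fun_scale z v \<in> Z" and tM: "t \<in> rep_space M" using tK by (auto simp: K_def)
    have ij: "matrix_unit i j \<in> sl3" using that by auto
    have "rep_act M (matrix_unit i j) t
      = rep_act M (matrix_unit i j) (t - fun_scale z v) + fun_scale z (rep_act M (matrix_unit i j) v)"
      using tM v ij by (simp add: act_diff act_scale scale_in)
    also have "\<dots> \<in> Z" by (rule Zadd [OF Zlow [OF z that] Zscale [OF vlow [OF that]]])
    finally have "rep_act M (matrix_unit i j) t - fun_scale 0 v \<in> Z" by simp
    then show ?thesis unfolding K_def using act_closed [OF ij tM] by blast
  qed
  have "lowering_closed 1 2 3 v K"
    unfolding lowering_closed_def
  proof (intro conjI ballI)
    have "0 \<in> K" unfolding K_def using Z0 by (intro CollectI conjI exI [of _ 0]) auto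
    moreover have "s + t \<in> K" if st: "s \<in> K" "t \<in> K" for s t
    proof -
      obtain y z where "s - fun_scale y v \<in> Z" "t - fun_scale z v \<in> Z" using st unfolding K_def by blast
      then have "(s - fun_scale y v) + (t - fun_scale z v) \<in> Z" by (rule Zadd)
      moreover have "(s - fun_scale y v) + (t - fun_scale z v) = (s + t) - fun_scale (y + z) v"
        by (rule ext) (simp add: algebra_simps)
      ultimately have "(s + t) - fun_scale (y + z) v \<in> Z" by simp
      then show ?thesis using st unfolding K_def by (auto simp: add_in)
    qed
    moreover have "fun_scale y t \<in> K" if tK: "t \<in> K" for y t
    proof -
      obtain z where "t - fun_scale z v \<in> Z" using tK unfolding K_def by blast
      then have "fun_scale y (t - fun_scale z v) \<in> Z" by (rule Zscale)
      moreover have "fun_scale y (t - fun_scale z v) = fun_scale y t - fun_scale (y * z) v"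
        by (rule ext) (simp add: algebra_simps)
      ultimately have "fun_scale y t - fun_scale (y * z) v \<in> Z" by simp
      then show ?thesis using tK unfolding K_def by (auto simp: scale_in)
    qed
    ultimately show "cfun.subspace K" by (simp add: cfun.subspace_def)
    show "v \<in> K" unfolding K_def using Z0 v(1) by (intro CollectI conjI exI [of _ 1]) auto
  qed (auto simp: Klow, auto simp: K_def)
  then have "t \<in> K" using lowering_span_least t(1) by blast
  then obtain z n where z: "peel r n (t - fun_scale z v) = 0" and tM: "t \<in> rep_space M"
    by (auto simp: K_def Z_def)
  have "rep_act M (coroot 1 3) (t - fun_scale z v) = fun_scale r (t - fun_scale z v)"
    by (simp add: act_diff act_scale scale_in tM v t(2)) (rule ext, simp add: algebra_simps)
  then have "fun_scale (fact n) (t - fun_scale z v) = 0"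
    using z peel_eigen tM v(1) by (simp add: diff_in scale_in)
  then have "t = fun_scale z v" by (simp add: fun_eq_iff)
  then show ?thesis ..
qed

end

section \<open>Direct sums and the uniqueness of an irreducible module with a given highest
  weight\<close>

definition dsum_rep :: "'i rep \<Rightarrow> 'j rep \<Rightarrow> ('i + 'j) rep" where
  "dsum_rep M N = \<lparr>rep_space = {t. t \<circ> Inl \<in> rep_space M \<and> t \<circ> Inr \<in> rep_space N},
     rep_act = (\<lambda>x t. case_sum (rep_act M x (t \<circ> Inl)) (rep_act N x (t \<circ> Inr)))\<rparr>"

lemma fun_comp_simps:
  "(s + t) \<circ> g = (s \<circ> g) + (t \<circ> g)" "fun_scale c t \<circ> g = fun_scale c (t \<circ> g)"
  "(s - t) \<circ> g = (s \<circ> g) - (t \<circ> g)" "(0 :: 'i \<Rightarrow> complex) \<circ> g = 0"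
  for s t :: "'i \<Rightarrow> complex"
  by (auto simp: fun_eq_iff)

lemma sum_fun_eqI:
  assumes "s \<circ> Inl = t \<circ> Inl" "s \<circ> Inr = t \<circ> Inr"
  shows "s = t"
proof
  fix x show "s x = t x"
    by (cases x) (use fun_cong [OF assms(1)] fun_cong [OF assms(2)] in simp_all)
qed

lemma in_dsum_rep: "t \<in> rep_space (dsum_rep M N) \<longleftrightarrow> t \<circ> Inl \<in> rep_space M \<and> t \<circ> Inr \<in> rep_space N"
  by (simp add: dsum_rep_def)

lemma dsum_act:
  "rep_act (dsum_rep M N) x t \<circ> Inl = rep_act M x (t \<circ> Inl)"
  "rep_act (dsum_rep M N) x t \<circ> Inr = rep_act N x (t \<circ> Inr)"
  by (simp_all add: dsum_rep_def case_sum_o_inj)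

lemma sl3_module_dsum:
  assumes "sl3_module M" "sl3_module N"
  shows "sl3_module (dsum_rep M N)"
proof -
  interpret M: sl3_module M by fact
  interpret N: sl3_module N by fact
  have sub: "cfun.subspace (rep_space (dsum_rep M N))"
    by (auto simp: cfun.subspace_def dsum_rep_def fun_comp_simps M.add_in N.add_in M.scale_in N.scale_in)
  obtain B C where B: "finite B" "rep_space M = cfun.span B" and C: "finite C" "rep_space N = cfun.span C"
    using M.finite_dim N.finite_dim by blast
  define D where "D = (\<lambda>b. case_sum b 0) ` B \<union> (\<lambda>c. case_sum 0 c) ` C"
  have BD: "cfun.span B \<subseteq> {b. case_sum b 0 \<in> cfun.span D}"
  proof (rule cfun.span_minimal)
    have "case_sum (b + b') 0 = case_sum b 0 + case_sum b' (0 :: 'b \<Rightarrow> complex)"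
      "case_sum (fun_scale c b) 0 = fun_scale c (case_sum b (0 :: 'b \<Rightarrow> complex))"
      "case_sum 0 0 = (0 :: 'a + 'b \<Rightarrow> complex)" for b b' :: "'a \<Rightarrow> complex" and c
      by (auto simp: fun_eq_iff split: sum.split)
    then show "cfun.subspace {b. case_sum b 0 \<in> cfun.span D}"
      by (auto simp: cfun.subspace_def cfun.span_zero intro: cfun.span_add cfun.span_scale)
  qed (auto simp: D_def intro: cfun.span_base)
  have CD: "cfun.span C \<subseteq> {b. case_sum 0 b \<in> cfun.span D}"
  proof (rule cfun.span_minimal)
    have "case_sum 0 (b + b') = case_sum 0 b + case_sum (0 :: 'a \<Rightarrow> complex) b'"
      "case_sum 0 (fun_scale c b) = fun_scale c (case_sum (0 :: 'a \<Rightarrow> complex) b)"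
      "case_sum 0 0 = (0 :: 'a + 'b \<Rightarrow> complex)" for b b' :: "'b \<Rightarrow> complex" and c
      by (auto simp: fun_eq_iff split: sum.split)
    then show "cfun.subspace {b. case_sum 0 b \<in> cfun.span D}"
      by (auto simp: cfun.subspace_def cfun.span_zero intro: cfun.span_add cfun.span_scale)
  qed (auto simp: D_def intro: cfun.span_base)
  have "rep_space (dsum_rep M N) \<subseteq> cfun.span D"
  proof
    fix t :: "'a + 'b \<Rightarrow> complex" assume "t \<in> rep_space (dsum_rep M N)"
    then have "t \<circ> Inl \<in> cfun.span B" "t \<circ> Inr \<in> cfun.span C"
      using B(2) C(2) by (simp_all add: in_dsum_rep)
    then have "case_sum (t \<circ> Inl) 0 + case_sum 0 (t \<circ> Inr) \<in> cfun.span D"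
      using BD CD by (intro cfun.span_add) auto
    moreover have "t = case_sum (t \<circ> Inl) 0 + case_sum 0 (t \<circ> Inr)"
      by (rule sum_fun_eqI) (simp_all add: fun_comp_simps case_sum_o_inj)
    ultimately show "t \<in> cfun.span D" by simp
  qed
  then have fin: "\<exists>B. finite B \<and> rep_space (dsum_rep M N) = cfun.span B"
    using finite_dim_subspace [OF sub, of D] B C by (simp add: D_def)
  show ?thesis
  proof
    show "cfun.subspace (rep_space (dsum_rep M N))" by (rule sub)
    show "\<exists>B. finite B \<and> rep_space (dsum_rep M N) = cfun.span B" by (rule fin)
  qed (auto intro!: sum_fun_eqI simp: in_dsum_rep dsum_act fun_comp_simps M.act_closed N.act_closed
      M.act_add N.act_add M.act_scale N.act_scale M.add_act N.add_act M.scale_act N.scale_act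
      M.bracket_act N.bracket_act)
qed

lemma highest_weight_vectorD:
  assumes "highest_weight_vector M lam v"
  shows "v \<in> rep_space M" "v \<noteq> 0" "rep_act M (matrix_unit 1 2) v = 0" "rep_act M (matrix_unit 2 3) v = 0"
    and "h \<in> cartan \<Longrightarrow> rep_act M h v = fun_scale (weight_eval lam h) v" "rep_act M (matrix_unit 1 3) v = 0"
  using assms by (auto simp: highest_weight_vector_def)

lemma submodule_top:
  assumes "irreducible_module M" "submodule U M" "v \<in> U" "v \<noteq> 0"
  shows "U = rep_space M"
  using assms unfolding irreducible_module_def by blast

text \<open>\<open>f\<close> and \<open>g\<close> are the two projections of a submodule of a direct
  sum. The kernel of \<open>f\<close> is mapped by \<open>g\<close> onto a submodule of
  \<open>N\<close> that misses \<open>w\<close>, hence onto zero by irreducibility; as the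
  projections are jointly injective, \<open>f\<close> is injective.\<close>

lemma graph_projection:
  assumes L: "sl3_module L" and irr: "irreducible_module M" "irreducible_module N"
    and f: "module_hom L M f" and g: "module_hom L N g"
    and v: "v \<in> f ` rep_space L" "v \<noteq> 0" and w: "w \<in> rep_space N"
    and not_w: "\<And>t. t \<in> rep_space L \<Longrightarrow> f t = 0 \<Longrightarrow> g t \<noteq> w"
    and joint: "\<And>t. t \<in> rep_space L \<Longrightarrow> f t = 0 \<Longrightarrow> g t = 0 \<Longrightarrow> t = 0"
  shows "module_iso L M f"
proof -
  interpret L: sl3_module L by fact
  note mods = irr [THEN irreducible_module_sl3]
  let ?K = "{t \<in> rep_space L. f t = 0}"
  have K: "submodule ?K L" by (rule submodule_kernel [OF L mods(1) f])
  have "module_hom (restrict_rep L ?K) N g" using g by (auto simp: module_hom_def)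
  then have "submodule (g ` ?K) N"
    using submodule_image [OF sl3_module_restrict [OF L K] mods(2)] by fastforce
  moreover have "w \<notin> g ` ?K" using not_w by auto
  ultimately have "g ` ?K = {0}" using irr(2) w unfolding irreducible_module_def by blast
  then have ker: "t = 0" if "t \<in> rep_space L" "f t = 0" for t using joint that by blast
  have "f ` rep_space L = rep_space M"
    by (rule submodule_top [OF irr(1) submodule_image [OF L mods(1) f] v])
  moreover have "inj_on f (rep_space L)"
  proof (rule inj_onI)
    fix s t assume st: "s \<in> rep_space L" "t \<in> rep_space L" "f s = f t"
    then have "f (s - t) = 0" by (simp add: module_hom_diff [OF L f])
    then have "s - t = 0" using st by (intro ker L.diff_in)
    then show "s = t" by simp
  qed
  ultimately show ?thesis using f by (intro module_isoI) (simp_all add: bij_betw_def)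
qed

text \<open>The submodule of \<open>M \<oplus> N\<close> generated by the sum of the two highest weight vectors is
  the graph of an isomorphism.\<close>

lemma highest_weight_isomorphic:
  assumes irr: "irreducible_module M" "irreducible_module N"
    and hw: "highest_weight_vector M lam v" "highest_weight_vector N lam w"
  shows "isomorphic_modules M N"
proof -
  interpret M: sl3_module M using irr by (simp add: irreducible_module_def)
  interpret N: sl3_module N using irr by (simp add: irreducible_module_def)
  interpret S: sl3_module "dsum_rep M N" by (rule sl3_module_dsum) unfold_locales
  note v = highest_weight_vectorD [OF hw(1)] and w = highest_weight_vectorD [OF hw(2)]
  let ?S = "dsum_rep M N"
  define r where "r = case_sum v w"
  define L where "L = S.lowering_span 1 2 3 r"
  note comp = case_sum_o_inj
  note act = dsum_act and S_iff = in_dsum_rep [of _ M N] and eqI = sum_fun_eqI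
  have r: "r \<in> rep_space ?S" using v w by (simp add: S_iff r_def comp)
  have rh: "rep_act ?S h r = fun_scale (weight_eval lam h) r" if "h \<in> cartan" for h
    using v w that by (intro eqI) (simp_all add: act fun_comp_simps r_def comp)
  have re: "rep_act ?S (matrix_unit 1 2) r = 0" "rep_act ?S (matrix_unit 2 3) r = 0"
    using v w by (auto intro!: eqI simp: act fun_comp_simps r_def comp)
  have Lsub: "submodule L ?S"
    unfolding L_def using rh re by (intro S.submodule_lowering_span r) auto
  have rL: "r \<in> L"
    using S.lowering_span_closed [OF _ r, of 1 2 3] by (simp add: L_def S.lowering_closed_def)
  have LS: "t \<in> rep_space ?S" if "t \<in> L" for t using Lsub that by (auto simp: submodule_def)
  have Lmod: "sl3_module (restrict_rep ?S L)" by (rule sl3_module_restrict [OF _ Lsub]) unfold_locales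
  have top: "\<exists>z. t = fun_scale z r" if "t \<in> L" "rep_act ?S (coroot 1 3) t = fun_scale (weight_eval lam (coroot 1 3)) t" for t
    using S.lowering_span_top [OF r rh [OF coroot_cartan]] that by (simp add: L_def)
  \<comment> \<open>This vector has the same eigenvalue as \<open>r\<close>, so in \<open>L\<close>
    it would have to be a multiple of \<open>r\<close>, whose components are both nonzero.\<close>
  have notw: "case_sum 0 w \<notin> L"
  proof
    assume "case_sum 0 w \<in> L"
    moreover have "rep_act ?S (coroot 1 3) (case_sum 0 w) = fun_scale (weight_eval lam (coroot 1 3)) (case_sum 0 w)"
      using w by (intro eqI) (simp_all add: act fun_comp_simps comp M.act_zero)
    ultimately obtain z where z: "case_sum 0 w = fun_scale z r" using top by blast
    have "fun_scale z v = 0" "fun_scale z w = w"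
      using arg_cong [OF z, of "\<lambda>t. t \<circ> Inl"] arg_cong [OF z, of "\<lambda>t. t \<circ> Inr"]
      by (simp_all add: r_def fun_comp_simps comp)
    then show False using v(2) w(2) by (cases "z = 0") simp_all
  qed
  have notv: "case_sum v 0 \<notin> L"
  proof
    assume "case_sum v 0 \<in> L"
    moreover have "rep_act ?S (coroot 1 3) (case_sum v 0) = fun_scale (weight_eval lam (coroot 1 3)) (case_sum v 0)"
      using v by (intro eqI) (simp_all add: act fun_comp_simps comp N.act_zero)
    ultimately obtain z where z: "case_sum v 0 = fun_scale z r" using top by blast
    have "fun_scale z w = 0" "fun_scale z v = v"
      using arg_cong [OF z, of "\<lambda>t. t \<circ> Inl"] arg_cong [OF z, of "\<lambda>t. t \<circ> Inr"]
      by (simp_all add: r_def fun_comp_simps comp)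
    then show False using v(2) w(2) by (cases "z = 0") simp_all
  qed
  have homl: "module_hom (restrict_rep ?S L) M (\<lambda>t. t \<circ> Inl)"
    and homr: "module_hom (restrict_rep ?S L) N (\<lambda>t. t \<circ> Inr)"
    using LS by (auto simp: module_hom_def fun_comp_simps act S_iff)
  have isol: "module_iso (restrict_rep ?S L) M (\<lambda>t. t \<circ> Inl)"
  proof (rule graph_projection [OF Lmod irr homl homr])
    show "v \<in> (\<lambda>t. t \<circ> Inl) ` rep_space (restrict_rep ?S L)"
      using rL by (intro image_eqI [of _ _ r]) (simp_all add: r_def comp)
    show "s \<circ> Inr \<noteq> w" if "s \<in> rep_space (restrict_rep ?S L)" "s \<circ> Inl = 0" for s
    proof
      assume "s \<circ> Inr = w"
      then have "s = case_sum 0 w" using that(2) by (intro eqI) (simp_all add: comp)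
      then show False using that(1) notw by simp
    qed
  qed (use v w in \<open>auto intro: eqI simp: fun_comp_simps\<close>)
  have isor: "module_iso (restrict_rep ?S L) N (\<lambda>t. t \<circ> Inr)"
  proof (rule graph_projection [OF Lmod irr(2,1) homr homl])
    show "w \<in> (\<lambda>t. t \<circ> Inr) ` rep_space (restrict_rep ?S L)"
      using rL by (intro image_eqI [of _ _ r]) (simp_all add: r_def comp)
    show "s \<circ> Inl \<noteq> v" if "s \<in> rep_space (restrict_rep ?S L)" "s \<circ> Inr = 0" for s
    proof
      assume "s \<circ> Inl = v"
      then have "s = case_sum v 0" using that(2) by (intro eqI) (simp_all add: comp)
      then show False using that(1) notv by simp
    qed
  qed (use v w in \<open>auto intro: eqI simp: fun_comp_simps\<close>)
  show ?thesis
    unfolding isomorphic_modules_def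
    using module_iso_comp [OF module_iso_inverse [OF Lmod isol] isor] by blast
qed

section \<open>A model of the irreducible modules\<close>

definition high_space :: "bool list \<Rightarrow> (3 list \<Rightarrow> complex) set" where
  "high_space sg = \<Inter> {U. submodule U (word_rep sg) \<and> delta (high_word sg) \<in> U}"

definition high_rep :: "bool list \<Rightarrow> 3 list rep" where
  "high_rep sg = restrict_rep (word_rep sg) (high_space sg)"

lemma rep_space_high [simp]: "rep_space (high_rep sg) = high_space sg"
  by (simp add: high_rep_def)

lemma rep_act_high [simp]: "rep_act (high_rep sg) = wact sg"
  by (simp add: high_rep_def)

lemma high_space_least: "submodule U (word_rep sg) \<Longrightarrow> delta (high_word sg) \<in> U \<Longrightarrow> high_space sg \<subseteq> U"
  by (auto simp: high_space_def)

lemma high_word_in [simp]: "delta (high_word sg) \<in> high_space sg"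
  by (simp add: high_space_def)

lemma submodule_top_space: "sl3_module M \<Longrightarrow> submodule (rep_space M) M"
  by (simp add: submodule_def sl3_module.subspace sl3_module.act_closed)

lemma submodule_high_space: "submodule (high_space sg) (word_rep sg)"
proof -
  have "submodule (rep_space (word_rep sg)) (word_rep sg)" by (rule submodule_top_space) unfold_locales
  then have "high_space sg \<subseteq> rep_space (word_rep sg)"
    by (rule high_space_least) (simp add: delta_in_word_rep)
  moreover have "cfun.subspace (high_space sg)"
    unfolding high_space_def by (rule cfun.subspace_Inter) (auto simp: submodule_def)
  ultimately show ?thesis by (auto simp: submodule_def high_space_def)
qed

lemma high_space_subset: "t \<in> high_space sg \<Longrightarrow> t \<in> rep_space (word_rep sg)"
  using submodule_high_space by (auto simp: submodule_def)

interpretation high: sl3_module "high_rep sg" for sg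
  unfolding high_rep_def by (rule sl3_module_restrict [OF sl3_module_word_rep submodule_high_space])

text \<open>Each slot contributes at most 1, with equality only for its highest index; the top
  eigenvalue of diag(1, 0, -1) therefore belongs to the highest word alone.\<close>

lemma wweight_le:
  "Re (wweight sg (coroot 1 3) w) \<le> length sg
    \<and> (length w = length sg \<longrightarrow> w \<noteq> high_word sg \<longrightarrow> Re (wweight sg (coroot 1 3) w) < length sg)"
proof (induction sg arbitrary: w)
  case (Cons s sg)
  show ?case
  proof (cases w)
    case (Cons i v)
    have "Re (slot s (coroot 1 3) i i) \<le> 1"
      "i \<noteq> (if s then 1 else 3) \<Longrightarrow> Re (slot s (coroot 1 3) i i) < 1"
      by (cases s; auto simp: slot_def)+
    then show ?thesis using Cons.IH [of v] Cons by (cases "i = (if s then 1 else 3)") (auto simp: high_word_def)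
  qed simp
qed (simp add: high_word_def)

lemma wweight_top_eq: "wweight sg (coroot 1 3) (high_word sg) = of_nat (length sg)"
  by (induction sg) (auto simp: high_word_def slot_def)

lemma top_line:
  assumes t: "t \<in> rep_space (word_rep sg)" and h: "wact sg (coroot 1 3) t = fun_scale (of_nat (length sg)) t"
  shows "t = fun_scale (t (high_word sg)) (delta (high_word sg))"
proof
  fix w
  show "t w = fun_scale (t (high_word sg)) (delta (high_word sg)) w"
  proof (cases "w = high_word sg \<or> length w \<noteq> length sg")
    case True
    then show ?thesis using t by (auto simp: delta_def in_word_rep)
  next
    case False
    have "wweight sg (coroot 1 3) w * t w = wact sg (coroot 1 3) t w"
      using False by (intro wact_diagonal [symmetric] cartan_offdiag [OF coroot_cartan]) auto
    also have "\<dots> = of_nat (length sg) * t w"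
      using fun_cong [OF h, of w] by (simp only: fun_scale_apply)
    finally have "wweight sg (coroot 1 3) w * t w = of_nat (length sg) * t w" .
    moreover have "wweight sg (coroot 1 3) w \<noteq> of_nat (length sg)"
    proof
      assume "wweight sg (coroot 1 3) w = of_nat (length sg)"
      then have "Re (wweight sg (coroot 1 3) w) = length sg" by simp
      then show False using False wweight_le [of sg w] by auto
    qed
    ultimately have "t w = 0" by simp
    then show ?thesis using False by (simp add: delta_def)
  qed
qed

lemma wact_top: "wact sg (coroot 1 3) (delta (high_word sg)) = fun_scale (of_nat (length sg)) (delta (high_word sg))"
  using wact_diagonal_delta [of "coroot 1 3" "high_word sg" sg] by (simp add: wweight_top_eq)

text \<open>Split the highest word along \<open>U\<close> and its complement. By uniqueness of the
  splitting both parts have the top eigenvalue, and the top eigenspace is a line, so the part in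
  \<open>U\<close> is a multiple of the highest word: a zero multiple puts the word into the
  complement, a nonzero one into \<open>U\<close>.\<close>

lemma high_submodule_cases:
  assumes "submodule U (word_rep sg)"
  shows "high_space sg \<subseteq> U \<or> high_space sg \<subseteq> word.ortho sg U"
proof -
  let ?v = "delta (high_word sg)" and ?H = "wact sg (coroot 1 3)" and ?n = "of_nat (length sg) :: complex"
  have v: "?v \<in> rep_space (word_rep sg)" by (simp add: delta_in_word_rep)
  note oU = word.submodule_ortho [OF assms]
  obtain u where u: "u \<in> U" "?v - u \<in> word.ortho sg U"
    using word.ortho_decompose [OF assms v] by blast
  have uM: "u \<in> rep_space (word_rep sg)" using u assms by (auto simp: submodule_def)
  have "?H u + ?H (?v - u) = ?H ?v"
    using word.act_diff [of "coroot 1 3" ?v sg u] uM v by simp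
  also have "\<dots> = fun_scale ?n u + fun_scale ?n (?v - u)"
    by (simp only: wact_top) (rule ext, simp add: algebra_simps)
  finally have "?H u = fun_scale ?n u"
  proof (rule word.ortho_unique(1) [OF assms, rotated -1])
    show "?H u \<in> U" "fun_scale ?n u \<in> U"
      using assms u(1) by (auto simp: submodule_def intro: cfun.subspace_scale)
    show "?H (?v - u) \<in> word.ortho sg U" "fun_scale ?n (?v - u) \<in> word.ortho sg U"
      using oU u(2) by (auto simp: submodule_def intro: cfun.subspace_scale)
  qed
  then have eq: "u = fun_scale (u (high_word sg)) ?v" by (rule top_line [OF uM])
  show ?thesis
  proof (cases "u (high_word sg) = 0")
    case True
    then have "?v \<in> word.ortho sg U" using eq u(2) by simp
    then show ?thesis using high_space_least [OF oU] by blast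
  next
    case False
    then have "fun_scale (1 / u (high_word sg)) u = ?v" by (subst eq) (simp add: fun_eq_iff)
    moreover have "fun_scale (1 / u (high_word sg)) u \<in> U"
      using assms u(1) by (simp add: submodule_def cfun.subspace_scale)
    ultimately show ?thesis using high_space_least [OF assms] by simp
  qed
qed

lemma irreducible_high_rep: "irreducible_module (high_rep sg)"
  unfolding irreducible_module_def
proof (intro conjI allI impI)
  show "sl3_module (high_rep sg)" by unfold_locales
  have "delta (high_word sg) (high_word sg) \<noteq> 0" by (simp add: delta_def)
  then have "delta (high_word sg) \<noteq> 0" by (metis zero_fun_apply)
  then show "rep_space (high_rep sg) \<noteq> {0}" using high_word_in by fastforce
next
  fix U assume "submodule U (high_rep sg)"
  then have U: "submodule U (word_rep sg)" "U \<subseteq> high_space sg"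
    using submodule_restrict [OF submodule_high_space] by (auto simp: high_rep_def)
  from high_submodule_cases [OF U(1)] show "U = {0} \<or> U = rep_space (high_rep sg)"
  proof
    assume "high_space sg \<subseteq> word.ortho sg U"
    then have "U \<subseteq> {0}" using U(2) word.ortho_Int by blast
    moreover have "0 \<in> U" using U(1) by (simp add: submodule_def cfun.subspace_0)
    ultimately show ?thesis by blast
  qed (use U in auto)
qed

lemma highest_weight_vector_high:
  "highest_weight_vector (high_rep sg) (count_list sg True, count_list sg False) (delta (high_word sg))"
proof -
  have "delta (high_word sg) (high_word sg) \<noteq> 0" by (simp add: delta_def)
  then have "delta (high_word sg) \<noteq> 0" by (metis zero_fun_apply)
  then show ?thesis
    by (simp add: highest_weight_vector_def wact_raise_high wact_diagonal_delta wweight_high_word)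
qed

section \<open>Unipotent orbits of decomposable tensors\<close>

text \<open>The point \<open>y\<close> consists of one vector and one covector, repeated in every
  slot of their kind. The orbit of the highest weight vector consists of such tensors with the
  covector annihilating the vector.\<close>

fun pure :: "bool list \<Rightarrow> (bool \<Rightarrow> 3 \<Rightarrow> complex) \<Rightarrow> 3 list \<Rightarrow> complex" where
  "pure [] y w = (if w = [] then 1 else 0)"
| "pure (s # sg) y [] = 0"
| "pure (s # sg) y (i # w) = y s i * pure sg y w"

definition slot_act :: "complex^3^3 \<Rightarrow> (bool \<Rightarrow> 3 \<Rightarrow> complex) \<Rightarrow> bool \<Rightarrow> 3 \<Rightarrow> complex" where
  "slot_act x y s i = (\<Sum>j\<in>UNIV. slot s x i j * y s j)"

text \<open>\<open>pure_exp sg x y k\<close> is \<open>x\<^sup>k / k!\<close> applied to \<^term>\<open>pure sg y\<close> when \<open>x\<close> has square zero.\<close>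

fun pure_exp :: "bool list \<Rightarrow> complex^3^3 \<Rightarrow> (bool \<Rightarrow> 3 \<Rightarrow> complex) \<Rightarrow> nat \<Rightarrow> 3 list \<Rightarrow> complex" where
  "pure_exp [] x y k w = (if w = [] \<and> k = 0 then 1 else 0)"
| "pure_exp (s # sg) x y k [] = 0"
| "pure_exp (s # sg) x y 0 (i # w) = y s i * pure_exp sg x y 0 w"
| "pure_exp (s # sg) x y (Suc k) (i # w)
    = y s i * pure_exp sg x y (Suc k) w + slot_act x y s i * pure_exp sg x y k w"

lemma pure_exp_0: "pure_exp sg x y 0 w = pure sg y w"
  by (induction sg y w rule: pure.induct) auto

lemma pure_exp_large: "k > length sg \<Longrightarrow> pure_exp sg x y k w = 0"
  by (induction sg x y k w rule: pure_exp.induct) auto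

lemma pure_exp_sum: "pure sg (\<lambda>s i. y s i + slot_act x y s i) w = (\<Sum>k\<le>length sg. pure_exp sg x y k w)"
proof (induction sg arbitrary: w)
  case (Cons s sg)
  show ?case
  proof (cases w)
    case (Cons i v)
    have "(\<Sum>k\<le>Suc (length sg). pure_exp (s # sg) x y k (i # v))
      = y s i * (\<Sum>k\<le>Suc (length sg). pure_exp sg x y k v)
        + slot_act x y s i * (\<Sum>k\<le>length sg. pure_exp sg x y k v)"
      unfolding sum.atMost_Suc_shift
      by (simp add: sum.distrib sum_distrib_left distrib_left del: sum.atMost_Suc)
    then show ?thesis using Cons.IH [of v] by (simp add: Cons pure_exp_large distrib_right)
  qed simp
qed auto

text \<open>\<open>pure_exp sg x y k\<close> is the sum over all choices of k slots to be hit by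
  \<open>x\<close>. One more application reaches every choice of k + 1 slots in k + 1 ways, while
  hitting the same slot twice gives zero.\<close>

lemma wact_pure_exp:
  assumes nil: "\<And>s i. (\<Sum>j\<in>UNIV. slot s x i j * slot_act x y s j) = 0"
  shows "wact sg x (pure_exp sg x y k) w = of_nat (Suc k) * pure_exp sg x y (Suc k) w"
proof (induction sg arbitrary: k w)
  case (Cons s sg)
  show ?case
  proof (cases w)
    case (Cons i v)
    show ?thesis
    proof (cases k)
      case 0
      have "(\<Sum>j\<in>UNIV. slot s x i j * (y s j * pure_exp sg x y 0 v)) = slot_act x y s i * pure_exp sg x y 0 v"
        by (simp add: slot_act_def sum_distrib_right mult.assoc)
      then show ?thesis using Cons.IH [of 0 v] by (simp add: Cons 0 wact_scale)
    next
      case (Suc l)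
      have "(\<Sum>j\<in>UNIV. slot s x i j * (y s j * pure_exp sg x y (Suc l) v + slot_act x y s j * pure_exp sg x y l v))
        = slot_act x y s i * pure_exp sg x y (Suc l) v
          + (\<Sum>j\<in>UNIV. slot s x i j * slot_act x y s j) * pure_exp sg x y l v"
        by (simp add: slot_act_def [of x y s i] sum_distrib_right distrib_left sum.distrib mult.assoc)
      then show ?thesis using Cons.IH [of "Suc l" v] Cons.IH [of l v]
        by (simp add: Cons Suc wact_scale wact_add nil) (simp add: algebra_simps)
    qed
  qed simp
qed simp

text \<open>A submodule is stable under exp(x). As \<open>x\<close> has square zero in every slot,
  the exponential is a finite sum on the tensor power and acts on each factor as 1 + x.\<close>

lemma pure_exp_orbit:
  assumes U: "submodule U (word_rep sg)" and y: "pure sg y \<in> U" and x: "x \<in> sl3"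
    and nil: "\<And>s i. (\<Sum>j\<in>UNIV. slot s x i j * slot_act x y s j) = 0"
  shows "pure sg (\<lambda>s i. y s i + slot_act x y s i) \<in> U"
proof -
  have sub: "cfun.subspace U" using U by (simp add: submodule_def)
  have "pure_exp sg x y k \<in> U" for k
  proof (induction k)
    case 0
    have "pure_exp sg x y 0 = pure sg y" by (rule ext) (rule pure_exp_0)
    then show ?case using y by simp
  next
    case (Suc k)
    have "pure_exp sg x y (Suc k) = fun_scale (1 / of_nat (Suc k)) (wact sg x (pure_exp sg x y k))"
      by (rule ext) (simp add: wact_pure_exp [OF nil] del: of_nat_Suc)
    moreover have "wact sg x (pure_exp sg x y k) \<in> U" using U x Suc by (simp add: submodule_def)
    ultimately show ?case using cfun.subspace_scale [OF sub] by metis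
  qed
  then have "(\<Sum>k\<le>length sg. pure_exp sg x y k) \<in> U" by (intro cfun.subspace_sum [OF sub])
  moreover have "(\<Sum>k\<le>length sg. pure_exp sg x y k) = pure sg (\<lambda>s i. y s i + slot_act x y s i)"
    by (rule ext) (simp add: pure_exp_sum sum_fun_apply)
  ultimately show ?thesis by simp
qed

text \<open>The action of the elementary matrix exp(c \<open>matrix_unit i j\<close>) on a vector
  and, contragrediently, on a covector.\<close>

definition shear :: "3 \<Rightarrow> 3 \<Rightarrow> complex \<Rightarrow> (bool \<Rightarrow> 3 \<Rightarrow> complex) \<Rightarrow> bool \<Rightarrow> 3 \<Rightarrow> complex" where
  "shear i j c y s l = y s l + (if s then (if l = i then c * y s j else 0) else (if l = j then - c * y s i else 0))"

lemma slot_act_unit: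
  "slot_act (matrix_scale c (matrix_unit i j)) y s l
    = (if s then (if l = i then c * y s j else 0) else (if l = j then - c * y s i else 0))"
proof -
  have "(\<Sum>m\<in>UNIV. slot s (matrix_scale c (matrix_unit i j)) l m * y s m)
    = (\<Sum>m\<in>{if s then j else i}. slot s (matrix_scale c (matrix_unit i j)) l m * y s m)"
    by (rule sum.mono_neutral_right) (auto simp: slot_def)
  then show ?thesis by (simp add: slot_act_def slot_def)
qed

lemma pure_shear:
  assumes U: "submodule U (word_rep sg)" and y: "pure sg y \<in> U" and ij: "i \<noteq> j"
  shows "pure sg (shear i j c y) \<in> U"
proof -
  let ?x = "matrix_scale c (matrix_unit i j)"
  have "(\<Sum>m\<in>UNIV. slot s ?x l m * slot_act ?x y s m) = 0" for s l
    using ij by (intro sum.neutral) (auto simp: slot_act_unit slot_def)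
  then have "pure sg (\<lambda>s l. y s l + slot_act ?x y s l) \<in> U"
    using ij by (intro pure_exp_orbit [OF U y]) (auto simp: sl3_scale)
  then show ?thesis by (simp add: slot_act_unit shear_def [abs_def])
qed

definition high_point :: "bool \<Rightarrow> 3 \<Rightarrow> complex" where
  "high_point s = delta (if s then 1 else 3)"

lemma pure_high_point: "pure sg high_point = delta (high_word sg)"
proof
  fix w show "pure sg high_point w = delta (high_word sg) w"
    by (induction sg high_point w rule: pure.induct) (auto simp: high_word_def high_point_def delta_def)
qed

definition low_point :: "bool \<Rightarrow> 3 \<Rightarrow> complex" where
  "low_point s i = (if s then delta 3 i else - delta 1 i)"

lemma pure_low: "pure sg low_point w = (-1) ^ count_list sg False * delta (low_word sg) w"
  by (induction sg low_point w rule: pure.induct) (auto simp: low_word_def delta_def low_point_def)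

lemma low_word_in: "delta (low_word sg) \<in> high_space sg"
proof -
  \<comment> \<open>Two elementary matrices take the first basis vector through (1, 0, 1) to the
    third one, and the third covector through (-1, 0, 1) to minus the first one. The sign per
    covector slot is undone below.\<close>
  have "shear 1 3 (-1) (shear 3 1 1 high_point) = low_point"
  proof (intro ext)
    fix s i show "shear 1 3 (-1) (shear 3 1 1 high_point) s i = low_point s i"
      using exhaust_3 [of i] by (cases s; elim disjE) (simp_all add: shear_def high_point_def delta_def low_point_def)
  qed
  moreover have "pure sg (shear 1 3 (-1) (shear 3 1 1 high_point)) \<in> high_space sg"
    by (intro pure_shear [OF submodule_high_space]) (simp_all add: pure_high_point)
  ultimately have "fun_scale ((-1) ^ count_list sg False) (pure sg low_point) \<in> high_space sg"
    using submodule_high_space [of sg] by (simp add: submodule_def cfun.subspace_scale)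
  moreover have "fun_scale ((-1) ^ count_list sg False) (pure sg low_point)
    = delta (low_word sg)"
    by (rule ext) (simp add: pure_low flip: power_add mult.assoc)
  ultimately show ?thesis by simp
qed

text \<open>The vector (1, 1, 1) and the covector (1, -2, 1). The entry -2 makes them annihilate
  each other, as membership in the orbit demands; what is used later is that no coordinate
  vanishes.\<close>

definition generic_point :: "bool \<Rightarrow> 3 \<Rightarrow> complex" where
  "generic_point s i = (if \<not> s \<and> i = 2 then -2 else 1)"

lemma generic_in: "pure sg generic_point \<in> high_space sg"
proof -
  \<comment> \<open>The vector runs through (1, 1, 0), (1, 1, -1), (1, 1, 1), the covector through
    (0, 0, 1), (1, 0, 1), (1, -2, 1).\<close>
  have "shear 3 2 2 (shear 3 1 (-1) (shear 2 1 1 high_point)) = generic_point"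
  proof (intro ext)
    fix s i show "shear 3 2 2 (shear 3 1 (-1) (shear 2 1 1 high_point)) s i = generic_point s i"
      using exhaust_3 [of i] by (cases s; elim disjE) (simp_all add: shear_def high_point_def delta_def generic_point_def)
  qed
  moreover have "pure sg (shear 3 2 2 (shear 3 1 (-1) (shear 2 1 1 high_point))) \<in> high_space sg"
    by (intro pure_shear [OF submodule_high_space]) (simp_all add: pure_high_point)
  ultimately show ?thesis by simp
qed

lemma delta_nonzero: "delta w \<noteq> 0"
  by (metis delta_def zero_fun_apply zero_neq_one)

text \<open>In an irreducible module an extremal vector generates everything by the lowering
  operators of its own Borel subalgebra alone.\<close>

lemma lowering_closed_full:
  assumes d: "distinct [a, b, c]" and v: "v \<in> high_space sg" "v \<noteq> 0"
    and e: "wact sg (matrix_unit a b) v = 0" "wact sg (matrix_unit b c) v = 0"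
    and h: "\<And>h. h \<in> cartan \<Longrightarrow> \<exists>r. wact sg h v = fun_scale r v"
    and K: "cfun.subspace K" "v \<in> K"
    and f: "\<And>t. t \<in> high_space sg \<Longrightarrow> t \<in> K \<Longrightarrow> wact sg (matrix_unit b a) t \<in> K \<and> wact sg (matrix_unit c b) t \<in> K"
  shows "high_space sg \<subseteq> K"
proof -
  let ?L = "high.lowering_span sg a b c v"
  have vM: "v \<in> rep_space (high_rep sg)" using v by simp
  have "submodule ?L (high_rep sg)"
    using e h by (intro high.submodule_lowering_span [OF d vM]) auto
  moreover have "v \<in> ?L"
    using high.lowering_span_closed [OF d vM] by (simp add: high.lowering_closed_def)
  ultimately have "?L = high_space sg"
    using submodule_top [OF irreducible_high_rep _ _ v(2)] by fastforce
  moreover have "high.lowering_closed sg a b c v (K \<inter> high_space sg)"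
    using d v f K high.act_closed high.subspace
    by (auto simp: high.lowering_closed_def cfun.subspace_inter)
  ultimately show ?thesis using high.lowering_span_least by blast
qed

text \<open>The lowest word is a highest weight vector for the ordering 3, 2, 1, whose lowering
  operators are the usual raising operators.\<close>

lemma raising_generates:
  assumes "cfun.subspace K" "delta (low_word sg) \<in> K"
    and "\<And>t. t \<in> high_space sg \<Longrightarrow> t \<in> K \<Longrightarrow> wact sg (matrix_unit 1 2) t \<in> K \<and> wact sg (matrix_unit 2 3) t \<in> K"
  shows "high_space sg \<subseteq> K"
  using assms by (intro lowering_closed_full [of 3 2 1 "delta (low_word sg)"])
    (auto simp: low_word_in delta_nonzero wact_lower_low wact_diagonal_delta)

lemma lowering_generates:
  assumes "cfun.subspace K" "delta (high_word sg) \<in> K"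
    and "\<And>t. t \<in> high_space sg \<Longrightarrow> t \<in> K \<Longrightarrow> wact sg (matrix_unit 2 1) t \<in> K \<and> wact sg (matrix_unit 3 2) t \<in> K"
  shows "high_space sg \<subseteq> K"
  using assms by (intro lowering_closed_full [of 1 2 3 "delta (high_word sg)"])
    (auto simp: delta_nonzero wact_raise_high wact_diagonal_delta)

section \<open>Transport of structure and the chosen modules \<open>irrep\<close>\<close>

lemma module_hom_restrict:
  assumes "module_hom M N f" "submodule U M"
  shows "module_hom (restrict_rep M U) N f"
proof -
  have "u \<in> rep_space M" if "u \<in> U" for u using assms(2) that by (auto simp: submodule_def)
  then show ?thesis using assms(1) by (auto simp: module_hom_def image_subset_iff)
qed

lemma irreducible_transfer:
  assumes M: "irreducible_module M" and N: "sl3_module N" and f: "module_iso M N f"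
  shows "irreducible_module N"
  unfolding irreducible_module_def
proof (intro conjI allI impI N)
  interpret M: sl3_module M using M by (rule irreducible_module_sl3)
  interpret N: sl3_module N by (rule N)
  define g where "g = inv_into (rep_space M) f"
  have g: "module_iso N M g" unfolding g_def by (rule module_iso_inverse [OF M.sl3_module_axioms f])
  note gh = module_iso_hom [OF g]
  have inj: "inj_on g (rep_space N)" and surj: "g ` rep_space N = rep_space M"
    using g by (auto simp: module_iso_def bij_betw_def)
  have g0: "g 0 = 0" by (rule module_hom_zero [OF N gh])
  show "rep_space N \<noteq> {0}"
  proof
    assume "rep_space N = {0}"
    then have "rep_space M = {0}" using surj g0 by simp
    then show False using M by (simp add: irreducible_module_def)
  qed
  fix U assume U: "submodule U N"
  have "submodule (g ` U) M"
    using submodule_image [OF sl3_module_restrict [OF N U] M.sl3_module_axioms module_hom_restrict [OF gh U]]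
    by simp
  then have "g ` U = {0} \<or> g ` U = rep_space M"
    using M by (simp add: irreducible_module_def)
  then consider "g ` U = {0}" | "g ` U = g ` rep_space N"
    unfolding surj by blast
  then show "U = {0} \<or> U = rep_space N"
  proof cases
    case 1
    then have "g ` U = g ` {0}" using g0 by simp
    then show ?thesis using inj_on_image_eq_iff [OF inj, of U "{0}"] U by (simp add: submodule_def)
  next
    case 2
    then show ?thesis using inj_on_image_eq_iff [OF inj, of U "rep_space N"] U by (simp add: submodule_def)
  qed
qed

lemma highest_weight_vector_transfer:
  assumes "sl3_module M" "module_iso M N f" "highest_weight_vector M lam v"
  shows "highest_weight_vector N lam (f v)"
proof -
  interpret M: sl3_module M by fact
  note v = highest_weight_vectorD [OF assms(3)]
  note h = module_homD [OF module_iso_hom [OF assms(2)]]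
  have f0: "f 0 = 0" by (rule module_hom_zero [OF assms(1) module_iso_hom [OF assms(2)]])
  have "inj_on f (rep_space M)" using assms(2) by (simp add: module_iso_def bij_betw_def)
  then have "f v \<noteq> 0"
    using v(1,2) f0 inj_onD [of f "rep_space M" v 0] by auto
  moreover have "rep_act N (matrix_unit i j) (f v) = 0" if "(i, j) \<in> {(1, 2), (2, 3), (1, 3)}" for i j
    using h(4) [of "matrix_unit i j" v] that v f0 by auto
  moreover have "rep_act N k (f v) = fun_scale (weight_eval lam k) (f v)" if "k \<in> cartan" for k
    using h(4) [OF cartan_sl3 [OF that] v(1)] h(3) [OF v(1)] v(5) [OF that] by simp
  ultimately show ?thesis using h(1) v(1) by (simp add: highest_weight_vector_def)
qed

text \<open>\<open>irrep\<close> selects among modules on functions of a natural number, whereas the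
  model lives on functions of index words. Extension by zero along an enumeration of the words is
  linear and injective and carries the model over.\<close>

definition to_nat_fun :: "('i::countable \<Rightarrow> complex) \<Rightarrow> nat \<Rightarrow> complex" where
  "to_nat_fun f n = (if n \<in> range (to_nat :: 'i \<Rightarrow> nat) then f (from_nat n) else 0)"

definition nat_rep :: "'i::countable rep \<Rightarrow> nat rep" where
  "nat_rep M = \<lparr>rep_space = to_nat_fun ` rep_space M,
     rep_act = (\<lambda>x g. to_nat_fun (rep_act M x (g \<circ> to_nat)))\<rparr>"

lemma to_nat_fun_inverse [simp]: "to_nat_fun f \<circ> to_nat = f"
  by (auto simp: to_nat_fun_def fun_eq_iff)

lemma to_nat_fun_linear:
  "to_nat_fun (f + g) = to_nat_fun f + to_nat_fun g"
  "to_nat_fun (f - g) = to_nat_fun f - to_nat_fun g"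
  "to_nat_fun (fun_scale c f) = fun_scale c (to_nat_fun f)"
  "to_nat_fun 0 = 0"
  by (auto simp: to_nat_fun_def fun_eq_iff)

lemma nat_rep:
  assumes "sl3_module M"
  shows "sl3_module (nat_rep M)" "module_iso M (nat_rep M) to_nat_fun"
proof -
  interpret M: sl3_module M by fact
  have sub: "cfun.subspace (rep_space (nat_rep M))"
    unfolding cfun.subspace_def
  proof (intro conjI ballI allI)
    show "0 \<in> rep_space (nat_rep M)"
      by (auto simp: nat_rep_def intro!: image_eqI [of _ _ 0] simp: to_nat_fun_linear)
  qed (auto simp: nat_rep_def M.add_in M.scale_in simp flip: to_nat_fun_linear)
  obtain B where B: "finite B" "rep_space M = cfun.span B" using M.finite_dim by blast
  have "cfun.span B \<subseteq> {b. to_nat_fun b \<in> cfun.span (to_nat_fun ` B)}"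
    by (rule cfun.span_minimal)
      (auto simp: cfun.subspace_def to_nat_fun_linear cfun.span_zero intro: cfun.span_base cfun.span_add cfun.span_scale)
  then have "rep_space (nat_rep M) \<subseteq> cfun.span (to_nat_fun ` B)" using B(2) by (auto simp: nat_rep_def)
  then have fin: "\<exists>B. finite B \<and> rep_space (nat_rep M) = cfun.span B"
    using finite_dim_subspace [OF sub] B(1) by blast
  show "sl3_module (nat_rep M)"
  proof
    show "cfun.subspace (rep_space (nat_rep M))" by (rule sub)
    show "\<exists>B. finite B \<and> rep_space (nat_rep M) = cfun.span B" by (rule fin)
  qed (auto simp: nat_rep_def fun_comp_simps M.act_closed M.act_add M.act_scale M.add_act M.scale_act
      M.bracket_act to_nat_fun_linear)
  have "inj_on to_nat_fun (rep_space M)" by (rule inj_on_inverseI [of _ "\<lambda>g. g \<circ> to_nat"]) simp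
  then show "module_iso M (nat_rep M) to_nat_fun"
    by (auto simp: module_iso_def nat_rep_def bij_betw_def to_nat_fun_linear)
qed

lemma irrep_spec: "irreducible_module (irrep lam)" "\<exists>v. highest_weight_vector (irrep lam) lam v"
proof -
  define sg where "sg = replicate (fst lam) True @ replicate (snd lam) False"
  have "count_list (replicate n b) c = (if b = c then n else 0)" for n and b c :: bool
    by (induction n) auto
  then have "(count_list sg True, count_list sg False) = lam" by (simp add: sg_def)
  then have hw: "highest_weight_vector (high_rep sg) lam (delta (high_word sg))"
    using highest_weight_vector_high [of sg] by simp
  note N = nat_rep [OF high.sl3_module_axioms, of sg]
  have "irreducible_module (nat_rep (high_rep sg))"
    by (rule irreducible_transfer [OF irreducible_high_rep N])
  moreover have "highest_weight_vector (nat_rep (high_rep sg)) lam (to_nat_fun (delta (high_word sg)))"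
    by (rule highest_weight_vector_transfer [OF high.sl3_module_axioms N(2) hw])
  ultimately have "\<exists>M :: nat rep. irreducible_module M \<and> (\<exists>v. highest_weight_vector M lam v)" by blast
  then have "irreducible_module (irrep lam) \<and> (\<exists>v. highest_weight_vector (irrep lam) lam v)"
    unfolding irrep_def by (rule someI_ex)
  then show "irreducible_module (irrep lam)" "\<exists>v. highest_weight_vector (irrep lam) lam v" by auto
qed

lemma irrep_isomorphic_high:
  "isomorphic_modules (irrep (count_list sg True, count_list sg False)) (high_rep sg)"
  using irrep_spec [of "(count_list sg True, count_list sg False)"]
    highest_weight_isomorphic [OF _ irreducible_high_rep _ highest_weight_vector_high] by blast

section \<open>Complete reducibility and multiplicities\<close>

lemma dim_strict_mono:
  assumes Z: "cfun.subspace Z" "Z \<subseteq> W" "Z \<noteq> W" and W: "W \<subseteq> cfun.span C" "finite C"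
  shows "cfun.dim Z < cfun.dim W"
proof -
  obtain B where B: "B \<subseteq> Z" "cfun.independent B" "Z \<subseteq> cfun.span B" "card B = cfun.dim Z"
    by (rule cfun.basis_exists)
  obtain B' where B': "B' \<subseteq> W" "cfun.independent B'" "W \<subseteq> cfun.span B'" "card B' = cfun.dim W"
    by (rule cfun.basis_exists)
  have fin: "finite B'" using cfun.independent_span_bound [OF W(2) B'(2)] B'(1) W(1) by blast
  obtain w where w: "w \<in> W" "w \<notin> Z" using Z by blast
  have "cfun.span B \<subseteq> Z" using B(1) Z(1) by (rule cfun.span_minimal)
  then have "w \<notin> cfun.span B" using w by blast
  then have ind: "cfun.independent (insert w B)" and wB: "w \<notin> B"
    using B(2) by (auto simp: cfun.independent_insert intro: cfun.span_base)
  have "insert w B \<subseteq> cfun.span B'" using w B(1) Z(2) B'(3) by blast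
  from cfun.independent_span_bound [OF fin ind this]
  have "finite (insert w B)" "card (insert w B) \<le> card B'" by auto
  then show ?thesis using wB B(4) B'(4) by simp
qed

lemma restrict_rep_twice [simp]: "restrict_rep (restrict_rep M U) W = restrict_rep M W"
  by (simp add: restrict_rep_def)

lemma submodule_Int: "submodule U M \<Longrightarrow> submodule W M \<Longrightarrow> submodule (U \<inter> W) M"
  by (auto simp: submodule_def cfun.subspace_inter)

context unitary_module
begin

text \<open>A nonzero submodule of least dimension inside \<open>U\<close> is irreducible; its
  orthogonal complement within \<open>U\<close> has smaller dimension and is handled by
  induction.\<close>

lemma submodule_decomposition:
  assumes "submodule U M"
  shows "\<exists>D. irreducible_decomposition (restrict_rep M U) D"
  using assms
proof (induction "cfun.dim U" arbitrary: U rule: less_induct)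
  case less
  obtain C where C: "finite C" "rep_space M = cfun.span C" using finite_dim by blast
  have dim_less: "cfun.dim Z < cfun.dim W" if "submodule Z M" "submodule W M" "Z \<subseteq> W" "Z \<noteq> W" for Z W
    using that C by (intro dim_strict_mono [of _ _ C]) (auto simp: submodule_def)
  show ?case
  proof (cases "U = {0}")
    case True
    have "irreducible_decomposition (restrict_rep M U) {}"
      unfolding irreducible_decomposition_def by (auto simp: True)
    then show ?thesis by blast
  next
    case False
    define P where "P W \<longleftrightarrow> submodule W M \<and> W \<subseteq> U \<and> W \<noteq> {0}" for W
    have "P U" using less.prems False by (simp add: P_def)
    then obtain W where "P W" and min: "\<And>Z. P Z \<Longrightarrow> cfun.dim W \<le> cfun.dim Z"
      using arg_min_natI [of P U cfun.dim] arg_min_nat_le [of P _ cfun.dim] by blast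
    then have W: "submodule W M" "W \<subseteq> U" "W \<noteq> {0}" by (auto simp: P_def)
    have irr: "irreducible_module (restrict_rep M W)"
      unfolding irreducible_module_def
    proof (intro conjI allI impI)
      show "sl3_module (restrict_rep M W)" by (rule sl3_module_restrict [OF sl3_module_axioms W(1)])
      show "rep_space (restrict_rep M W) \<noteq> {0}" using W by simp
      fix Z assume "submodule Z (restrict_rep M W)"
      then have Z: "submodule Z M" "Z \<subseteq> W" using submodule_restrict [OF W(1)] by auto
      show "Z = {0} \<or> Z = rep_space (restrict_rep M W)"
      proof (rule ccontr)
        assume "\<not> (Z = {0} \<or> Z = rep_space (restrict_rep M W))"
        then have "P Z" "Z \<noteq> W" using Z W by (auto simp: P_def)
        then show False using min [of Z] dim_less [OF Z(1) W(1) Z(2)] by simp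
      qed
    qed
    define V where "V = U \<inter> ortho W"
    note oW = submodule_ortho [OF W(1)]
    have V: "submodule V M" unfolding V_def by (rule submodule_Int [OF less.prems oW])
    have "V \<noteq> U"
    proof
      assume "V = U"
      then have "W \<subseteq> {0}" using W(2) ortho_Int unfolding V_def by blast
      moreover have "0 \<in> W" using W(1) by (simp add: submodule_def cfun.subspace_0)
      ultimately show False using W(3) by blast
    qed
    then have "cfun.dim V < cfun.dim U" using V less.prems by (intro dim_less) (auto simp: V_def)
    then obtain D where D: "irreducible_decomposition (restrict_rep M V) D"
      using less.hyps V by blast
    have fin: "finite D" and Dsub: "\<And>X. X \<in> D \<Longrightarrow> submodule X M \<and> X \<subseteq> V \<and> irreducible_module (restrict_rep M X)"
      and Duniq: "\<And>v. v \<in> V \<Longrightarrow> \<exists>!f. f \<in> (\<Pi>\<^sub>E X\<in>D. X) \<and> v = (\<Sum>X\<in>D. f X)"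
      using D submodule_restrict [OF V] by (auto simp: irreducible_decomposition_def)
    have WD: "W \<notin> D"
    proof
      assume "W \<in> D"
      then have "W \<subseteq> {0}" using Dsub ortho_Int unfolding V_def by blast
      moreover have "0 \<in> W" using W(1) by (simp add: submodule_def cfun.subspace_0)
      ultimately show False using W(3) by blast
    qed
    have subV: "cfun.subspace V" using V by (simp add: submodule_def)
    have "\<exists>!f. f \<in> (\<Pi>\<^sub>E X\<in>insert W D. X) \<and> v = (\<Sum>X\<in>insert W D. f X)" if v: "v \<in> U" for v
    proof -
      have "v \<in> rep_space M" using v less.prems by (auto simp: submodule_def)
      then obtain w where w: "w \<in> W" "v - w \<in> ortho W" using ortho_decompose [OF W(1)] by blast
      have "v - w \<in> U" using v w(1) W(2) less.prems by (auto simp: submodule_def intro!: cfun.subspace_diff)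
      then have vw: "v - w \<in> V" using w by (simp add: V_def)
      then obtain g where g: "g \<in> (\<Pi>\<^sub>E X\<in>D. X)" "v - w = (\<Sum>X\<in>D. g X)"
        and gu: "\<And>f. f \<in> (\<Pi>\<^sub>E X\<in>D. X) \<Longrightarrow> v - w = (\<Sum>X\<in>D. f X) \<Longrightarrow> f = g"
        using Duniq by metis
      show ?thesis
      proof (rule ex1I [of _ "g(W := w)"])
        have "(\<Sum>X\<in>D. (g(W := w)) X) = (\<Sum>X\<in>D. g X)" by (rule sum.cong) (use WD in auto)
        moreover have "v = w + (v - w)" by simp
        ultimately have "v = (\<Sum>X\<in>insert W D. (g(W := w)) X)"
          using fin WD g(2) by simp
        then show "g(W := w) \<in> (\<Pi>\<^sub>E X\<in>insert W D. X) \<and> v = (\<Sum>X\<in>insert W D. (g(W := w)) X)"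
          using g(1) w(1) by (auto simp: PiE_iff extensional_def)
        fix f assume f: "f \<in> (\<Pi>\<^sub>E X\<in>insert W D. X) \<and> v = (\<Sum>X\<in>insert W D. f X)"
        have fW: "f W \<in> W" and fX: "\<And>X. X \<in> D \<Longrightarrow> f X \<in> X" using f by (auto simp: PiE_iff)
        have sumV: "(\<Sum>X\<in>D. f X) \<in> V" using fX Dsub by (intro cfun.subspace_sum [OF subV]) blast
        have "f W + (\<Sum>X\<in>D. f X) = w + (v - w)" using f fin WD by simp
        from ortho_unique [OF W(1) fW w(1) _ w(2) this] sumV
        have eq: "f W = w" "(\<Sum>X\<in>D. f X) = v - w" by (auto simp: V_def)
        \<comment> \<open>Elements of the product over \<open>D\<close> are \<open>undefined\<close>
          off \<open>D\<close>, so the value at \<open>W\<close> must be cut off before the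
          uniqueness of \<open>g\<close> applies.\<close>
        have "(\<Sum>X\<in>D. restrict f D X) = (\<Sum>X\<in>D. f X)" by (rule sum.cong) auto
        then have fg: "restrict f D = g"
          using fX eq(2) by (intro gu) auto
        show "f = g(W := w)"
        proof
          fix X
          consider "X = W" | "X \<in> D" "X \<noteq> W" | "X \<notin> insert W D" by blast
          then show "f X = (g(W := w)) X"
          proof cases
            case 2
            then show ?thesis using fun_cong [OF fg, of X] by simp
          next
            case 3
            then have "f X = undefined" "g X = undefined"
              using f g(1) by (auto intro: PiE_arb)
            then show ?thesis using 3 by simp
          qed (simp add: eq(1))
        qed
      qed
    qed
    then have "irreducible_decomposition (restrict_rep M U) (insert W D)"
      unfolding irreducible_decomposition_def
      using fin Dsub W irr submodule_restrict [OF less.prems] by (auto simp: V_def)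
    then show ?thesis by blast
  qed
qed

end

lemma restrict_rep_full [simp]: "restrict_rep M (rep_space M) = M"
  by (simp add: restrict_rep_def)

text \<open>The Hermitian form of the tensor power is pulled back along the embedding; injectivity
  keeps it definite.\<close>

lemma embedded_decomposition:
  assumes M: "sl3_module M" and F: "module_hom M (word_rep sg) F" and inj: "inj_on F (rep_space M)"
  shows "\<exists>D. irreducible_decomposition M D"
proof -
  interpret M: sl3_module M by fact
  note h = module_homD [OF F]
  have F0: "F 0 = 0" by (rule module_hom_zero [OF M F])
  interpret unitary_module M "\<lambda>v w. winner (length sg) (F v) (F w)"
  proof
    fix v assume v: "v \<in> rep_space M" "winner (length sg) (F v) (F v) = 0"
    then have "F v = F 0" using word.q_definite h(1) F0 by metis
    then show "v = 0" using inj v(1) by (auto dest: inj_onD)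
  qed (simp_all add: h word.q_add word.q_scale word.q_sym [symmetric] winner_adjoint)
  show ?thesis using submodule_decomposition [OF submodule_top_space [OF M]] by simp
qed

text \<open>A summand isomorphic to \<open>V\<close> yields a map by composing with the projection
  onto it. Conversely a nonzero map is nonzero on some summand and is an isomorphism there by
  Schur's lemma. Both directions work for the decomposition picked by choice.\<close>

lemma multiplicity_nonzero_iff:
  assumes M: "sl3_module M" and ex: "\<exists>D. irreducible_decomposition M D" and V: "irreducible_module V"
  shows "module_multiplicity V M \<noteq> 0 \<longleftrightarrow> (\<exists>h t. module_hom M V h \<and> t \<in> rep_space M \<and> h t \<noteq> 0)"
proof -
  interpret M: sl3_module M by fact
  interpret V: sl3_module V using V by (rule irreducible_module_sl3)
  define D where "D = (SOME D. irreducible_decomposition M D)"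
  have D: "irreducible_decomposition M D" unfolding D_def using ex by (rule someI_ex)
  have fin: "finite D" and sub: "\<And>U. U \<in> D \<Longrightarrow> submodule U M"
    and irr: "\<And>U. U \<in> D \<Longrightarrow> irreducible_module (restrict_rep M U)"
    and uniq: "\<And>v. v \<in> rep_space M \<Longrightarrow> \<exists>!f. f \<in> (\<Pi>\<^sub>E U\<in>D. U) \<and> v = (\<Sum>U\<in>D. f U)"
    using D by (auto simp: irreducible_decomposition_def)
  have "module_multiplicity V M \<noteq> 0 \<longleftrightarrow> (\<exists>U\<in>D. isomorphic_modules (restrict_rep M U) V)"
    using fin by (auto simp: module_multiplicity_def D_def [symmetric] Let_def)
  also have "\<dots> \<longleftrightarrow> (\<exists>h t. module_hom M V h \<and> t \<in> rep_space M \<and> h t \<noteq> 0)"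
  proof
    assume "\<exists>U\<in>D. isomorphic_modules (restrict_rep M U) V"
    then obtain U j where U: "U \<in> D" and j: "module_iso (restrict_rep M U) V j"
      by (auto simp: isomorphic_modules_def)
    \<comment> \<open>The family of components of \<open>v\<close>. The projection onto the summand
      \<open>U\<close> is the map from \<open>v\<close> to \<open>c v U\<close>; its linearity and
      equivariance come from the uniqueness of the components.\<close>
    define c where "c v = (THE f. f \<in> (\<Pi>\<^sub>E U\<in>D. U) \<and> v = (\<Sum>U\<in>D. f U))" for v
    have c: "c v \<in> (\<Pi>\<^sub>E U\<in>D. U) \<and> v = (\<Sum>U\<in>D. c v U)" if "v \<in> rep_space M" for v
      unfolding c_def by (rule theI' [OF uniq [OF that]])
    have c_eq: "c v X = f X" if v: "v \<in> rep_space M" and X: "X \<in> D" and f: "\<And>X. X \<in> D \<Longrightarrow> f X \<in> X"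
      and s: "v = (\<Sum>X\<in>D. f X)" for v f X
    proof -
      have "restrict f D \<in> (\<Pi>\<^sub>E U\<in>D. U) \<and> v = (\<Sum>U\<in>D. restrict f D U)" using f s by simp
      then have "c v = restrict f D" unfolding c_def by (intro the1_equality [OF uniq [OF v]])
      then show ?thesis using X by simp
    qed
    have cX: "c v X \<in> X" if "v \<in> rep_space M" "X \<in> D" for v X using c that by (auto simp: PiE_iff)
    have cM: "c v X \<in> rep_space M" if "v \<in> rep_space M" "X \<in> D" for v X
      using cX [OF that] sub [OF that(2)] by (auto simp: submodule_def)
    have cs: "(\<Sum>U\<in>D. c v U) = v" if "v \<in> rep_space M" for v using c [OF that] by simp
    have c_add: "c (v + w) U = c v U + c w U" if v: "v \<in> rep_space M" and w: "w \<in> rep_space M" for v w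
    proof (rule c_eq [OF M.add_in [OF v w] U])
      show "c v X + c w X \<in> X" if "X \<in> D" for X
        using cX [OF v that] cX [OF w that] sub [OF that] by (simp add: submodule_def cfun.subspace_add)
      show "v + w = (\<Sum>X\<in>D. c v X + c w X)" using cs [OF v] cs [OF w] by (simp add: sum.distrib)
    qed
    have c_scale: "c (fun_scale r v) U = fun_scale r (c v U)" if v: "v \<in> rep_space M" for r v
    proof (rule c_eq [OF M.scale_in [OF v] U])
      show "fun_scale r (c v X) \<in> X" if "X \<in> D" for X
        using cX [OF v that] sub [OF that] by (simp add: submodule_def cfun.subspace_scale)
      show "fun_scale r v = (\<Sum>X\<in>D. fun_scale r (c v X))"
        using cs [OF v] by (simp flip: cfun.scale_sum_right)
    qed
    have c_act: "c (rep_act M x v) U = rep_act M x (c v U)" if v: "v \<in> rep_space M" and x: "x \<in> sl3" for x v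
    proof (rule c_eq [OF M.act_closed [OF x v] U])
      show "rep_act M x (c v X) \<in> X" if "X \<in> D" for X
        using cX [OF v that] sub [OF that] x by (simp add: submodule_def)
      show "rep_act M x v = (\<Sum>X\<in>D. rep_act M x (c v X))"
        using M.act_sum [OF x, of D "c v"] cM [OF v] cs [OF v] by simp
    qed
    have p: "module_hom M (restrict_rep M U) (\<lambda>v. c v U)"
      using cX U by (auto simp: module_hom_def c_add c_scale c_act)
    have "U \<noteq> {0}" using irr [OF U] by (simp add: irreducible_module_def)
    moreover have "0 \<in> U" using sub [OF U] by (simp add: submodule_def cfun.subspace_0)
    ultimately obtain u where u: "u \<in> U" "u \<noteq> 0" by blast
    have uM: "u \<in> rep_space M" using u sub [OF U] by (auto simp: submodule_def)
    have "c u U = (if U = U then u else 0)"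
    proof (rule c_eq [where f = "\<lambda>X. if X = U then u else 0", OF uM U])
      show "(if X = U then u else 0) \<in> X" if "X \<in> D" for X
        using u(1) sub [OF that] by (simp add: submodule_def cfun.subspace_0)
      show "u = (\<Sum>X\<in>D. if X = U then u else 0)" using fin U by simp
    qed
    then have "c u U = u" by simp
    moreover have "j u \<noteq> 0"
    proof
      assume "j u = 0"
      have mU: "sl3_module (restrict_rep M U)" using irr [OF U] by (rule irreducible_module_sl3)
      have "j 0 = 0" by (rule module_hom_zero [OF mU module_iso_hom [OF j]])
      moreover have "inj_on j U" using j by (simp add: module_iso_def bij_betw_def)
      ultimately have "u = 0" using inj_onD [of j U u 0] \<open>j u = 0\<close> u(1) \<open>0 \<in> U\<close> by simp
      then show False using u by simp
    qed
    ultimately show "\<exists>h t. module_hom M V h \<and> t \<in> rep_space M \<and> h t \<noteq> 0"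
      using module_hom_comp [OF p module_iso_hom [OF j]] uM
      by (intro exI [of _ "j \<circ> (\<lambda>v. c v U)"] exI [of _ u]) simp
  next
    assume "\<exists>h t. module_hom M V h \<and> t \<in> rep_space M \<and> h t \<noteq> 0"
    then obtain h t where h: "module_hom M V h" and t: "t \<in> rep_space M" "h t \<noteq> 0" by blast
    obtain f where f: "f \<in> (\<Pi>\<^sub>E U\<in>D. U)" "t = (\<Sum>U\<in>D. f U)" using uniq [OF t(1)] by auto
    have fU: "f U \<in> U" if "U \<in> D" for U using f(1) that by (auto simp: PiE_iff)
    have "f U \<in> rep_space M" if "U \<in> D" for U using fU sub that by (auto simp: submodule_def)
    then have "h t = (\<Sum>U\<in>D. h (f U))" unfolding f(2) by (rule module_hom_sum [OF M h])
    then obtain U where U: "U \<in> D" "h (f U) \<noteq> 0" using t(2) by (metis sum.neutral)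
    have "module_iso (restrict_rep M U) V h"
      using fU [OF U(1)] U(2) by (intro schur [OF irr [OF U(1)] V module_hom_restrict [OF h sub [OF U(1)]]]) auto
    then show "\<exists>U\<in>D. isomorphic_modules (restrict_rep M U) V"
      using U(1) by (auto simp: isomorphic_modules_def)
  qed
  finally show ?thesis .
qed

text \<open>A reduced echelon basis: the coefficient of a vector at \<open>e i\<close> is its value
  at the index i. Coordinates are thus evaluations, and those of an element of a tensor product are
  its values at pairs of indices.\<close>

definition coordinate_basis :: "('i \<Rightarrow> complex) set \<Rightarrow> 'i set \<Rightarrow> ('i \<Rightarrow> 'i \<Rightarrow> complex) \<Rightarrow> bool" where
  "coordinate_basis V I e \<longleftrightarrow> finite I \<and> (\<forall>i\<in>I. e i \<in> V) \<and>
     (\<forall>i\<in>I. \<forall>j\<in>I. e i j = (if i = j then 1 else 0)) \<and>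
     (\<forall>v\<in>V. v = (\<Sum>i\<in>I. fun_scale (v i) (e i)))"

text \<open>Gaussian elimination: a new spanning vector is reduced modulo the old basis and, if nonzero,
  normalized at a coordinate where it does not vanish.\<close>

lemma coordinate_basis_span:
  assumes "finite B"
  shows "\<exists>I e. coordinate_basis (cfun.span B) I e"
  using assms
proof induction
  case empty
  have "coordinate_basis (cfun.span {}) {} (\<lambda>_. 0 :: 'a \<Rightarrow> complex)"
    by (simp add: coordinate_basis_def cfun.span_empty)
  then show ?case by blast
next
  case (insert b B)
  then obtain I e where cb: "coordinate_basis (cfun.span B) I e" by blast
  then have I: "finite I" and eB: "\<And>i. i \<in> I \<Longrightarrow> e i \<in> cfun.span B"
    and eij: "\<And>i j. i \<in> I \<Longrightarrow> j \<in> I \<Longrightarrow> e i j = (if i = j then 1 else 0)"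
    and ex: "\<And>v. v \<in> cfun.span B \<Longrightarrow> v = (\<Sum>i\<in>I. fun_scale (v i) (e i))"
    by (auto simp: coordinate_basis_def)
  define c where "c = b - (\<Sum>i\<in>I. fun_scale (b i) (e i))"
  have rB: "(\<Sum>i\<in>I. fun_scale (b i) (e i)) \<in> cfun.span B"
    using eB by (intro cfun.span_sum cfun.span_scale) auto
  have cI: "c i = 0" if "i \<in> I" for i
    using that I by (simp add: c_def sum_fun_apply eij if_distrib cong: if_cong)
  have spanc: "cfun.span (insert b B) = cfun.span (insert c B)"
  proof (rule antisym; rule cfun.span_minimal [OF _ cfun.subspace_span])
    have mono: "cfun.span B \<subseteq> cfun.span (insert c B)" "cfun.span B \<subseteq> cfun.span (insert b B)"
      by (auto intro!: cfun.span_mono)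
    have "b = c + (\<Sum>i\<in>I. fun_scale (b i) (e i))" by (simp add: c_def)
    also have "\<dots> \<in> cfun.span (insert c B)"
      using rB mono by (intro cfun.span_add) (auto intro: cfun.span_base)
    finally show "insert b B \<subseteq> cfun.span (insert c B)" by (auto intro: cfun.span_base)
    have "c \<in> cfun.span (insert b B)"
      unfolding c_def using rB mono by (intro cfun.span_diff) (auto intro: cfun.span_base)
    then show "insert c B \<subseteq> cfun.span (insert b B)" by (auto intro: cfun.span_base)
  qed
  show ?case
  proof (cases "c = 0")
    case True
    then have "cfun.span (insert b B) = cfun.span B" unfolding spanc by (simp add: cfun.span_insert_0)
    then have "\<exists>I e. coordinate_basis (cfun.span (insert b B)) I e" using cb by auto
    then show ?thesis .
  next
    case False
    then obtain p where p: "c p \<noteq> 0" by (auto simp: fun_eq_iff)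
    then have pI: "p \<notin> I" using cI by auto
    define d where "d = fun_scale (1 / c p) c"
    have dp: "d p = 1" and dI: "\<And>i. i \<in> I \<Longrightarrow> d i = 0" using p cI by (auto simp: d_def)
    have dc: "c = fun_scale (c p) d" using p by (simp add: d_def fun_eq_iff)
    \<comment> \<open>The new pivot \<open>p\<close> is cleared from the old basis vectors; since
      \<open>d\<close> vanishes on \<open>I\<close>, their own pivots survive.\<close>
    define e' where "e' i = (if i = p then d else e i - fun_scale (e i p) d)" for i
    have dspan: "d \<in> cfun.span (insert c B)"
      unfolding d_def by (intro cfun.span_scale cfun.span_base) simp
    have mono: "cfun.span B \<subseteq> cfun.span (insert c B)" by (auto intro!: cfun.span_mono)
    have "coordinate_basis (cfun.span (insert b B)) (insert p I) e'"
      unfolding coordinate_basis_def spanc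
    proof (intro conjI ballI)
      show "finite (insert p I)" using I by simp
      show "e' i \<in> cfun.span (insert c B)" if "i \<in> insert p I" for i
        using that dspan eB mono by (auto simp: e'_def intro!: cfun.span_diff cfun.span_scale)
      show "e' i j = (if i = j then 1 else 0)" if "i \<in> insert p I" "j \<in> insert p I" for i j
        using that dp dI pI eij by (auto simp: e'_def)
      fix v assume "v \<in> cfun.span (insert c B)"
      then obtain k where "v - fun_scale k c \<in> cfun.span B" using cfun.span_breakdown_eq by blast
      then obtain w where w: "w \<in> cfun.span B" "v = fun_scale (k * c p) d + w"
        using dc by (metis add.commute cfun.scale_scale diff_add_cancel)
      define r where "r = k * c p"
      have vi: "v i = w i" if "i \<in> I" for i using w(2) dI that by simp
      have vp: "v p = r + w p" using w(2) dp by (simp add: r_def)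
      have "(\<Sum>i\<in>I. fun_scale (v i) (e' i)) = (\<Sum>i\<in>I. fun_scale (w i) (e i) - fun_scale (w i * e i p) d)"
        using pI by (intro sum.cong) (auto simp: vi e'_def cfun.scale_right_diff_distrib)
      also have "\<dots> = w - fun_scale (w p) d"
      proof -
        have "w p = (\<Sum>i\<in>I. w i * e i p)"
          using fun_cong [OF ex [OF w(1)], of p] by (simp add: sum_fun_apply)
        then show ?thesis
          using ex [OF w(1)] by (simp add: sum_subtractf cfun.scale_sum_left)
      qed
      finally have "(\<Sum>i\<in>insert p I. fun_scale (v i) (e' i)) = fun_scale (r + w p) d + (w - fun_scale (w p) d)"
        using I pI by (simp add: vp e'_def)
      also have "\<dots> = v" unfolding w(2) r_def [symmetric] by (rule ext) (simp add: algebra_simps)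
      finally show "v = (\<Sum>i\<in>insert p I. fun_scale (v i) (e' i))" by simp
    qed
    then show ?thesis by blast
  qed
qed

lemma (in sl3_module) coordinate_basis_exists: "\<exists>I e. coordinate_basis (rep_space M) I e"
proof -
  obtain B where "finite B" "rep_space M = cfun.span B" using finite_dim by blast
  with coordinate_basis_span [OF this(1)] show ?thesis by simp
qed

section \<open>Tensor products and bilinear maps\<close>

lemma coordinate_basisD:
  assumes "coordinate_basis V I e"
  shows "finite I" "i \<in> I \<Longrightarrow> e i \<in> V"
    and "i \<in> I \<Longrightarrow> j \<in> I \<Longrightarrow> e i j = (if i = j then 1 else 0)"
    and "v \<in> V \<Longrightarrow> (\<Sum>i\<in>I. fun_scale (v i) (e i)) = v"
  using assms by (auto simp: coordinate_basis_def)

definition bilinear_hom ::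
  "'i rep \<Rightarrow> 'j rep \<Rightarrow> 'k rep \<Rightarrow> (('i \<Rightarrow> complex) \<Rightarrow> ('j \<Rightarrow> complex) \<Rightarrow> ('k \<Rightarrow> complex)) \<Rightarrow> bool" where
  "bilinear_hom M N V b \<longleftrightarrow>
     (\<forall>v\<in>rep_space M. \<forall>w\<in>rep_space N. b v w \<in> rep_space V) \<and>
     (\<forall>v\<in>rep_space M. \<forall>v'\<in>rep_space M. \<forall>w\<in>rep_space N. b (v + v') w = b v w + b v' w) \<and>
     (\<forall>v\<in>rep_space M. \<forall>w\<in>rep_space N. \<forall>w'\<in>rep_space N. b v (w + w') = b v w + b v w') \<and>
     (\<forall>v\<in>rep_space M. \<forall>w\<in>rep_space N. \<forall>c. b (fun_scale c v) w = fun_scale c (b v w)) \<and>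
     (\<forall>v\<in>rep_space M. \<forall>w\<in>rep_space N. \<forall>c. b v (fun_scale c w) = fun_scale c (b v w)) \<and>
     (\<forall>x\<in>sl3. \<forall>v\<in>rep_space M. \<forall>w\<in>rep_space N.
       rep_act V x (b v w) = b (rep_act M x v) w + b v (rep_act N x w))"

lemma bilinear_homD:
  assumes "bilinear_hom M N V b" "v \<in> rep_space M" "w \<in> rep_space N"
  shows "b v w \<in> rep_space V"
    and "v' \<in> rep_space M \<Longrightarrow> b (v + v') w = b v w + b v' w"
    and "w' \<in> rep_space N \<Longrightarrow> b v (w + w') = b v w + b v w'"
    and "b (fun_scale c v) w = fun_scale c (b v w)"
    and "b v (fun_scale c w) = fun_scale c (b v w)"
    and "x \<in> sl3 \<Longrightarrow> rep_act V x (b v w) = b (rep_act M x v) w + b v (rep_act N x w)"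
  using assms by (simp_all add: bilinear_hom_def)

lemma bilinear_hom_zero:
  assumes "bilinear_hom M N V b" "v \<in> rep_space M" "w \<in> rep_space N"
  shows "b 0 w = 0" "b v 0 = 0"
  using bilinear_homD(4) [OF assms, of 0] bilinear_homD(5) [OF assms, of 0] by simp_all

locale tensor_product = M: sl3_module M + N: sl3_module N for M :: "'i rep" and N :: "'j rep"
begin

abbreviation "T \<equiv> tensor_rep M N"

lemma slices:
  assumes "t \<in> rep_space T"
  shows "(\<lambda>k. t (k, j)) \<in> rep_space M" "(\<lambda>k. t (i, k)) \<in> rep_space N"
proof -
  let ?S = "{t. (\<forall>j. (\<lambda>k. t (k, j)) \<in> rep_space M) \<and> (\<forall>i. (\<lambda>k. t (i, k)) \<in> rep_space N)}"
  have "rep_space T \<subseteq> ?S"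
    unfolding tensor_rep_def rep.simps
  proof (rule cfun.span_minimal)
    have "tensor v w \<in> ?S" if "v \<in> rep_space M" "w \<in> rep_space N" for v w
    proof -
      have "(\<lambda>k. tensor v w (k, j)) = fun_scale (w j) v" for j by (auto simp: tensor_def)
      moreover have "(\<lambda>k. tensor v w (i, k)) = fun_scale (v i) w" for i by (auto simp: tensor_def)
      ultimately show ?thesis using that by (simp add: M.scale_in N.scale_in)
    qed
    then show "{tensor v w |v w. v \<in> rep_space M \<and> w \<in> rep_space N} \<subseteq> ?S" by blast
    have "0 \<in> ?S" using M.zero_in N.zero_in by (simp add: zero_fun_def)
    moreover have "s + t \<in> ?S" if "s \<in> ?S" "t \<in> ?S" for s t
    proof -
      have "(\<lambda>k. (s + t) (k, j)) = (\<lambda>k. s (k, j)) + (\<lambda>k. t (k, j))" for j by auto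
      moreover have "(\<lambda>k. (s + t) (i, k)) = (\<lambda>k. s (i, k)) + (\<lambda>k. t (i, k))" for i by auto
      ultimately show ?thesis using that by (simp only: mem_Collect_eq) (blast intro: M.add_in N.add_in)
    qed
    moreover have "fun_scale c t \<in> ?S" if "t \<in> ?S" for c t
    proof -
      have "(\<lambda>k. fun_scale c t (k, j)) = fun_scale c (\<lambda>k. t (k, j))" for j by auto
      moreover have "(\<lambda>k. fun_scale c t (i, k)) = fun_scale c (\<lambda>k. t (i, k))" for i by auto
      ultimately show ?thesis using that by (simp only: mem_Collect_eq) (blast intro: M.scale_in N.scale_in)
    qed
    ultimately show "cfun.subspace ?S" unfolding cfun.subspace_def by blast
  qed
  then show "(\<lambda>k. t (k, j)) \<in> rep_space M" "(\<lambda>k. t (i, k)) \<in> rep_space N" using assms by auto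
qed

lemma act_apply:
  "rep_act T x t (i, j) = rep_act M x (\<lambda>k. t (k, j)) i + rep_act N x (\<lambda>k. t (i, k)) j"
  by (simp add: tensor_rep_def)

lemma subspace_T: "cfun.subspace (rep_space T)"
  by (simp add: tensor_rep_def)

lemma tensor_in: "v \<in> rep_space M \<Longrightarrow> w \<in> rep_space N \<Longrightarrow> tensor v w \<in> rep_space T"
  by (auto simp: tensor_rep_def intro!: cfun.span_base)

lemma T_act_add:
  assumes x: "x \<in> sl3" and s: "s \<in> rep_space T" and t: "t \<in> rep_space T"
  shows "rep_act T x (s + t) = rep_act T x s + rep_act T x t"
proof (rule ext, clarify)
  fix i j
  have "(\<lambda>k. (s + t) (k, j)) = (\<lambda>k. s (k, j)) + (\<lambda>k. t (k, j))"
    "(\<lambda>k. (s + t) (i, k)) = (\<lambda>k. s (i, k)) + (\<lambda>k. t (i, k))" by auto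
  then show "rep_act T x (s + t) (i, j) = (rep_act T x s + rep_act T x t) (i, j)"
    using M.act_add [OF x slices(1) [OF s] slices(1) [OF t]] N.act_add [OF x slices(2) [OF s] slices(2) [OF t]]
    by (simp only: act_apply plus_fun_apply) simp
qed

lemma T_act_scale:
  assumes x: "x \<in> sl3" and t: "t \<in> rep_space T"
  shows "rep_act T x (fun_scale c t) = fun_scale c (rep_act T x t)"
proof (rule ext, clarify)
  fix i j
  have "(\<lambda>k. fun_scale c t (k, j)) = fun_scale c (\<lambda>k. t (k, j))"
    "(\<lambda>k. fun_scale c t (i, k)) = fun_scale c (\<lambda>k. t (i, k))" by auto
  then show "rep_act T x (fun_scale c t) (i, j) = fun_scale c (rep_act T x t) (i, j)"
    using M.act_scale [OF x slices(1) [OF t]] N.act_scale [OF x slices(2) [OF t]]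
    by (simp only: act_apply fun_scale_apply) (simp add: distrib_left)
qed

lemma T_act_tensor:
  "x \<in> sl3 \<Longrightarrow> v \<in> rep_space M \<Longrightarrow> w \<in> rep_space N \<Longrightarrow>
    rep_act T x (tensor v w) = tensor (rep_act M x v) w + tensor v (rep_act N x w)"
  by (rule tensor_rep_act_tensor) unfold_locales

lemma tensor_induct [consumes 1, case_names tensor zero add scale]:
  assumes "t \<in> rep_space T"
    and tensor: "\<And>v w. v \<in> rep_space M \<Longrightarrow> w \<in> rep_space N \<Longrightarrow> P (tensor v w)"
    and zero: "P 0"
    and add: "\<And>s t. s \<in> rep_space T \<Longrightarrow> t \<in> rep_space T \<Longrightarrow> P s \<Longrightarrow> P t \<Longrightarrow> P (s + t)"
    and scale: "\<And>c t. t \<in> rep_space T \<Longrightarrow> P t \<Longrightarrow> P (fun_scale c t)"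
  shows "P t"
proof -
  let ?S = "{t \<in> rep_space T. P t}"
  have "cfun.subspace ?S"
    using subspace_T zero add scale unfolding cfun.subspace_def by simp
  moreover have "{tensor v w |v w. v \<in> rep_space M \<and> w \<in> rep_space N} \<subseteq> ?S"
    using tensor tensor_in by auto
  ultimately have "cfun.span {tensor v w |v w. v \<in> rep_space M \<and> w \<in> rep_space N} \<subseteq> ?S"
    by (intro cfun.span_minimal)
  then show ?thesis using assms(1) by (auto simp: tensor_rep_def)
qed

lemma T_act_closed:
  assumes x: "x \<in> sl3" and t: "t \<in> rep_space T"
  shows "rep_act T x t \<in> rep_space T"
  using t
proof (induction rule: tensor_induct)
  case (tensor v w)
  then show ?case using x
    by (simp only: T_act_tensor)
      (intro cfun.subspace_add [OF subspace_T] tensor_in M.act_closed N.act_closed)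
next
  case zero
  have "rep_act T x (fun_scale 0 0) = fun_scale 0 (rep_act T x 0)"
    by (rule T_act_scale [OF x]) (rule cfun.subspace_0 [OF subspace_T])
  then have "rep_act T x 0 = 0" by simp
  then show ?case by (simp only: cfun.subspace_0 [OF subspace_T])
next
  case (add s t)
  then show ?case by (simp only: T_act_add [OF x] cfun.subspace_add [OF subspace_T])
next
  case (scale c t)
  then show ?case by (simp only: T_act_scale [OF x] cfun.subspace_scale [OF subspace_T])
qed

lemma tensor_add: "tensor (v + v') w = tensor v w + tensor v' w" "tensor v (w + w') = tensor v w + tensor v w'"
  by (auto simp: tensor_def algebra_simps)

lemma tensor_diff: "tensor (v - v') w = tensor v w - tensor v' w" "tensor v (w - w') = tensor v w - tensor v w'"
  by (auto simp: tensor_def algebra_simps)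

lemma tensor_scale: "tensor (fun_scale c v) w = fun_scale c (tensor v w)" "tensor v (fun_scale c w) = fun_scale c (tensor v w)"
  by (auto simp: tensor_def algebra_simps)

lemma T_module: "sl3_module T"
proof
  show "cfun.subspace (rep_space T)" by (rule subspace_T)
  show "rep_act T x t \<in> rep_space T" if "x \<in> sl3" "t \<in> rep_space T" for x t using that by (rule T_act_closed)
  show "rep_act T x (s + t) = rep_act T x s + rep_act T x t"
    if "x \<in> sl3" "s \<in> rep_space T" "t \<in> rep_space T" for x s t using that by (rule T_act_add)
  show "rep_act T x (fun_scale c t) = fun_scale c (rep_act T x t)"
    if "x \<in> sl3" "t \<in> rep_space T" for x t c using that by (rule T_act_scale)
  show "rep_act T (x + y) t = rep_act T x t + rep_act T y t"
    if "x \<in> sl3" "y \<in> sl3" "t \<in> rep_space T" for x y t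
    using that by (auto simp: act_apply M.add_act N.add_act slices)
  show "rep_act T (matrix_scale c x) t = fun_scale c (rep_act T x t)"
    if "x \<in> sl3" "t \<in> rep_space T" for x t c
    using that by (auto simp: act_apply M.scale_act N.scale_act slices distrib_left)
  \<comment> \<open>The preceding axioms concern one application of the action and can mostly be
    read off slices; here two applications mix the variables, so the identity is checked on
    decomposable tensors and extended linearly.\<close>
  show "rep_act T (lie_bracket x y) t = rep_act T x (rep_act T y t) - rep_act T y (rep_act T x t)"
    if x: "x \<in> sl3" and y: "y \<in> sl3" and t: "t \<in> rep_space T" for x y t
    using t
  proof (induction rule: tensor_induct)
    case (tensor v w)
    have "rep_act T (lie_bracket x y) (tensor v w)
      = rep_act T x (rep_act T y (tensor v w)) - rep_act T y (rep_act T x (tensor v w))"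
      using tensor x y
      by (simp add: T_act_tensor T_act_add tensor_in M.act_closed N.act_closed sl3_bracket
          M.bracket_act N.bracket_act tensor_diff)
    then show ?case .
  next
    case zero
    have "rep_act T z 0 = 0" if "z \<in> sl3" for z
      using T_act_scale [OF that cfun.subspace_0 [OF subspace_T], of 0] by simp
    then have "rep_act T (lie_bracket x y) 0 = rep_act T x (rep_act T y 0) - rep_act T y (rep_act T x 0)"
      using x y sl3_bracket by simp
    then show ?case .
  next
    case (add s t)
    have s: "rep_act T (lie_bracket x y) s = rep_act T x (rep_act T y s) - rep_act T y (rep_act T x s)"
      using add(3) .
    have t: "rep_act T (lie_bracket x y) t = rep_act T x (rep_act T y t) - rep_act T y (rep_act T x t)"
      using add(4) .
    have "rep_act T (lie_bracket x y) (s + t) = rep_act T x (rep_act T y (s + t)) - rep_act T y (rep_act T x (s + t))"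
      by (simp add: T_act_add T_act_closed sl3_bracket add(1,2) x y s t)
    then show ?case .
  next
    case (scale c t)
    have t: "rep_act T (lie_bracket x y) t = rep_act T x (rep_act T y t) - rep_act T y (rep_act T x t)"
      using scale(2) .
    have "rep_act T (lie_bracket x y) (fun_scale c t)
      = rep_act T x (rep_act T y (fun_scale c t)) - rep_act T y (rep_act T x (fun_scale c t))"
      by (simp add: T_act_scale T_act_closed sl3_bracket cfun.scale_right_diff_distrib scale(1) x y t)
    then show ?case .
  qed
  show "\<exists>B. finite B \<and> rep_space T = cfun.span B"
  proof -
    obtain I e where e: "coordinate_basis (rep_space M) I e" using M.coordinate_basis_exists by blast
    obtain J d where d: "coordinate_basis (rep_space N) J d" using N.coordinate_basis_exists by blast
    note e = coordinate_basisD [OF e] and d = coordinate_basisD [OF d]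
    let ?B = "(\<lambda>(i, j). tensor (e i) (d j)) ` (I \<times> J)"
    have "tensor v w \<in> cfun.span ?B" if "v \<in> rep_space M" "w \<in> rep_space N" for v w
    proof -
      have "tensor v w = (\<Sum>i\<in>I. \<Sum>j\<in>J. fun_scale (v i * w j) (tensor (e i) (d j)))"
      proof (rule ext, clarify)
        fix a b
        have "v a = (\<Sum>i\<in>I. v i * e i a)" "w b = (\<Sum>j\<in>J. w j * d j b)"
          using fun_cong [OF e(4) [OF that(1)], of a] fun_cong [OF d(4) [OF that(2)], of b]
          by (simp_all add: sum_fun_apply)
        then show "tensor v w (a, b) = (\<Sum>i\<in>I. \<Sum>j\<in>J. fun_scale (v i * w j) (tensor (e i) (d j))) (a, b)"
          by (simp add: sum_fun_apply tensor_def sum_product mult_ac)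
      qed
      also have "\<dots> \<in> cfun.span ?B"
        by (intro cfun.span_sum cfun.span_scale cfun.span_base) auto
      finally show ?thesis .
    qed
    then have "rep_space T \<subseteq> cfun.span ?B"
      unfolding tensor_rep_def rep.simps by (intro cfun.span_minimal) auto
    then show ?thesis using e(1) d(1) by (intro finite_dim_subspace [OF subspace_T]) auto
  qed
qed

text \<open>The linear map induced by a bilinear one, written in the product of two coordinate
  bases. No representation of \<open>t\<close> as a sum of decomposable tensors is chosen, so there
  is nothing to be checked about independence of it.\<close>

definition tensor_lift ::
  "'i set \<Rightarrow> ('i \<Rightarrow> 'i \<Rightarrow> complex) \<Rightarrow> 'j set \<Rightarrow> ('j \<Rightarrow> 'j \<Rightarrow> complex)
    \<Rightarrow> (('i \<Rightarrow> complex) \<Rightarrow> ('j \<Rightarrow> complex) \<Rightarrow> ('k \<Rightarrow> complex)) \<Rightarrow> ('i \<times> 'j \<Rightarrow> complex) \<Rightarrow> ('k \<Rightarrow> complex)" where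
  "tensor_lift I e J d b t = (\<Sum>i\<in>I. \<Sum>j\<in>J. fun_scale (t (i, j)) (b (e i) (d j)))"

lemma tensor_lift_hom:
  assumes e: "coordinate_basis (rep_space M) I e" and d: "coordinate_basis (rep_space N) J d"
    and V: "sl3_module V" and b: "bilinear_hom M N V b"
  shows "module_hom T V (tensor_lift I e J d b)"
    and "v \<in> rep_space M \<Longrightarrow> w \<in> rep_space N \<Longrightarrow> tensor_lift I e J d b (tensor v w) = b v w"
proof -
  interpret V: sl3_module V by fact
  let ?h = "tensor_lift I e J d b"
  note e = coordinate_basisD [OF e] and d = coordinate_basisD [OF d]
  note b' = bilinear_homD [OF b]
  have h_add: "?h (s + t) = ?h s + ?h t" for s t
    by (simp add: tensor_lift_def cfun.scale_left_distrib sum.distrib)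
  have h_scale: "?h (fun_scale c t) = fun_scale c (?h t)" for c t
    by (simp add: tensor_lift_def cfun.scale_sum_right)
  have h_zero: "?h 0 = 0" by (simp add: tensor_lift_def)
  have b_sum1: "b (\<Sum>i\<in>K. fun_scale (r i) (e i)) w = (\<Sum>i\<in>K. fun_scale (r i) (b (e i) w))"
    if "K \<subseteq> I" "w \<in> rep_space N" for K r w
  proof -
    have "finite K" using that(1) e(1) by (rule finite_subset)
    then show ?thesis using that(1)
    proof induction
      case empty
      have "b (\<Sum>i\<in>{}. fun_scale (r i) (e i)) w = (\<Sum>i\<in>{}. fun_scale (r i) (b (e i) w))"
        using bilinear_hom_zero(1) [OF b M.zero_in that(2)] by simp
      then show ?case .
    next
      case (insert i K)
      have K: "K \<subseteq> I" using insert.prems by simp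
      have IH: "b (\<Sum>i\<in>K. fun_scale (r i) (e i)) w = (\<Sum>i\<in>K. fun_scale (r i) (b (e i) w))"
        using insert.IH [OF K] .
      have "e i \<in> rep_space M" "(\<Sum>i\<in>K. fun_scale (r i) (e i)) \<in> rep_space M"
        using insert.prems e(2) by (auto intro!: M.sum_in M.scale_in)
      then have "b (\<Sum>i\<in>insert i K. fun_scale (r i) (e i)) w = (\<Sum>i\<in>insert i K. fun_scale (r i) (b (e i) w))"
        using insert.hyps that(2) by (simp add: b' M.scale_in IH)
      then show ?case .
    qed
  qed
  have b_sum2: "b v (\<Sum>j\<in>K. fun_scale (r j) (d j)) = (\<Sum>j\<in>K. fun_scale (r j) (b v (d j)))"
    if "K \<subseteq> J" "v \<in> rep_space M" for K r v
  proof -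
    have "finite K" using that(1) d(1) by (rule finite_subset)
    then show ?thesis using that(1)
    proof induction
      case empty
      have "b v (\<Sum>j\<in>{}. fun_scale (r j) (d j)) = (\<Sum>j\<in>{}. fun_scale (r j) (b v (d j)))"
        using bilinear_hom_zero(2) [OF b that(2) N.zero_in] by simp
      then show ?case .
    next
      case (insert j K)
      have K: "K \<subseteq> J" using insert.prems by simp
      have IH: "b v (\<Sum>j\<in>K. fun_scale (r j) (d j)) = (\<Sum>j\<in>K. fun_scale (r j) (b v (d j)))"
        using insert.IH [OF K] .
      have "d j \<in> rep_space N" "(\<Sum>j\<in>K. fun_scale (r j) (d j)) \<in> rep_space N"
        using insert.prems d(2) by (auto intro!: N.sum_in N.scale_in)
      then have "b v (\<Sum>j\<in>insert j K. fun_scale (r j) (d j)) = (\<Sum>j\<in>insert j K. fun_scale (r j) (b v (d j)))"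
        using insert.hyps that(2) by (simp add: b' N.scale_in IH)
      then show ?case .
    qed
  qed
  have h_tensor: "?h (tensor v w) = b v w" if v: "v \<in> rep_space M" and w: "w \<in> rep_space N" for v w
  proof -
    have "b v w = b (\<Sum>i\<in>I. fun_scale (v i) (e i)) (\<Sum>j\<in>J. fun_scale (w j) (d j))"
      by (simp add: e(4) [OF v] d(4) [OF w])
    also have "\<dots> = (\<Sum>i\<in>I. fun_scale (v i) (b (e i) (\<Sum>j\<in>J. fun_scale (w j) (d j))))"
      using d(4) [OF w] w by (intro b_sum1) auto
    also have "\<dots> = (\<Sum>i\<in>I. fun_scale (v i) (\<Sum>j\<in>J. fun_scale (w j) (b (e i) (d j))))"
      using e(2) by (intro sum.cong refl) (simp add: b_sum2)
    also have "\<dots> = ?h (tensor v w)"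
      by (simp add: tensor_lift_def tensor_def cfun.scale_sum_right)
    finally show ?thesis ..
  qed
  then show "v \<in> rep_space M \<Longrightarrow> w \<in> rep_space N \<Longrightarrow> ?h (tensor v w) = b v w" .
  have h_in: "?h t \<in> rep_space V" for t
    unfolding tensor_lift_def using b'(1) e(2) d(2) by (intro V.sum_in V.scale_in) auto
  have "?h (rep_act T x t) = rep_act V x (?h t)" if x: "x \<in> sl3" and t: "t \<in> rep_space T" for x t
    using t
  proof (induction rule: tensor_induct)
    case (tensor v w)
    have "?h (rep_act T x (tensor v w)) = rep_act V x (?h (tensor v w))"
      using tensor x by (simp add: T_act_tensor h_add h_tensor M.act_closed N.act_closed b')
    then show ?case .
  next
    case zero
    have "rep_act T x 0 = 0" using T_act_scale [OF x cfun.subspace_0 [OF subspace_T], of 0] by simp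
    then have "?h (rep_act T x 0) = rep_act V x (?h 0)" using x by (simp add: h_zero V.act_zero)
    then show ?case .
  next
    case (add s t)
    have s: "?h (rep_act T x s) = rep_act V x (?h s)" using add(3) .
    have t: "?h (rep_act T x t) = rep_act V x (?h t)" using add(4) .
    have "?h (rep_act T x (s + t)) = rep_act V x (?h (s + t))"
      by (simp add: T_act_add h_add V.act_add h_in add(1,2) x s t)
    then show ?case .
  next
    case (scale c t)
    have t: "?h (rep_act T x t) = rep_act V x (?h t)" using scale(2) .
    have "?h (rep_act T x (fun_scale c t)) = rep_act V x (?h (fun_scale c t))"
      by (simp add: T_act_scale h_scale V.act_scale h_in scale(1) x t)
    then show ?case .
  qed
  then show "module_hom T V ?h"
    using h_in by (auto simp: module_hom_def h_add h_scale)
qed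

lemma hom_iff_bilinear:
  assumes V: "sl3_module V"
  shows "(\<exists>h t. module_hom T V h \<and> t \<in> rep_space T \<and> h t \<noteq> 0)
    \<longleftrightarrow> (\<exists>b v w. bilinear_hom M N V b \<and> v \<in> rep_space M \<and> w \<in> rep_space N \<and> b v w \<noteq> 0)"
proof
  assume "\<exists>h t. module_hom T V h \<and> t \<in> rep_space T \<and> h t \<noteq> 0"
  then obtain h t where h: "module_hom T V h" and t: "t \<in> rep_space T" "h t \<noteq> 0" by blast
  note hD = module_homD [OF h]
  have "bilinear_hom M N V (\<lambda>v w. h (tensor v w))"
    by (simp add: bilinear_hom_def tensor_in hD tensor_add tensor_scale M.act_closed N.act_closed
        T_act_tensor flip: hD(4))
  moreover have "\<exists>v\<in>rep_space M. \<exists>w\<in>rep_space N. h (tensor v w) \<noteq> 0"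
  proof (rule ccontr)
    assume *: "\<not> (\<exists>v\<in>rep_space M. \<exists>w\<in>rep_space N. h (tensor v w) \<noteq> 0)"
    have "h t = 0"
      using t(1)
    proof (induction rule: tensor_induct)
      case zero
      show ?case by (rule module_hom_zero [OF T_module h])
    next
      case (add s t)
      have "h s = 0" using add(3) .
      moreover have "h t = 0" using add(4) .
      ultimately have "h (s + t) = 0" using add(1,2) by (simp add: hD)
      then show ?case .
    next
      case (scale c t)
      have "h t = 0" using scale(2) .
      then have "h (fun_scale c t) = 0" using scale(1) by (simp add: hD)
      then show ?case .
    qed (use * in blast)
    then show False using t(2) by simp
  qed
  ultimately show "\<exists>b v w. bilinear_hom M N V b \<and> v \<in> rep_space M \<and> w \<in> rep_space N \<and> b v w \<noteq> 0"
    by blast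
next
  assume "\<exists>b v w. bilinear_hom M N V b \<and> v \<in> rep_space M \<and> w \<in> rep_space N \<and> b v w \<noteq> 0"
  then obtain b v w where b: "bilinear_hom M N V b" and vw: "v \<in> rep_space M" "w \<in> rep_space N" "b v w \<noteq> 0"
    by blast
  obtain I e where e: "coordinate_basis (rep_space M) I e" using M.coordinate_basis_exists by blast
  obtain J d where d: "coordinate_basis (rep_space N) J d" using N.coordinate_basis_exists by blast
  note h = tensor_lift_hom [OF e d V b]
  show "\<exists>h t. module_hom T V h \<and> t \<in> rep_space T \<and> h t \<noteq> 0"
    using h(1) tensor_in [OF vw(1,2)] h(2) [OF vw(1,2)] vw(3) by metis
qed

end

section \<open>Concatenation of words and the embedding of a tensor product into a tensor
  power\<close>

definition word_cat :: "nat \<Rightarrow> (3 list \<Rightarrow> complex) \<Rightarrow> (3 list \<Rightarrow> complex) \<Rightarrow> 3 list \<Rightarrow> complex" where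
  "word_cat n t t' w = t (take n w) * t' (drop n w)"

lemma wact_word_cat:
  assumes "\<And>u. length u \<noteq> length sg \<Longrightarrow> t u = 0"
  shows "wact (sg @ sg') x (word_cat (length sg) t t') w
    = word_cat (length sg) (wact sg x t) t' w + word_cat (length sg) t (wact sg' x t') w"
  using assms
proof (induction sg arbitrary: t w)
  case Nil
  have "word_cat 0 t t' = (\<lambda>w. t [] * t' w)" by (auto simp: word_cat_def)
  then show ?case by (simp add: wact_scale) (simp add: word_cat_def)
next
  case (Cons s sg)
  show ?case
  proof (cases w)
    case Nil
    then show ?thesis using Cons.prems [of "[]"] by (simp add: word_cat_def)
  next
    case (Cons i v)
    have tail: "(\<lambda>u. word_cat (Suc (length sg)) t t' (i # u)) = word_cat (length sg) (\<lambda>u. t (i # u)) t'" for i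
      by (auto simp: word_cat_def)
    have "wact (sg @ sg') x (word_cat (length sg) (\<lambda>u. t (i # u)) t') v
      = word_cat (length sg) (wact sg x (\<lambda>u. t (i # u))) t' v
        + word_cat (length sg) (\<lambda>u. t (i # u)) (wact sg' x t') v"
      using Cons.prems by (intro Cons.IH) auto
    then show ?thesis
      by (simp add: Cons tail) (simp add: word_cat_def distrib_right sum_distrib_right mult.assoc)
  qed
qed

lemma bilinear_word_cat:
  assumes f: "module_hom M (word_rep sg) f" and g: "module_hom N (word_rep sg') g"
  shows "bilinear_hom M N (word_rep (sg @ sg')) (\<lambda>v w. word_cat (length sg) (f v) (g w))"
proof -
  note fD = module_homD [OF f] and gD = module_homD [OF g]
  have "word_cat (length sg) (f v) (g w) \<in> rep_space (word_rep (sg @ sg'))"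
    if "v \<in> rep_space M" "w \<in> rep_space N" for v w
  proof -
    have "length (take (length sg) u) \<noteq> length sg \<or> length (drop (length sg) u) \<noteq> length sg'"
      if "length u \<noteq> length (sg @ sg')" for u :: "3 list"
      using that by auto
    then show ?thesis
      using fD(1) [OF that(1)] gD(1) [OF that(2)] unfolding in_word_rep word_cat_def by fastforce
  qed
  moreover have "wact (sg @ sg') x (word_cat (length sg) (f v) (g w))
      = word_cat (length sg) (f (rep_act M x v)) (g w) + word_cat (length sg) (f v) (g (rep_act N x w))"
    if "x \<in> sl3" "v \<in> rep_space M" "w \<in> rep_space N" for x v w
  proof
    fix u
    show "wact (sg @ sg') x (word_cat (length sg) (f v) (g w)) u
      = (word_cat (length sg) (f (rep_act M x v)) (g w) + word_cat (length sg) (f v) (g (rep_act N x w))) u"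
      using wact_word_cat [of sg "f v" sg' x "g w" u] fD(1) [OF that(2)] fD(4) [OF that(1,2)] gD(4) [OF that(1,3)]
      by (simp add: in_word_rep)
  qed
  moreover have "word_cat n (s + s') t = word_cat n s t + word_cat n s' t"
    "word_cat n t (s + s') = word_cat n t s + word_cat n t s'"
    "word_cat n (fun_scale c s) t = fun_scale c (word_cat n s t)"
    "word_cat n t (fun_scale c s) = fun_scale c (word_cat n t s)" for n s s' t c
    by (auto simp: word_cat_def algebra_simps)
  ultimately show ?thesis by (simp add: bilinear_hom_def fD(2,3) gD(2,3))
qed

text \<open>The tensor product of two injective maps is injective. With the second half
  \<open>w\<close> of a word fixed, the induced map is a value of \<open>f\<close>, so injectivity
  of \<open>f\<close> makes the image of each row under \<open>g\<close> vanish; then injectivity of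
  \<open>g\<close> makes the rows themselves vanish.\<close>

lemma (in tensor_product) tensor_embedding:
  assumes f: "module_hom M (word_rep sg) f" "inj_on f (rep_space M)"
    and g: "module_hom N (word_rep sg') g" "inj_on g (rep_space N)"
  shows "\<exists>F. module_hom T (word_rep (sg @ sg')) F \<and> inj_on F (rep_space T)"
proof -
  obtain I e where eb: "coordinate_basis (rep_space M) I e" using M.coordinate_basis_exists by blast
  obtain J d where db: "coordinate_basis (rep_space N) J d" using N.coordinate_basis_exists by blast
  define b where "b v w = word_cat (length sg) (f v) (g w)" for v w
  define F where "F = tensor_lift I e J d b"
  have F: "module_hom T (word_rep (sg @ sg')) F"
    unfolding F_def using bilinear_word_cat [OF f(1) g(1), folded b_def]
    by (intro tensor_lift_hom [OF eb db]) (auto intro: word.sl3_module_axioms)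
  note e = coordinate_basisD [OF eb] and d = coordinate_basisD [OF db]
  note fD = module_homD [OF f(1)] and gD = module_homD [OF g(1)]
  have f0: "f 0 = 0" and g0: "g 0 = 0"
    using module_hom_zero [OF M.sl3_module_axioms f(1)] module_hom_zero [OF N.sl3_module_axioms g(1)] by auto
  have ker: "t = 0" if t: "t \<in> rep_space T" and Ft: "F t = 0" for t
  proof -
    have row: "g (\<lambda>k. t (i, k)) w = (\<Sum>j\<in>J. t (i, j) * g (d j) w)" for i w
    proof -
      have "g (\<lambda>k. t (i, k)) = g (\<Sum>j\<in>J. fun_scale (t (i, j)) (d j))"
        using d(4) [OF slices(2) [OF t, of i]] by simp
      also have "\<dots> = (\<Sum>j\<in>J. g (fun_scale (t (i, j)) (d j)))"
        using d(2) by (intro module_hom_sum [OF N.sl3_module_axioms g(1)] N.scale_in)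
      finally show ?thesis using d(2) by (simp add: gD sum_fun_apply)
    qed
    have zero: "g (\<lambda>k. t (i, k)) w = 0" if i: "i \<in> I" for i w
    proof (cases "length w = length sg'")
      case True
      \<comment> \<open>The value at \<open>w\<close> of the image of the i-th row. The combination
        of the \<open>e i\<close> with these coefficients is sent by \<open>f\<close> to the tensor
        u |-> \<open>F t (u @ w)\<close>, which is zero.\<close>
      define a where "a i = g (\<lambda>k. t (i, k)) w" for i
      have "f (\<Sum>i\<in>I. fun_scale (a i) (e i)) = (\<Sum>i\<in>I. f (fun_scale (a i) (e i)))"
        using e(2) by (intro module_hom_sum [OF M.sl3_module_axioms f(1)] M.scale_in)
      also have "\<dots> = 0"
      proof
        fix u
        show "(\<Sum>i\<in>I. f (fun_scale (a i) (e i))) u = 0 u"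
        proof (cases "length u = length sg")
          case True
          have "(\<Sum>i\<in>I. f (fun_scale (a i) (e i))) u = (\<Sum>i\<in>I. a i * f (e i) u)"
            using e(2) by (simp add: sum_fun_apply fD)
          also have "\<dots> = F t (u @ w)"
            using True by (simp add: F_def tensor_lift_def b_def word_cat_def sum_fun_apply a_def row
                sum_distrib_right sum_distrib_left mult_ac)
          finally show ?thesis using Ft by simp
        next
          case False
          have "f (fun_scale (a i) (e i)) u = 0" if "i \<in> I" for i
            using fD(1) [OF M.scale_in [OF e(2) [OF that]]] False by (simp add: in_word_rep)
          then show ?thesis by (simp add: sum_fun_apply)
        qed
      qed
      finally have "f (\<Sum>i\<in>I. fun_scale (a i) (e i)) = f 0" by (simp add: f0)
      then have "(\<Sum>i\<in>I. fun_scale (a i) (e i)) = 0"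
        using e(2) by (intro inj_onD [OF f(2)]) (auto intro!: M.sum_in M.scale_in)
      from fun_cong [OF this, of i] have "(\<Sum>k\<in>I. a k * e k i) = 0" by (simp add: sum_fun_apply)
      moreover have "(\<Sum>k\<in>I. a k * e k i) = (\<Sum>k\<in>I. if k = i then a k else 0)"
        using e(3) i by (intro sum.cong) auto
      ultimately show ?thesis using e(1) i by (simp add: a_def)
    next
      case False
      then show ?thesis using gD(1) [OF slices(2) [OF t, of i]] by (simp add: in_word_rep)
    qed
    have tI: "t (i, j) = 0" if "i \<in> I" for i j
    proof -
      have "g (\<lambda>k. t (i, k)) = g 0" unfolding g0 using zero [OF that] by (intro ext) simp
      then have "(\<lambda>k. t (i, k)) = 0"
        by (intro inj_onD [OF g(2)] slices(2) [OF t]) auto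
      then show ?thesis by (metis zero_fun_apply)
    qed
    show ?thesis
    proof (rule ext, clarify)
      fix i j
      have "(\<lambda>k. t (k, j)) = (\<Sum>k\<in>I. fun_scale (t (k, j)) (e k))"
        using e(4) [OF slices(1) [OF t, of j]] by simp
      also have "\<dots> = 0" by (intro sum.neutral ballI) (simp add: tI)
      finally show "t (i, j) = 0 (i, j)" by (metis zero_fun_apply)
    qed
  qed
  have "inj_on F (rep_space T)"
  proof (rule inj_onI)
    fix s t assume st: "s \<in> rep_space T" "t \<in> rep_space T" "F s = F t"
    then have "F (s - t) = 0" by (simp add: module_hom_diff [OF T_module F])
    then have "s - t = 0" using st by (intro ker cfun.subspace_diff [OF subspace_T])
    then show "s = t" by simp
  qed
  with F show ?thesis by blast
qed

lemma bilinear_hom_transfer: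
  assumes M: "sl3_module M" and N: "sl3_module N" and b: "bilinear_hom M N V b" and f: "module_hom M' M f" and g: "module_hom N' N g" and k: "module_hom V V' k"
  shows "bilinear_hom M' N' V' (\<lambda>v w. k (b (f v) (g w)))"
proof -
  note D = bilinear_homD [OF b] module_homD [OF f] module_homD [OF g] module_homD [OF k]
  show ?thesis unfolding bilinear_hom_def
    by (intro conjI ballI allI)
      (simp_all add: D sl3_module.act_closed [OF M] sl3_module.act_closed [OF N] flip: module_homD(4) [OF k])
qed

text \<open>All choices are removed here: the chosen irreducible modules and the chosen
  decomposition give way to explicit submodules of tensor powers. Only the number of slots of each
  kind in a signature enters on the left, so their order is free.\<close>

lemma tensor_coeff_nonzero_iff:
  "tensor_coeff (count_list sg1 True, count_list sg1 False) (count_list sg2 True, count_list sg2 False)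
      (count_list sg3 True, count_list sg3 False) \<noteq> 0
    \<longleftrightarrow> (\<exists>b. bilinear_hom (high_rep sg1) (high_rep sg2) (high_rep sg3) b \<and>
          (\<exists>v\<in>high_space sg1. \<exists>w\<in>high_space sg2. b v w \<noteq> 0))"
proof -
  let ?w = "\<lambda>sg. (count_list sg True, count_list sg False)"
  let ?M = "irrep (?w sg1)" and ?N = "irrep (?w sg2)" and ?V = "irrep (?w sg3)"
  note mods = irreducible_module_sl3 [OF irrep_spec(1)]
  interpret tensor_product ?M ?N by (simp add: tensor_product_def mods)
  obtain f where f: "module_iso ?M (high_rep sg1) f"
    using irrep_isomorphic_high by (auto simp: isomorphic_modules_def)
  obtain g where g: "module_iso ?N (high_rep sg2) g"
    using irrep_isomorphic_high by (auto simp: isomorphic_modules_def)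
  obtain k where k: "module_iso ?V (high_rep sg3) k"
    using irrep_isomorphic_high by (auto simp: isomorphic_modules_def)
  have emb: "\<exists>F. module_hom (irrep (?w sg)) (word_rep sg) F \<and> inj_on F (rep_space (irrep (?w sg)))"
    if "module_iso (irrep (?w sg)) (high_rep sg) F" for sg F
  proof -
    have "module_hom (irrep (?w sg)) (word_rep sg) F"
      using module_iso_hom [OF that] high_space_subset by (auto simp: module_hom_def)
    then show ?thesis using that by (auto simp: module_iso_def bij_betw_def)
  qed
  have "\<exists>F. module_hom T (word_rep (sg1 @ sg2)) F \<and> inj_on F (rep_space T)"
    using emb [OF f] emb [OF g] tensor_embedding by blast
  then have dec: "\<exists>D. irreducible_decomposition T D"
    using embedded_decomposition [OF T_module] by blast
  have "tensor_coeff (?w sg1) (?w sg2) (?w sg3) \<noteq> 0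
    \<longleftrightarrow> (\<exists>b v w. bilinear_hom ?M ?N ?V b \<and> v \<in> rep_space ?M \<and> w \<in> rep_space ?N \<and> b v w \<noteq> 0)"
    unfolding tensor_coeff_def multiplicity_nonzero_iff [OF T_module dec irrep_spec(1)]
    by (rule hom_iff_bilinear [OF mods])
  also have "\<dots> \<longleftrightarrow> (\<exists>b. bilinear_hom (high_rep sg1) (high_rep sg2) (high_rep sg3) b \<and>
          (\<exists>v\<in>high_space sg1. \<exists>w\<in>high_space sg2. b v w \<noteq> 0))" (is "?L \<longleftrightarrow> ?R")
  proof
    have iso: "sl3_module A \<Longrightarrow> module_iso A B h \<Longrightarrow> v \<in> rep_space A \<Longrightarrow> v \<noteq> 0 \<Longrightarrow> h v \<noteq> 0"
      for A :: "'x rep" and B :: "'y rep" and h v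
    proof -
      assume A: "sl3_module A" and h: "module_iso A B h" and v: "v \<in> rep_space A" "v \<noteq> 0"
      have "h 0 = 0" by (rule module_hom_zero [OF A module_iso_hom [OF h]])
      moreover have "inj_on h (rep_space A)" using h by (simp add: module_iso_def bij_betw_def)
      ultimately show "h v \<noteq> 0" using v inj_onD [of h "rep_space A" v 0] sl3_module.zero_in [OF A] by auto
    qed
    {
      assume ?L
      then obtain b v w where b: "bilinear_hom ?M ?N ?V b"
        and vw: "v \<in> rep_space ?M" "w \<in> rep_space ?N" "b v w \<noteq> 0" by blast
      let ?f = "inv_into (rep_space ?M) f" and ?g = "inv_into (rep_space ?N) g"
      have fg: "?f (f v) = v" "?g (g w) = w"
        using f g vw by (auto simp: module_iso_def bij_betw_inv_into_left)
      have "bilinear_hom (high_rep sg1) (high_rep sg2) (high_rep sg3) (\<lambda>v w. k (b (?f v) (?g w)))"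
        by (rule bilinear_hom_transfer [OF mods mods b]) (intro module_iso_hom module_iso_inverse mods f g k)+
      moreover have "k (b (?f (f v)) (?g (g w))) \<noteq> 0"
        unfolding fg using bilinear_homD(1) [OF b vw(1,2)] vw(3) by (intro iso [OF mods k])
      moreover have "f v \<in> high_space sg1" "g w \<in> high_space sg2"
        using module_homD(1) [OF module_iso_hom [OF f] vw(1)] module_homD(1) [OF module_iso_hom [OF g] vw(2)]
        by auto
      ultimately show ?R by blast
    next
      assume ?R
      then obtain b v w where b: "bilinear_hom (high_rep sg1) (high_rep sg2) (high_rep sg3) b"
        and vw: "v \<in> rep_space (high_rep sg1)" "w \<in> rep_space (high_rep sg2)" "b v w \<noteq> 0" by auto
      let ?k = "inv_into (rep_space ?V) k"
      have k': "module_iso (high_rep sg3) ?V ?k" by (rule module_iso_inverse [OF mods k])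
      have "v \<in> f ` rep_space ?M" "w \<in> g ` rep_space ?N"
        using f g vw by (auto simp: module_iso_def bij_betw_def)
      then obtain v' w' where vw': "v' \<in> rep_space ?M" "v = f v'" "w' \<in> rep_space ?N" "w = g w'" by blast
      have "bilinear_hom ?M ?N ?V (\<lambda>v w. ?k (b (f v) (g w)))"
        by (rule bilinear_hom_transfer [OF high.sl3_module_axioms high.sl3_module_axioms b])
          (intro module_iso_hom f g k')+
      moreover have "?k (b (f v') (g w')) \<noteq> 0"
        unfolding vw'(2,4) [symmetric] using bilinear_homD(1) [OF b vw(1,2)] vw(3)
        by (intro iso [OF high.sl3_module_axioms k'])
      ultimately show ?L using vw' by blast
    }
  qed
  finally show ?thesis .
qed

section \<open>Invariant kernels\<close>

text \<open>Orthogonal projection is equivariant because both \<open>U\<close> and its complement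
  are submodules and the splitting is unique. It serves to push a map into a full tensor power down
  to its irreducible submodule.\<close>

lemma (in unitary_module) projection_hom:
  assumes U: "submodule U M"
  shows "\<exists>p. module_hom M (restrict_rep M U) p \<and> (\<forall>t\<in>rep_space M. t - p t \<in> ortho U)"
proof -
  define p where "p t = (SOME u. u \<in> U \<and> t - u \<in> ortho U)" for t
  have p: "p t \<in> U" "t - p t \<in> ortho U" if "t \<in> rep_space M" for t
    using someI_ex [of "\<lambda>u. u \<in> U \<and> t - u \<in> ortho U"] ortho_decompose [OF U that]
    unfolding p_def by blast+
  note oU = submodule_ortho [OF U]
  have p_eq: "p t = u" if "t \<in> rep_space M" "u \<in> U" "t - u \<in> ortho U" for t u
    using ortho_unique(1) [OF U p(1) [OF that(1)] that(2) p(2) [OF that(1)] that(3)] by simp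
  have "p (s + t) = p s + p t" if st: "s \<in> rep_space M" "t \<in> rep_space M" for s t
  proof (rule p_eq [OF add_in [OF st]])
    show "p s + p t \<in> U" using U p(1) st by (simp add: submodule_def cfun.subspace_add)
    have "(s + t) - (p s + p t) = (s - p s) + (t - p t)" by simp
    also have "\<dots> \<in> ortho U"
      using oU p(2) [OF st(1)] p(2) [OF st(2)] unfolding submodule_def by (blast intro: cfun.subspace_add)
    finally show "(s + t) - (p s + p t) \<in> ortho U" .
  qed
  moreover have "p (fun_scale c t) = fun_scale c (p t)" if t: "t \<in> rep_space M" for c t
  proof (rule p_eq [OF scale_in [OF t]])
    show "fun_scale c (p t) \<in> U" using U p(1) t by (simp add: submodule_def cfun.subspace_scale)
    have "fun_scale c t - fun_scale c (p t) = fun_scale c (t - p t)" by (simp add: cfun.scale_right_diff_distrib)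
    also have "\<dots> \<in> ortho U" using oU p(2) [OF t] unfolding submodule_def by (blast intro: cfun.subspace_scale)
    finally show "fun_scale c t - fun_scale c (p t) \<in> ortho U" .
  qed
  moreover have "p (rep_act M x t) = rep_act M x (p t)" if x: "x \<in> sl3" and t: "t \<in> rep_space M" for x t
  proof (rule p_eq [OF act_closed [OF x t]])
    have UM: "p t \<in> rep_space M" using U p(1) [OF t] by (auto simp: submodule_def)
    show "rep_act M x (p t) \<in> U" using U p(1) [OF t] x by (simp add: submodule_def)
    have "rep_act M x t - rep_act M x (p t) = rep_act M x (t - p t)" using x t UM by (simp add: act_diff)
    also have "\<dots> \<in> ortho U" using oU p(2) [OF t] x by (simp add: submodule_def)
    finally show "rep_act M x t - rep_act M x (p t) \<in> ortho U" .
  qed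
  ultimately have "module_hom M (restrict_rep M U) p"
    using p(1) by (auto simp: module_hom_def)
  with p(2) show ?thesis by blast
qed

text \<open>An invariant tensor whose slots are grouped in three blocks, one per module. The blocks
  are separate arguments, so that a further elementary invariant can be attached at the heads of any
  two or all three of them.\<close>

definition invariant_kernel ::
  "bool list \<Rightarrow> bool list \<Rightarrow> bool list \<Rightarrow> (3 list \<Rightarrow> 3 list \<Rightarrow> 3 list \<Rightarrow> complex) \<Rightarrow> bool" where
  "invariant_kernel d1 d2 d3 \<kappa> \<longleftrightarrow>
     (\<forall>u v w. \<kappa> u v w \<noteq> 0 \<longrightarrow> length u = length d1 \<and> length v = length d2 \<and> length w = length d3) \<and>
     (\<forall>x\<in>sl3. \<forall>u v w. wact d1 x (\<lambda>u. \<kappa> u v w) u + wact d2 x (\<lambda>v. \<kappa> u v w) v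
        + wact d3 x (\<lambda>w. \<kappa> u v w) w = 0)"

lemma invariant_kernel_swap:
  "invariant_kernel d1 d2 d3 \<kappa> \<Longrightarrow> invariant_kernel d2 d1 d3 (\<lambda>v u w. \<kappa> u v w)"
  "invariant_kernel d1 d2 d3 \<kappa> \<Longrightarrow> invariant_kernel d1 d3 d2 (\<lambda>u w v. \<kappa> u v w)"
  unfolding invariant_kernel_def by (auto simp: add_ac)

lemma invariant_kernel_Nil:
  "invariant_kernel [] [] [] (\<lambda>u v w. if u = [] \<and> v = [] \<and> w = [] then 1 else 0)"
  by (simp add: invariant_kernel_def)

fun pair_kernel :: "(3 list \<Rightarrow> 3 list \<Rightarrow> 3 list \<Rightarrow> complex) \<Rightarrow> 3 list \<Rightarrow> 3 list \<Rightarrow> 3 list \<Rightarrow> complex" where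
  "pair_kernel \<kappa> (i # u) (j # v) w = (if i = j then 1 else 0) * \<kappa> u v w"
| "pair_kernel \<kappa> [] v w = 0"
| "pair_kernel \<kappa> u [] w = 0"

lemma pair_kernel_Nil2 [simp]: "pair_kernel \<kappa> u [] w = 0"
  by (cases u) auto

lemma pair_kernel_zero: "pair_kernel \<kappa> [] v = (\<lambda>w. 0)" "pair_kernel \<kappa> u [] = (\<lambda>w. 0)"
  by auto

lemma sum_delta_3:
  fixes f :: "3 \<Rightarrow> complex"
  shows "(\<Sum>k\<in>UNIV. f k * ((if k = j then 1 else 0) * r)) = f j * r"
    and "(\<Sum>k\<in>UNIV. f k * ((if j = k then 1 else 0) * r)) = f j * r"
proof -
  have "f k * ((if k = j then 1 else 0) * r) = (if k = j then f k * r else 0)" for k by simp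
  then show "(\<Sum>k\<in>UNIV. f k * ((if k = j then 1 else 0) * r)) = f j * r" by simp
  then show "(\<Sum>k\<in>UNIV. f k * ((if j = k then 1 else 0) * r)) = f j * r" by (simp add: eq_commute)
qed

lemma slot_Not: "slot (\<not> s) x i j = - slot s x j i"
  by (simp add: slot_def)

lemma invariant_pair:
  assumes "invariant_kernel d1 d2 d3 \<kappa>"
  shows "invariant_kernel (s # d1) ((\<not> s) # d2) d3 (pair_kernel \<kappa>)"
  unfolding invariant_kernel_def
proof (intro conjI allI ballI impI)
  fix u v w assume nz: "pair_kernel \<kappa> u v w \<noteq> 0"
  then obtain i u' j v' where uv: "u = i # u'" "v = j # v'" by (cases u; cases v) auto
  then have "\<kappa> u' v' w \<noteq> 0" using nz by auto
  then show "length u = length (s # d1)" "length v = length ((\<not> s) # d2)" "length w = length d3"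
    using assms uv by (auto simp: invariant_kernel_def)
next
  fix x u v w assume x: "x \<in> sl3"
  show "wact (s # d1) x (\<lambda>u. pair_kernel \<kappa> u v w) u + wact ((\<not> s) # d2) x (\<lambda>v. pair_kernel \<kappa> u v w) v
        + wact d3 x (\<lambda>w. pair_kernel \<kappa> u v w) w = 0"
  proof (cases "u = [] \<or> v = []")
    case True
    then show ?thesis by (auto simp: pair_kernel_zero)
  next
    case False
    then obtain i u' j v' where uv: "u = i # u'" "v = j # v'" by (cases u; cases v) auto
    define r where "r = (if i = j then 1 else (0 :: complex))"
    have "wact d1 x (\<lambda>u. \<kappa> u v' w) u' + wact d2 x (\<lambda>v. \<kappa> u' v w) v' + wact d3 x (\<lambda>w. \<kappa> u' v' w) w = 0"
      using assms x by (simp add: invariant_kernel_def)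
    then have "r * wact d1 x (\<lambda>u. \<kappa> u v' w) u' + r * wact d2 x (\<lambda>v. \<kappa> u' v w) v' + r * wact d3 x (\<lambda>w. \<kappa> u' v' w) w = 0"
      by (simp flip: distrib_left)
    moreover have "wact (s # d1) x (\<lambda>u. pair_kernel \<kappa> u v w) u
      = slot s x i j * \<kappa> u' v' w + r * wact d1 x (\<lambda>u. \<kappa> u v' w) u'"
      by (simp only: uv wact.simps pair_kernel.simps sum_delta_3 wact_scale r_def)
    moreover have "wact ((\<not> s) # d2) x (\<lambda>v. pair_kernel \<kappa> u v w) v
      = - slot s x i j * \<kappa> u' v' w + r * wact d2 x (\<lambda>v. \<kappa> u' v w) v'"
      by (simp only: uv wact.simps pair_kernel.simps sum_delta_3 wact_scale r_def slot_Not)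
    moreover have "wact d3 x (\<lambda>w. pair_kernel \<kappa> u v w) w = r * wact d3 x (\<lambda>w. \<kappa> u' v' w) w"
      by (simp only: uv pair_kernel.simps wact_scale r_def)
    ultimately show ?thesis by simp
  qed
qed

definition eps :: "3 \<Rightarrow> 3 \<Rightarrow> 3 \<Rightarrow> complex" where
  "eps i j k = (if (i, j, k) \<in> {(1, 2, 3), (2, 3, 1), (3, 1, 2)} then 1
     else if (i, j, k) \<in> {(2, 1, 3), (1, 3, 2), (3, 2, 1)} then -1 else 0)"

text \<open>The infinitesimal invariance of the determinant: the derivation induced by A multiplies
  the Levi-Civita symbol by the trace of A.\<close>

lemma eps_invariant:
  fixes A :: "3 \<Rightarrow> 3 \<Rightarrow> complex"
  assumes "A 1 1 + A 2 2 + A 3 3 = 0"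
  shows "(\<Sum>m\<in>UNIV. A i m * eps m j k) + (\<Sum>m\<in>UNIV. A j m * eps i m k) + (\<Sum>m\<in>UNIV. A k m * eps i j m) = 0"
proof -
  have a: "A 3 3 = - A 1 1 - A 2 2" using assms by algebra
  show ?thesis
    using exhaust_3 [of i] exhaust_3 [of j] exhaust_3 [of k]
    by (elim disjE) (simp_all add: sum_3 eps_def a)
qed

fun triple_kernel :: "(3 list \<Rightarrow> 3 list \<Rightarrow> 3 list \<Rightarrow> complex) \<Rightarrow> 3 list \<Rightarrow> 3 list \<Rightarrow> 3 list \<Rightarrow> complex" where
  "triple_kernel \<kappa> (i # u) (j # v) (k # w) = eps i j k * \<kappa> u v w"
| "triple_kernel \<kappa> [] v w = 0"
| "triple_kernel \<kappa> u [] w = 0"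
| "triple_kernel \<kappa> u v [] = 0"

lemma triple_kernel_Nil [simp]: "triple_kernel \<kappa> u [] w = 0" "triple_kernel \<kappa> u v [] = 0"
  by (cases u; cases v; auto)+

lemma triple_kernel_zero: "triple_kernel \<kappa> [] v = (\<lambda>w. 0)" "triple_kernel \<kappa> u [] = (\<lambda>w. 0)"
  by auto

lemma sum_of_sums_zero: "p + q + r = 0 \<Longrightarrow> a + b + c = 0 \<Longrightarrow> (p + a) + (q + b) + (r + c) = (0 :: complex)"
  by algebra

lemma invariant_triple:
  assumes "invariant_kernel d1 d2 d3 \<kappa>"
  shows "invariant_kernel (s # d1) (s # d2) (s # d3) (triple_kernel \<kappa>)"
  unfolding invariant_kernel_def
proof (intro conjI allI ballI impI)
  fix u v w assume nz: "triple_kernel \<kappa> u v w \<noteq> 0"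
  then obtain i u' j v' k w' where uv: "u = i # u'" "v = j # v'" "w = k # w'" by (cases u; cases v; cases w) auto
  then have "\<kappa> u' v' w' \<noteq> 0" using nz by auto
  then show "length u = length (s # d1)" "length v = length (s # d2)" "length w = length (s # d3)"
    using assms uv by (auto simp: invariant_kernel_def)
next
  fix x u v w assume x: "x \<in> sl3"
  show "wact (s # d1) x (\<lambda>u. triple_kernel \<kappa> u v w) u + wact (s # d2) x (\<lambda>v. triple_kernel \<kappa> u v w) v
        + wact (s # d3) x (\<lambda>w. triple_kernel \<kappa> u v w) w = 0"
  proof (cases "u = [] \<or> v = [] \<or> w = []")
    case True
    then show ?thesis by (auto simp: triple_kernel_zero)
  next
    case False
    then obtain i u' j v' k w' where uv: "u = i # u'" "v = j # v'" "w = k # w'"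
      by (cases u; cases v; cases w) auto
    define r where "r = eps i j k"
    define c where "c = \<kappa> u' v' w'"
    have "wact d1 x (\<lambda>u. \<kappa> u v' w') u' + wact d2 x (\<lambda>v. \<kappa> u' v w') v' + wact d3 x (\<lambda>w. \<kappa> u' v' w) w' = 0"
      using assms x by (simp add: invariant_kernel_def)
    then have e0: "r * wact d1 x (\<lambda>u. \<kappa> u v' w') u' + r * wact d2 x (\<lambda>v. \<kappa> u' v w') v' + r * wact d3 x (\<lambda>w. \<kappa> u' v' w) w' = 0"
      by (simp flip: distrib_left)
    have e1: "wact (s # d1) x (\<lambda>u. triple_kernel \<kappa> u v w) u
      = (\<Sum>m\<in>UNIV. slot s x i m * eps m j k) * c + r * wact d1 x (\<lambda>u. \<kappa> u v' w') u'"
      by (simp only: uv wact.simps triple_kernel.simps wact_scale r_def c_def sum_distrib_right mult.assoc)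
    have e2: "wact (s # d2) x (\<lambda>v. triple_kernel \<kappa> u v w) v
      = (\<Sum>m\<in>UNIV. slot s x j m * eps i m k) * c + r * wact d2 x (\<lambda>v. \<kappa> u' v w') v'"
      by (simp only: uv wact.simps triple_kernel.simps wact_scale r_def c_def sum_distrib_right mult.assoc)
    have e3: "wact (s # d3) x (\<lambda>w. triple_kernel \<kappa> u v w) w
      = (\<Sum>m\<in>UNIV. slot s x k m * eps i j m) * c + r * wact d3 x (\<lambda>w. \<kappa> u' v' w) w'"
      by (simp only: uv wact.simps triple_kernel.simps wact_scale r_def c_def sum_distrib_right mult.assoc)
    have e4: "(\<Sum>m\<in>UNIV. slot s x i m * eps m j k) * c + (\<Sum>m\<in>UNIV. slot s x j m * eps i m k) * c
        + (\<Sum>m\<in>UNIV. slot s x k m * eps i j m) * c = 0"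
    proof -
      have "x $ 1 $ 1 + x $ 2 $ 2 + x $ 3 $ 3 = 0" using x by (simp add: sl3_def trace_def sum_3)
      moreover have "slot s x 1 1 + slot s x 2 2 + slot s x 3 3
        = (if s then 1 else -1) * (x $ 1 $ 1 + x $ 2 $ 2 + x $ 3 $ 3)"
        by (simp add: slot_def)
      ultimately have "slot s x 1 1 + slot s x 2 2 + slot s x 3 3 = 0" by (simp only: mult_zero_right)
      from eps_invariant [of "slot s x", OF this, of i j k] show ?thesis by (simp only: distrib_right [symmetric] mult_zero_left)
    qed
    show ?thesis unfolding e1 e2 e3 by (rule sum_of_sums_zero [OF e4 e0])
  qed
qed

text \<open>The coefficient at the highest word of \<open>\<kappa>\<close> applied to the highest weight vector of \<open>sg1\<close> and
  to a vector of \<open>high_space sg2\<close> in general position.\<close>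

definition kernel_value :: "bool list \<Rightarrow> bool list \<Rightarrow> bool list \<Rightarrow> (3 list \<Rightarrow> 3 list \<Rightarrow> 3 list \<Rightarrow> complex) \<Rightarrow> complex" where
  "kernel_value sg1 sg2 sg3 \<kappa>
    = (\<Sum>v\<in>words (length sg2). \<kappa> (high_word sg1) v (high_word sg3) * pure sg2 generic_point v)"

text \<open>The first two signatures are negated because those blocks are paired with tensors of the
  modules. Requiring one particular value to be nonzero, rather than the kernel itself, is a
  condition that survives the attachment of further invariants, since on decomposable tensors the
  value is multiplied by a nonzero number.\<close>

definition linked :: "bool list \<Rightarrow> bool list \<Rightarrow> bool list \<Rightarrow> bool" where
  "linked sg1 sg2 sg3 \<longleftrightarrow> (\<exists>\<kappa>. invariant_kernel (map Not sg1) (map Not sg2) sg3 \<kappa> \<and> kernel_value sg1 sg2 sg3 \<kappa> \<noteq> 0)"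

lemma linked_Nil: "linked [] [] []"
  unfolding linked_def
  by (rule exI [of _ "\<lambda>u v w. if u = [] \<and> v = [] \<and> w = [] then 1 else 0"])
    (simp add: invariant_kernel_Nil kernel_value_def high_word_def)

lemma high_word_Cons: "high_word (s # sg) = (if s then 1 else 3) # high_word sg"
  by (simp add: high_word_def)

lemma generic_point_nonzero: "generic_point s i \<noteq> 0"
  by (simp add: generic_point_def)

lemma linked_12:
  assumes "linked sg1 sg2 sg3"
  shows "linked (s # sg1) ((\<not> s) # sg2) sg3"
proof -
  obtain \<kappa> where k: "invariant_kernel (map Not sg1) (map Not sg2) sg3 \<kappa>" "kernel_value sg1 sg2 sg3 \<kappa> \<noteq> 0"
    using assms by (auto simp: linked_def)
  have inv: "invariant_kernel (map Not (s # sg1)) (map Not ((\<not> s) # sg2)) sg3 (pair_kernel \<kappa>)"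
    using invariant_pair [OF k(1), of "\<not> s"] by simp
  let ?h = "if s then 1 else 3 :: 3"
  have "kernel_value (s # sg1) ((\<not> s) # sg2) sg3 (pair_kernel \<kappa>)
    = (\<Sum>j\<in>UNIV. generic_point (\<not> s) j * ((if ?h = j then 1 else 0) * kernel_value sg1 sg2 sg3 \<kappa>))"
    unfolding kernel_value_def
    by (simp only: sum_words_Suc high_word_Cons list.size pair_kernel.simps pure.simps sum_distrib_left
        add_0_right add_Suc_right mult_ac)
  also have "\<dots> = generic_point (\<not> s) ?h * kernel_value sg1 sg2 sg3 \<kappa>" by (rule sum_delta_3)
  finally show ?thesis using inv k(2) generic_point_nonzero unfolding linked_def by (metis mult_eq_0_iff)
qed

lemma linked_13:
  assumes "linked sg1 sg2 sg3"
  shows "linked (s # sg1) sg2 (s # sg3)"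
proof -
  obtain \<kappa> where k: "invariant_kernel (map Not sg1) (map Not sg2) sg3 \<kappa>" "kernel_value sg1 sg2 sg3 \<kappa> \<noteq> 0"
    using assms by (auto simp: linked_def)
  let ?k = "\<lambda>u v w. pair_kernel (\<lambda>u w v. \<kappa> u v w) u w v"
  have inv: "invariant_kernel (map Not (s # sg1)) (map Not sg2) (s # sg3) ?k"
    using invariant_kernel_swap(2) [OF invariant_pair [OF invariant_kernel_swap(2) [OF k(1)], of "\<not> s"]] by simp
  have "kernel_value (s # sg1) sg2 (s # sg3) ?k = kernel_value sg1 sg2 sg3 \<kappa>"
    by (simp add: kernel_value_def high_word_Cons)
  then show ?thesis using inv k(2) unfolding linked_def by metis
qed

lemma linked_23:
  assumes "linked sg1 sg2 sg3"
  shows "linked sg1 (s # sg2) (s # sg3)"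
proof -
  obtain \<kappa> where k: "invariant_kernel (map Not sg1) (map Not sg2) sg3 \<kappa>" "kernel_value sg1 sg2 sg3 \<kappa> \<noteq> 0"
    using assms by (auto simp: linked_def)
  let ?k = "\<lambda>u v w. pair_kernel (\<lambda>v w u. \<kappa> u v w) v w u"
  have inv: "invariant_kernel (map Not sg1) (map Not (s # sg2)) (s # sg3) ?k"
    using invariant_kernel_swap(1) [OF invariant_kernel_swap(2) [OF
      invariant_pair [OF invariant_kernel_swap(2) [OF invariant_kernel_swap(1) [OF k(1)]], of "\<not> s"]]] by simp
  let ?h = "if s then 1 else 3 :: 3"
  have "kernel_value sg1 (s # sg2) (s # sg3) ?k
    = (\<Sum>j\<in>UNIV. generic_point s j * ((if j = ?h then 1 else 0) * kernel_value sg1 sg2 sg3 \<kappa>))"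
    unfolding kernel_value_def
    by (simp only: sum_words_Suc high_word_Cons list.size pair_kernel.simps pure.simps sum_distrib_left
        add_0_right add_Suc_right mult_ac)
  also have "\<dots> = generic_point s ?h * kernel_value sg1 sg2 sg3 \<kappa>" by (rule sum_delta_3)
  finally show ?thesis using inv k(2) generic_point_nonzero unfolding linked_def by (metis mult_eq_0_iff)
qed

lemma linked_123:
  assumes "linked sg1 sg2 sg3"
  shows "linked ((\<not> s) # sg1) ((\<not> s) # sg2) (s # sg3)"
proof -
  obtain \<kappa> where k: "invariant_kernel (map Not sg1) (map Not sg2) sg3 \<kappa>" "kernel_value sg1 sg2 sg3 \<kappa> \<noteq> 0"
    using assms by (auto simp: linked_def)
  have inv: "invariant_kernel (map Not ((\<not> s) # sg1)) (map Not ((\<not> s) # sg2)) (s # sg3) (triple_kernel \<kappa>)"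
    using invariant_triple [OF k(1), of s] by simp
  let ?h = "\<lambda>s. if s then 1 else 3 :: 3"
  have "kernel_value ((\<not> s) # sg1) ((\<not> s) # sg2) (s # sg3) (triple_kernel \<kappa>)
    = (\<Sum>j\<in>UNIV. generic_point (\<not> s) j * eps (?h (\<not> s)) j (?h s)) * kernel_value sg1 sg2 sg3 \<kappa>"
    unfolding kernel_value_def
    by (simp only: sum_words_Suc high_word_Cons list.size triple_kernel.simps pure.simps sum_distrib_left
        sum_distrib_right add_0_right add_Suc_right mult_ac)
  \<comment> \<open>The highest indices of the first and the third block are 1 and 3 in some order,
    so only j = 2 contributes, with a nonzero middle coordinate of the generic point.\<close>
  moreover have "(\<Sum>j\<in>UNIV. generic_point (\<not> s) j * eps (?h (\<not> s)) j (?h s)) \<noteq> 0"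
    by (cases s) (simp_all add: sum_3 eps_def generic_point_def)
  ultimately show ?thesis using inv k(2) unfolding linked_def by (metis mult_eq_0_iff)
qed

lemma high_word_in_words: "high_word sg \<in> words (length sg)"
  by (simp add: words_def)

section \<open>From invariant kernels to equivariant bilinear maps\<close>

definition kernel_map ::
  "nat \<Rightarrow> nat \<Rightarrow> (3 list \<Rightarrow> 3 list \<Rightarrow> 3 list \<Rightarrow> complex) \<Rightarrow> (3 list \<Rightarrow> complex) \<Rightarrow> (3 list \<Rightarrow> complex) \<Rightarrow> 3 list \<Rightarrow> complex" where
  "kernel_map m n \<kappa> s t w = (\<Sum>u\<in>words m. \<Sum>v\<in>words n. s u * t v * \<kappa> u v w)"

text \<open>By \<open>wact_dual\<close>, moving the action from a tensor to the kernel negates the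
  slots and the sign, which turns invariance of the kernel into the Leibniz rule for the
  map.\<close>

lemma bilinear_kernel_map:
  assumes k: "invariant_kernel (map Not sg1) (map Not sg2) sg3 \<kappa>"
  shows "bilinear_hom (word_rep sg1) (word_rep sg2) (word_rep sg3) (kernel_map (length sg1) (length sg2) \<kappa>)"
  unfolding bilinear_hom_def
proof (intro conjI ballI allI)
  let ?b = "kernel_map (length sg1) (length sg2) \<kappa>"
  fix s t
  show "?b s t \<in> rep_space (word_rep sg3)"
    using k by (auto simp: in_word_rep kernel_map_def invariant_kernel_def intro!: sum.neutral)
  show "?b (s + s') t = ?b s t + ?b s' t" for s'
    by (rule ext) (simp add: kernel_map_def distrib_right sum.distrib)
  show "?b s (t + t') = ?b s t + ?b s t'" for t'
    by (rule ext) (simp add: kernel_map_def distrib_right distrib_left sum.distrib)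
  show "?b (fun_scale c s) t = fun_scale c (?b s t)" for c
    by (rule ext) (simp add: kernel_map_def sum_distrib_left mult_ac)
  show "?b s (fun_scale c t) = fun_scale c (?b s t)" for c
    by (rule ext) (simp add: kernel_map_def sum_distrib_left mult_ac)
  show "rep_act (word_rep sg3) x (?b s t) = ?b (rep_act (word_rep sg1) x s) t + ?b s (rep_act (word_rep sg2) x t)"
    if x: "x \<in> sl3" for x
  proof
    fix w
    let ?U = "words (length sg1)" and ?V = "words (length sg2)"
    have "wact sg3 x (?b s t) w = (\<Sum>u\<in>?U. \<Sum>v\<in>?V. s u * t v * wact sg3 x (\<kappa> u v) w)"
    proof -
      have "wact sg3 x (?b s t) w = wact sg3 x (\<lambda>w. \<Sum>u\<in>?U. 1 * (\<Sum>v\<in>?V. s u * t v * \<kappa> u v w)) w"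
        by (simp add: kernel_map_def [abs_def])
      also have "\<dots> = (\<Sum>u\<in>?U. 1 * wact sg3 x (\<lambda>w. \<Sum>v\<in>?V. s u * t v * \<kappa> u v w) w)" by (rule wact_sum)
      finally show ?thesis by (simp add: wact_sum)
    qed
    also have "\<dots> = (\<Sum>u\<in>?U. \<Sum>v\<in>?V. - (s u * t v * wact (map Not sg1) x (\<lambda>u. \<kappa> u v w) u)
        - s u * t v * wact (map Not sg2) x (\<lambda>v. \<kappa> u v w) v)"
    proof (intro sum.cong refl)
      fix u v
      have "wact (map Not sg1) x (\<lambda>u. \<kappa> u v w) u + wact (map Not sg2) x (\<lambda>v. \<kappa> u v w) v + wact sg3 x (\<kappa> u v) w = 0"
        using k x by (simp add: invariant_kernel_def)
      then have "wact sg3 x (\<kappa> u v) w = - wact (map Not sg1) x (\<lambda>u. \<kappa> u v w) u - wact (map Not sg2) x (\<lambda>v. \<kappa> u v w) v"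
        by algebra
      then show "s u * t v * wact sg3 x (\<kappa> u v) w = - (s u * t v * wact (map Not sg1) x (\<lambda>u. \<kappa> u v w) u)
        - s u * t v * wact (map Not sg2) x (\<lambda>v. \<kappa> u v w) v"
        by (simp only:) (simp add: algebra_simps)
    qed
    also have "\<dots> = - (\<Sum>u\<in>?U. \<Sum>v\<in>?V. s u * t v * wact (map Not sg1) x (\<lambda>u. \<kappa> u v w) u)
        - (\<Sum>u\<in>?U. \<Sum>v\<in>?V. s u * t v * wact (map Not sg2) x (\<lambda>v. \<kappa> u v w) v)"
      by (simp add: sum_subtractf sum_negf)
    also have "(\<Sum>u\<in>?U. \<Sum>v\<in>?V. s u * t v * wact (map Not sg1) x (\<lambda>u. \<kappa> u v w) u)
      = (\<Sum>v\<in>?V. t v * (\<Sum>u\<in>?U. s u * wact (map Not sg1) x (\<lambda>u. \<kappa> u v w) u))"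
      by (subst sum.swap) (simp add: sum_distrib_left mult_ac)
    also have "\<dots> = (\<Sum>v\<in>?V. t v * - (\<Sum>u\<in>?U. wact sg1 x s u * \<kappa> u v w))"
      by (simp add: wact_dual)
    also have "\<dots> = - (\<Sum>v\<in>?V. \<Sum>u\<in>?U. wact sg1 x s u * t v * \<kappa> u v w)"
      by (simp add: sum_distrib_left sum_negf mult_ac)
    also have "(\<Sum>v\<in>?V. \<Sum>u\<in>?U. wact sg1 x s u * t v * \<kappa> u v w) = ?b (wact sg1 x s) t w"
      unfolding kernel_map_def by (rule sum.swap)
    also have "(\<Sum>u\<in>?U. \<Sum>v\<in>?V. s u * t v * wact (map Not sg2) x (\<lambda>v. \<kappa> u v w) v)
      = (\<Sum>u\<in>?U. s u * (\<Sum>v\<in>?V. t v * wact (map Not sg2) x (\<lambda>v. \<kappa> u v w) v))"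
      by (simp add: sum_distrib_left mult_ac)
    also have "\<dots> = (\<Sum>u\<in>?U. s u * - (\<Sum>v\<in>?V. wact sg2 x t v * \<kappa> u v w))"
      by (simp add: wact_dual)
    also have "\<dots> = - ?b s (wact sg2 x t) w"
      by (simp add: kernel_map_def sum_distrib_left sum_negf mult_ac)
    finally show "rep_act (word_rep sg3) x (?b s t) w
      = (?b (rep_act (word_rep sg1) x s) t + ?b s (rep_act (word_rep sg2) x t)) w" by simp
  qed
qed

lemma module_hom_inclusion: "module_hom (high_rep sg) (word_rep sg) (\<lambda>v. v)"
  using high_space_subset by (auto simp: module_hom_def)

text \<open>The kernel maps into the whole tensor power, so its value is projected onto the
  irreducible submodule. The projection is nonzero, because the coordinate at the highest word is
  the inner product with an element of that submodule.\<close>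

lemma linked_tensor_coeff:
  assumes "linked sg1 sg2 sg3"
  shows "tensor_coeff (count_list sg1 True, count_list sg1 False) (count_list sg2 True, count_list sg2 False)
      (count_list sg3 True, count_list sg3 False) \<noteq> 0"
proof -
  obtain \<kappa> where k: "invariant_kernel (map Not sg1) (map Not sg2) sg3 \<kappa>" "kernel_value sg1 sg2 sg3 \<kappa> \<noteq> 0"
    using assms by (auto simp: linked_def)
  let ?b = "kernel_map (length sg1) (length sg2) \<kappa>"
  let ?v = "delta (high_word sg1)" and ?w = "pure sg2 generic_point"
  obtain p where p: "module_hom (word_rep sg3) (high_rep sg3) p"
    and po: "\<And>t. t \<in> rep_space (word_rep sg3) \<Longrightarrow> t - p t \<in> word.ortho sg3 (high_space sg3)"
    using word.projection_hom [OF submodule_high_space, of sg3] by (auto simp: high_rep_def)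
  have hom: "bilinear_hom (high_rep sg1) (high_rep sg2) (high_rep sg3) (\<lambda>v w. p (?b v w))"
    by (rule bilinear_hom_transfer [OF word.sl3_module_axioms word.sl3_module_axioms bilinear_kernel_map [OF k(1)]
        module_hom_inclusion module_hom_inclusion p])
  have bin: "?b ?v ?w \<in> rep_space (word_rep sg3)"
    using bilinear_homD(1) [OF bilinear_kernel_map [OF k(1)]] high_space_subset generic_in high_word_in by blast
  have "?b ?v ?w (high_word sg3) = (\<Sum>u\<in>words (length sg1). if u = high_word sg1 then
      (\<Sum>v\<in>words (length sg2). ?w v * \<kappa> u v (high_word sg3)) else 0)"
    unfolding kernel_map_def by (intro sum.cong refl) (simp add: delta_def)
  also have "\<dots> = kernel_value sg1 sg2 sg3 \<kappa>"
    by (simp add: kernel_value_def high_word_in_words mult.commute)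
  finally have nz: "?b ?v ?w (high_word sg3) \<noteq> 0" using k(2) by simp
  have "p (?b ?v ?w) \<noteq> 0"
  proof
    assume "p (?b ?v ?w) = 0"
    then have "?b ?v ?w \<in> word.ortho sg3 (high_space sg3)" using po [OF bin] by simp
    then have "winner (length sg3) (?b ?v ?w) (delta (high_word sg3)) = 0"
      by (simp add: word.ortho_def)
    moreover have "winner (length sg3) t (delta (high_word sg3)) = t (high_word sg3)" for t
    proof -
      have "winner (length sg3) t (delta (high_word sg3))
        = (\<Sum>w\<in>words (length sg3). if w = high_word sg3 then t w else 0)"
        unfolding winner_def by (intro sum.cong refl) (simp add: delta_def)
      then show ?thesis by (simp add: high_word_in_words)
    qed
    ultimately show False using nz by simp
  qed
  then show ?thesis
    unfolding tensor_coeff_nonzero_iff using hom high_word_in generic_in by blast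
qed

section \<open>Weights and the Horn inequalities\<close>

text \<open>\<open>k\<close> and \<open>l\<close> count how often \<alpha>1 and \<alpha>2 are
  subtracted. A vector slot descends from 1 to 2 by \<alpha>1 and on to 3 by \<alpha>2, a covector
  slot from 3 to 2 by \<alpha>2 and on to 1 by \<alpha>1; so each root is used at most once per
  slot, and an excess of one over the other comes only from slots of one kind.\<close>

lemma weight_bounds:
  assumes h: "h \<in> cartan" and "length u = length sg"
  shows "\<exists>k l. k \<le> length sg \<and> l \<le> length sg \<and> k \<le> l + count_list sg True \<and> l \<le> k + count_list sg False
    \<and> (\<forall>h\<in>cartan. wweight sg h u = wweight sg h (high_word sg)
        - of_nat k * (h $ 1 $ 1 - h $ 2 $ 2) - of_nat l * (h $ 2 $ 2 - h $ 3 $ 3))"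
  using assms(2)
proof (induction sg arbitrary: u)
  case (Cons s sg)
  then obtain i v where u: "u = i # v" "length v = length sg" by (cases u) auto
  obtain k l where IH: "k \<le> length sg" "l \<le> length sg" "k \<le> l + count_list sg True" "l \<le> k + count_list sg False"
    "\<And>h. h \<in> cartan \<Longrightarrow> wweight sg h v = wweight sg h (high_word sg)
        - of_nat k * (h $ 1 $ 1 - h $ 2 $ 2) - of_nat l * (h $ 2 $ 2 - h $ 3 $ 3)"
    using Cons.IH [OF u(2)] by blast
  consider "i = (if s then 1 else 3)" | "s" "i = 2" | "\<not> s" "i = 2" | "i = (if s then 3 else 1)"
    using exhaust_3 [of i] by (cases s) auto
  then show ?case
  proof cases
    case 1
    then show ?thesis using IH
      by - (rule exI [of _ k], rule exI [of _ l], auto simp: u high_word_def)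
  next
    case 2
    then show ?thesis using IH
      by - (rule exI [of _ "Suc k"], rule exI [of _ l], auto simp: u high_word_def slot_def algebra_simps)
  next
    case 3
    then show ?thesis using IH
      by - (rule exI [of _ k], rule exI [of _ "Suc l"], auto simp: u high_word_def slot_def algebra_simps)
  next
    case 4
    then show ?thesis using IH
      by - (rule exI [of _ "Suc k"], rule exI [of _ "Suc l"], auto simp: u high_word_def slot_def algebra_simps)
  qed
qed simp

text \<open>A functional that is an eigenvector of the transpose of \<open>h\<close> has an eigenvalue of \<open>h\<close>:
  otherwise the product of all \<open>h - \<theta>\<close>, over the weights \<open>\<theta>\<close>, would not annihilate it.\<close>

lemma eigen_functional:
  assumes h: "h \<in> cartan" and c: "\<And>w. w \<in> high_space sg \<Longrightarrow> m (wact sg h w) = c * m w"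
    and add: "\<And>v w. v \<in> high_space sg \<Longrightarrow> w \<in> high_space sg \<Longrightarrow> m (v + w) = m v + m w"
    and scale: "\<And>r w. w \<in> high_space sg \<Longrightarrow> m (fun_scale r w) = r * m w"
    and nz: "w0 \<in> high_space sg" "m w0 \<noteq> (0 :: complex)"
  shows "\<exists>u. length u = length sg \<and> c = wweight sg h u"
proof (rule ccontr)
  assume "\<not> ?thesis"
  then have ne: "c \<noteq> wweight sg h u" if "u \<in> words (length sg)" for u using that by (auto simp: words_def)
  \<comment> \<open>The set \<open>S\<close> collects the words whose weights have been treated:
    subtracting the weight of \<open>u\<close> from \<open>h\<close> kills the coordinate at
    \<open>u\<close> and multiplies the value of \<open>m\<close> by a nonzero number. For all words
    together the vector becomes zero.\<close>
  have "\<exists>w\<in>high_space sg. m w \<noteq> 0 \<and> (\<forall>u\<in>S. w u = 0)" if "S \<subseteq> words (length sg)" for S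
  proof -
    have "finite S" using that finite_words by (rule finite_subset)
    then show ?thesis using that
    proof induction
      case empty
      then show ?case using nz by auto
    next
      case (insert u S)
      then obtain w where w: "w \<in> high_space sg" "m w \<noteq> 0" "\<forall>u\<in>S. w u = 0" by auto
      have u: "u \<in> words (length sg)" using insert.prems by auto
      define w' where "w' = wact sg h w + fun_scale (- wweight sg h u) w"
      have hw: "wact sg h w \<in> high_space sg" using high.act_closed [of h w sg] w(1) h by (simp add: cartan_sl3)
      have sw: "fun_scale r w \<in> high_space sg" for r using high.scale_in [of w sg r] w(1) by simp
      have w': "w' \<in> high_space sg" 
        using high.add_in [of "wact sg h w" sg "fun_scale (- wweight sg h u) w"] hw sw
        unfolding w'_def rep_space_high by blast
      have "m w' = c * m w - wweight sg h u * m w"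
        unfolding w'_def add [OF hw sw] scale [OF w(1)] c [OF w(1)] by simp
      also have "\<dots> = (c - wweight sg h u) * m w" by (simp add: left_diff_distrib)
      also have "\<dots> \<noteq> 0" using ne [OF u] w(2) by simp
      finally have "m w' \<noteq> 0" .
      moreover have "w' z = (wweight sg h z - wweight sg h u) * w z" if "z \<in> words (length sg)" for z
        using wact_diagonal [OF cartan_offdiag [OF h], of z sg w] that
        by (simp add: w'_def words_def left_diff_distrib)
      then have "\<forall>z\<in>insert u S. w' z = 0" using insert.prems w(3) by auto
      ultimately show ?case using w' by blast
    qed
  qed
  from this [of "words (length sg)"] obtain w where w: "w \<in> high_space sg" "m w \<noteq> 0" "\<forall>u\<in>words (length sg). w u = 0"
    by auto
  then have "w = fun_scale 0 w" using high_space_subset [OF w(1)] by (auto simp: fun_eq_iff in_word_rep words_def)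
  then have "m w = 0" using scale [OF w(1), of 0] by simp
  then show False using w(2) by simp
qed

lemma eigen_vector:
  assumes h: "\<And>h. h \<in> cartan \<Longrightarrow> wact sg h t = fun_scale (c h) t"
    and t: "t \<in> rep_space (word_rep sg)" "t \<noteq> 0"
  shows "\<exists>u. length u = length sg \<and> (\<forall>h\<in>cartan. c h = wweight sg h u)"
proof -
  obtain u where u: "t u \<noteq> 0" using t(2) by (auto simp: fun_eq_iff)
  then have len: "length u = length sg" using t(1) by (auto simp: in_word_rep)
  have "c k = wweight sg k u" if "k \<in> cartan" for k
    using fun_cong [OF h [OF that], of u] wact_diagonal [OF cartan_offdiag [OF that] len, of t] u by simp
  then show ?thesis using len by blast
qed

section \<open>Weights forced by a nonzero equivariant bilinear map\<close>

locale nonzero_bilinear =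
  fixes sg1 sg2 sg3 :: "bool list" and b
  assumes b: "bilinear_hom (high_rep sg1) (high_rep sg2) (high_rep sg3) b"
    and nz: "\<exists>v\<in>high_space sg1. \<exists>w\<in>high_space sg2. b v w \<noteq> 0"
begin

text \<open>The composite of \<open>b\<close> with a functional on the target that kills the images
  of the lowering operators and is an eigenvector of the Cartan subalgebra; it makes the map scalar
  valued.\<close>

definition \<beta> :: "(3 list \<Rightarrow> complex) \<Rightarrow> (3 list \<Rightarrow> complex) \<Rightarrow> complex" where
  "\<beta> v w = b v w (high_word sg3)"

lemma b_rules:
  assumes "v \<in> high_space sg1" "w \<in> high_space sg2"
  shows "b v w \<in> high_space sg3"
    and "v' \<in> high_space sg1 \<Longrightarrow> b (v + v') w = b v w + b v' w"
    and "w' \<in> high_space sg2 \<Longrightarrow> b v (w + w') = b v w + b v w'"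
    and "b (fun_scale c v) w = fun_scale c (b v w)"
    and "b v (fun_scale c w) = fun_scale c (b v w)"
    and "x \<in> sl3 \<Longrightarrow> wact sg3 x (b v w) = b (wact sg1 x v) w + b v (wact sg2 x w)"
  using bilinear_homD [OF b, of v w] assms by simp_all

lemma b_zero: "v \<in> high_space sg1 \<Longrightarrow> b v 0 = 0" "w \<in> high_space sg2 \<Longrightarrow> b 0 w = 0"
  using bilinear_hom_zero [OF b, of v 0] bilinear_hom_zero [OF b, of 0 w]
    high.zero_in [of sg1] high.zero_in [of sg2] by (simp_all del: high.zero_in)

lemma high_act: "x \<in> sl3 \<Longrightarrow> t \<in> high_space sg \<Longrightarrow> wact sg x t \<in> high_space sg"
  using high.act_closed [of x t sg] by simp

lemma high_add: "s \<in> high_space sg \<Longrightarrow> t \<in> high_space sg \<Longrightarrow> s + t \<in> high_space sg"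
  using high.add_in [of s sg t] by simp

lemma high_scale: "t \<in> high_space sg \<Longrightarrow> fun_scale c t \<in> high_space sg"
  using high.scale_in [of t sg c] by simp

lemma high_zero: "0 \<in> high_space sg"
  using high.zero_in [of sg] by simp

text \<open>The vectors orthogonal to all values of \<open>b\<close> form a submodule. If \<beta>
  vanished, it would contain the highest word and thus all of \<open>high_space sg3\<close>, and
  every value of \<open>b\<close> would be orthogonal to itself.\<close>

lemma \<beta>_nonzero: "\<exists>v\<in>high_space sg1. \<exists>w\<in>high_space sg2. \<beta> v w \<noteq> 0"
proof (rule ccontr)
  assume *: "\<not> ?thesis"
  let ?q = "winner (length sg3)"
  let ?U = "{z \<in> rep_space (word_rep sg3). \<forall>v\<in>high_space sg1. \<forall>w\<in>high_space sg2. ?q (b v w) z = 0}"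
  have bM: "b v w \<in> rep_space (word_rep sg3)" if "v \<in> high_space sg1" "w \<in> high_space sg2" for v w
    using b_rules(1) [OF that] by (rule high_space_subset)
  have "wact sg3 x z \<in> ?U" if x: "x \<in> sl3" and z: "z \<in> ?U" for x z
  proof -
    have zM: "z \<in> rep_space (word_rep sg3)" using z by simp
    have "?q (b v w) (wact sg3 x z) = 0" if vw: "v \<in> high_space sg1" "w \<in> high_space sg2" for v w
    proof -
      let ?y = "adjoint_matrix x"
      have "?q (b v w) (wact sg3 x z) = ?q (wact sg3 ?y (b v w)) z"
        by (simp add: winner_adjoint)
      also have "\<dots> = ?q (b (wact sg1 ?y v) w) z + ?q (b v (wact sg2 ?y w)) z"
        using x vw zM by (simp add: b_rules word.q_add bM high_act)
      also have "\<dots> = 0" using z x vw by (simp add: high_act)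
      finally show ?thesis .
    qed
    then show ?thesis using word.act_closed [OF x zM] by simp
  qed
  moreover have "cfun.subspace ?U"
    unfolding cfun.subspace_def
    by (auto simp: word.q_add' word.q_scale' word.q_zero' bM word.add_in word.scale_in)
  ultimately have "submodule ?U (word_rep sg3)" by (auto simp: submodule_def)
  moreover have "delta (high_word sg3) \<in> ?U"
  proof -
    have "?q t (delta (high_word sg3)) = (\<Sum>w\<in>words (length sg3). if w = high_word sg3 then t w else 0)" for t
      unfolding winner_def by (intro sum.cong refl) (simp add: delta_def)
    then have "?q t (delta (high_word sg3)) = t (high_word sg3)" for t by (simp add: high_word_in_words)
    then show ?thesis using * by (simp add: \<beta>_def delta_in_word_rep)
  qed
  ultimately have sub: "high_space sg3 \<subseteq> ?U" by (rule high_space_least)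
  obtain v w where vw: "v \<in> high_space sg1" "w \<in> high_space sg2" "b v w \<noteq> 0" using nz by blast
  then have "b v w \<in> ?U" using b_rules(1) sub by blast
  then have "?q (b v w) (b v w) = 0" using vw by blast
  then have "b v w = 0" using word.q_definite [OF bM [OF vw(1,2)]] by simp
  then show False using vw(3) by simp
qed

lemma \<beta>_lower:
  assumes "v \<in> high_space sg1" "w \<in> high_space sg2" "(i, j) \<in> {(2, 1), (3, 2)}"
  shows "\<beta> (wact sg1 (matrix_unit i j) v) w + \<beta> v (wact sg2 (matrix_unit i j) w) = 0"
proof -
  have "wact sg3 (matrix_unit i j) (b v w) = b (wact sg1 (matrix_unit i j) v) w + b v (wact sg2 (matrix_unit i j) w)"
    using assms by (intro b_rules) auto
  from fun_cong [OF this, of "high_word sg3"]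
  show ?thesis using wact_lower_high_coordinate [of i j sg3 "b v w"] assms(3) by (auto simp: \<beta>_def)
qed

lemma \<beta>_cartan:
  assumes "v \<in> high_space sg1" "w \<in> high_space sg2" "h \<in> cartan"
  shows "\<beta> (wact sg1 h v) w + \<beta> v (wact sg2 h w) = wweight sg3 h (high_word sg3) * \<beta> v w"
proof -
  have "wact sg3 h (b v w) = b (wact sg1 h v) w + b v (wact sg2 h w)"
    using assms by (intro b_rules) (auto simp: cartan_sl3)
  from fun_cong [OF this, of "high_word sg3"]
  show ?thesis
    using wact_diagonal [OF cartan_offdiag [OF assms(3)], of "high_word sg3" sg3 "b v w"] by (simp add: \<beta>_def)
qed

lemma \<beta>_linear:
  assumes "v \<in> high_space sg1" "w \<in> high_space sg2"
  shows "v' \<in> high_space sg1 \<Longrightarrow> \<beta> (v + v') w = \<beta> v w + \<beta> v' w"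
    and "w' \<in> high_space sg2 \<Longrightarrow> \<beta> v (w + w') = \<beta> v w + \<beta> v w'"
    and "\<beta> (fun_scale c v) w = c * \<beta> v w" "\<beta> v (fun_scale c w) = c * \<beta> v w"
  using b_rules [OF assms] by (simp_all add: \<beta>_def)

lemma \<beta>_zero: "v \<in> high_space sg1 \<Longrightarrow> \<beta> v 0 = 0" "w \<in> high_space sg2 \<Longrightarrow> \<beta> 0 w = 0"
  by (simp_all add: \<beta>_def b_zero)

text \<open>By \<open>\<beta>_lower\<close> the left radical of \<beta> is stable under the lowering
  operators, so it would be everything if it contained the highest weight vector.\<close>

lemma \<beta>_high_left: "\<exists>w\<in>high_space sg2. \<beta> (delta (high_word sg1)) w \<noteq> 0"
proof (rule ccontr)
  assume *: "\<not> ?thesis"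
  let ?K = "{v \<in> high_space sg1. \<forall>w\<in>high_space sg2. \<beta> v w = 0}"
  have "high_space sg1 \<subseteq> ?K"
  proof (rule lowering_generates)
    show "cfun.subspace ?K"
      unfolding cfun.subspace_def by (auto simp: high_zero high_add high_scale \<beta>_zero \<beta>_linear)
    show "delta (high_word sg1) \<in> ?K" using * by simp
    fix t assume t: "t \<in> high_space sg1" "t \<in> ?K"
    have "wact sg1 (matrix_unit i j) t \<in> ?K" if ij: "(i, j) \<in> {(2, 1), (3, 2)}" for i j
    proof -
      have x: "matrix_unit i j \<in> sl3" using ij by auto
      have "\<beta> (wact sg1 (matrix_unit i j) t) w = 0" if w: "w \<in> high_space sg2" for w
        using \<beta>_lower [OF t(1) w ij] t(2) high_act [OF x w] by auto
      then show ?thesis using high_act [OF x t(1)] by simp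
    qed
    then show "wact sg1 (matrix_unit 2 1) t \<in> ?K \<and> wact sg1 (matrix_unit 3 2) t \<in> ?K" by blast
  qed
  then show False using \<beta>_nonzero by blast
qed

text \<open>Raising operators kill the highest weight vector on the left, so with it fixed
  \<open>b\<close> commutes with them in the second argument; vanishing at the lowest word would
  spread to the whole module.\<close>

lemma b_high_low: "b (delta (high_word sg1)) (delta (low_word sg2)) \<noteq> 0"
proof
  assume *: "b (delta (high_word sg1)) (delta (low_word sg2)) = 0"
  let ?v = "delta (high_word sg1)"
  let ?K = "{w \<in> high_space sg2. b ?v w = 0}"
  have "high_space sg2 \<subseteq> ?K"
  proof (rule raising_generates)
    show "cfun.subspace ?K"
      unfolding cfun.subspace_def by (auto simp: high_zero high_add high_scale b_zero b_rules)
    show "delta (low_word sg2) \<in> ?K" using * low_word_in by simp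
    fix t assume t: "t \<in> high_space sg2" "t \<in> ?K"
    have "wact sg2 (matrix_unit i j) t \<in> ?K" if ij: "(i, j) \<in> {(1, 2), (2, 3)}" for i j
    proof -
      have x: "matrix_unit i j \<in> sl3" using ij by auto
      have "wact sg1 (matrix_unit i j) ?v = 0" using ij by (intro wact_raise_high) auto
      moreover have "wact sg3 (matrix_unit i j) 0 = 0" using word.act_zero [OF x, of sg3] by simp
      ultimately have "b ?v (wact sg2 (matrix_unit i j) t) = 0"
        using b_rules(6) [OF high_word_in t(1) x] t b_zero(2) [OF t(1)] by simp
      then show ?thesis using high_act [OF x t(1)] by simp
    qed
    then show "wact sg2 (matrix_unit 1 2) t \<in> ?K \<and> wact sg2 (matrix_unit 2 3) t \<in> ?K" by blast
  qed
  then show False using \<beta>_high_left by (auto simp: \<beta>_def)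
qed

text \<open>With the highest weight vector on the left, \<beta> is a functional of the right
  argument on which the transpose of \<open>h\<close> has eigenvalue \<nu> - \<lambda>. Exchanging
  the factors gives the same for \<nu> - \<mu>.\<close>

lemma weight_right:
  assumes h: "h \<in> cartan"
  shows "\<exists>u. length u = length sg2 \<and>
    wweight sg3 h (high_word sg3) - wweight sg1 h (high_word sg1) = wweight sg2 h u"
proof -
  obtain w0 where w0: "w0 \<in> high_space sg2" "\<beta> (delta (high_word sg1)) w0 \<noteq> 0" using \<beta>_high_left by blast
  show ?thesis
  proof (rule eigen_functional [where m = "\<beta> (delta (high_word sg1))", OF h _ _ _ w0])
    fix w assume w: "w \<in> high_space sg2"
    have "\<beta> (wact sg1 h (delta (high_word sg1))) w = wweight sg1 h (high_word sg1) * \<beta> (delta (high_word sg1)) w"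
      by (simp add: wact_diagonal_delta [OF h] \<beta>_linear w)
    then show "\<beta> (delta (high_word sg1)) (wact sg2 h w)
      = (wweight sg3 h (high_word sg3) - wweight sg1 h (high_word sg1)) * \<beta> (delta (high_word sg1)) w"
      using \<beta>_cartan [OF high_word_in w h] by (simp add: algebra_simps)
  qed (simp_all add: \<beta>_linear)
qed

lemma swap: "nonzero_bilinear sg2 sg1 sg3 (\<lambda>w v. b v w)"
proof
  show "bilinear_hom (high_rep sg2) (high_rep sg1) (high_rep sg3) (\<lambda>w v. b v w)"
    using b unfolding bilinear_hom_def by (auto simp: add.commute)
qed (use nz in blast)

lemma weight_left:
  "h \<in> cartan \<Longrightarrow> \<exists>u. length u = length sg1 \<and>
    wweight sg3 h (high_word sg3) - wweight sg2 h (high_word sg2) = wweight sg1 h u"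
  by (rule nonzero_bilinear.weight_right [OF swap])

lemma weight_top:
  "\<exists>u. length u = length sg3 \<and>
    (\<forall>h\<in>cartan. wweight sg1 h (high_word sg1) + wweight sg2 h (low_word sg2) = wweight sg3 h u)"
proof (rule eigen_vector [OF _ high_space_subset [OF b_rules(1) [OF high_word_in low_word_in]] b_high_low])
  fix h assume h: "h \<in> cartan"
  have "wact sg3 h (b (delta (high_word sg1)) (delta (low_word sg2)))
    = b (wact sg1 h (delta (high_word sg1))) (delta (low_word sg2))
      + b (delta (high_word sg1)) (wact sg2 h (delta (low_word sg2)))"
    using h by (intro b_rules) (auto simp: cartan_sl3 low_word_in)
  then show "wact sg3 h (b (delta (high_word sg1)) (delta (low_word sg2)))
    = fun_scale (wweight sg1 h (high_word sg1) + wweight sg2 h (low_word sg2)) (b (delta (high_word sg1)) (delta (low_word sg2)))"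
    by (simp add: wact_diagonal_delta [OF h] b_rules low_word_in cfun.scale_left_distrib)
qed

end

text \<open>The simple roots take the values \<open>1\<close> and \<open>\<i>\<close> on this element, so that a single
  complex number determines both coordinates of an element of the root lattice.\<close>

definition root_separator :: "complex^3^3" where
  "root_separator = (\<chi> i j. if i \<noteq> j then 0 else if i = 1 then (2 + \<i>) / 3
     else if i = 2 then (- 1 + \<i>) / 3 else (- 1 - 2 * \<i>) / 3)"

lemma root_separator_cartan: "root_separator \<in> cartan"
  by (auto simp: cartan_def sl3_def trace_def sum_3 root_separator_def field_simps)

lemma root_separator_nth:
  "root_separator $ 1 $ 1 = (2 + \<i>) / 3" "root_separator $ 2 $ 2 = (- 1 + \<i>) / 3"
  "root_separator $ 3 $ 3 = (- 1 - 2 * \<i>) / 3"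
  by (simp_all add: root_separator_def)

lemma wweight_low_word:
  "wweight sg h (low_word sg) = of_nat (count_list sg True) * h $ 3 $ 3 - of_nat (count_list sg False) * h $ 1 $ 1"
  by (induction sg) (auto simp: low_word_def slot_def algebra_simps)

lemma length_count: "length sg = count_list sg True + count_list sg False"
  by (induction sg) auto

text \<open>The fundamental weights take the values (2 + i)/3 and (1 + 2i)/3 at the separator. Real
  and imaginary parts then give the root coordinates \<open>k\<close>, \<open>l\<close> of (a - p, b
  - q) by the inverse Cartan matrix, one third of the matrix with rows (2, 1) and (1, 2).\<close>

lemma root_separator_weight:
  assumes "length u = length sg"
    and "of_int p * ((2 + \<i>) / 3) + of_int q * ((1 + 2 * \<i>) / 3) = wweight sg root_separator u"
  shows "\<exists>k l :: nat. k \<le> count_list sg True + count_list sg False \<and> l \<le> count_list sg True + count_list sg False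
    \<and> k \<le> l + count_list sg True \<and> l \<le> k + count_list sg False
    \<and> 3 * int k = 2 * (int (count_list sg True) - p) + (int (count_list sg False) - q)
    \<and> 3 * int l = (int (count_list sg True) - p) + 2 * (int (count_list sg False) - q)"
proof -
  note c = root_separator_cartan
  let ?a = "count_list sg True" and ?b = "count_list sg False"
  obtain k l where kl: "k \<le> length sg" "l \<le> length sg" "k \<le> l + ?a" "l \<le> k + ?b"
    and w: "wweight sg root_separator u = wweight sg root_separator (high_word sg)
        - of_nat k * (root_separator $ 1 $ 1 - root_separator $ 2 $ 2) - of_nat l * (root_separator $ 2 $ 2 - root_separator $ 3 $ 3)"
    using weight_bounds [OF c assms(1)] c by blast
  have diff: "root_separator $ 1 $ 1 - root_separator $ 2 $ 2 = 1" "root_separator $ 2 $ 2 - root_separator $ 3 $ 3 = \<i>"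
    by (simp_all add: root_separator_nth field_simps)
  have sum: "root_separator $ 1 $ 1 + root_separator $ 2 $ 2 = (1 + 2 * \<i>) / 3"
    by (simp add: root_separator_nth field_simps)
  have "of_int p * ((2 + \<i>) / 3) + of_int q * ((1 + 2 * \<i>) / 3)
    = of_nat ?a * ((2 + \<i>) / 3) + of_nat ?b * ((1 + 2 * \<i>) / 3) - of_nat k - of_nat l * \<i>"
    using assms(2) unfolding w diff wweight_high_word [OF c] weight_eval_def fund_weight1_def fund_weight2_def sum
    by (simp add: root_separator_nth)
  \<comment> \<open>Tripling is done with abstract coefficients so that the factor 3 lands directly
    on the two fractions and cancels their denominators.\<close>
  moreover have "P * (3 * r) + Q * (3 * s) = A * (3 * r) + B * (3 * s) - 3 * K - 3 * L"
    if "P * r + Q * s = A * r + B * s - K - L" for P Q A B K L r s :: complex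
    using that by algebra
  ultimately have "of_int p * (3 * ((2 + \<i>) / 3)) + of_int q * (3 * ((1 + 2 * \<i>) / 3))
    = of_nat ?a * (3 * ((2 + \<i>) / 3)) + of_nat ?b * (3 * ((1 + 2 * \<i>) / 3)) - 3 * of_nat k - 3 * (of_nat l * \<i>)"
    by blast
  moreover have "3 * (z / 3) = z" for z :: complex by simp
  ultimately have "of_int p * (2 + \<i>) + of_int q * (1 + 2 * \<i>)
    = of_nat ?a * (2 + \<i>) + of_nat ?b * (1 + 2 * \<i>) - 3 * of_nat k - 3 * (of_nat l * \<i>)"
    by (simp only:)
  then have "2 * real_of_int p + real_of_int q = 2 * real ?a + real ?b - 3 * real k"
    "real_of_int p + 2 * real_of_int q = real ?a + 2 * real ?b - 3 * real l"
    by (simp_all add: complex_eq_iff)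
  then have "real_of_int (2 * p + q) = real_of_int (2 * int ?a + int ?b - 3 * int k)"
    "real_of_int (p + 2 * q) = real_of_int (int ?a + 2 * int ?b - 3 * int l)"
    by simp_all
  then have "2 * p + q = 2 * int ?a + int ?b - 3 * int k" "p + 2 * q = int ?a + 2 * int ?b - 3 * int l"
    unfolding of_int_eq_iff .
  then have "3 * int k = 2 * (int ?a - p) + (int ?b - q)" "3 * int l = (int ?a - p) + 2 * (int ?b - q)"
    by simp_all
  then show ?thesis using kl unfolding length_count [of sg] by blast
qed

text \<open>\<open>k\<close> and \<open>l\<close> are the coordinates of \<open>\<lambda> + \<mu> - \<nu>\<close> with respect to the simple roots.\<close>

definition horn :: "dom_weight \<Rightarrow> dom_weight \<Rightarrow> dom_weight \<Rightarrow> bool" where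
  "horn lam mu nu \<longleftrightarrow> (\<exists>k l :: int.
     int (fst lam) + int (fst mu) - int (fst nu) = 2 * k - l \<and>
     int (snd lam) + int (snd mu) - int (snd nu) = 2 * l - k \<and>
     0 \<le> k \<and> 0 \<le> l \<and>
     k \<le> int (fst lam) + int (snd lam) \<and> k \<le> int (fst mu) + int (snd mu) \<and> k \<le> int (fst lam) + int (fst mu) \<and>
     l \<le> int (fst lam) + int (snd lam) \<and> l \<le> int (fst mu) + int (snd mu) \<and> l \<le> int (snd lam) + int (snd mu) \<and>
     k - l \<le> int (fst lam) \<and> k - l \<le> int (fst mu) \<and> l - k \<le> int (snd lam) \<and> l - k \<le> int (snd mu))"

lemma (in nonzero_bilinear) horn_bilinear:
  "horn (count_list sg1 True, count_list sg1 False) (count_list sg2 True, count_list sg2 False)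
    (count_list sg3 True, count_list sg3 False)"
proof -
  note c = root_separator_cartan
  let ?h = root_separator
  let ?a1 = "count_list sg1 True" and ?b1 = "count_list sg1 False"
    and ?a2 = "count_list sg2 True" and ?b2 = "count_list sg2 False"
    and ?a3 = "count_list sg3 True" and ?b3 = "count_list sg3 False"
  have sum: "?h $ 1 $ 1 + ?h $ 2 $ 2 = (1 + 2 * \<i>) / 3"
    by (simp add: root_separator_nth field_simps)
  define r s where "r = (2 + \<i>) / 3" and "s = (1 + 2 * \<i>) / 3"
  have high: "wweight sg ?h (high_word sg) = of_nat (count_list sg True) * r + of_nat (count_list sg False) * s" for sg
    unfolding wweight_high_word [OF c] weight_eval_def fund_weight1_def fund_weight2_def sum
    by (simp add: root_separator_nth r_def s_def)
  have "?h $ 3 $ 3 = - s" "?h $ 1 $ 1 = r" by (simp_all add: root_separator_nth r_def s_def field_simps)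
  \<comment> \<open>The lowest weight of the module with highest weight (a, b) is -(b, a).\<close>
  then have low: "wweight sg ?h (low_word sg) = - of_nat (count_list sg False) * r - of_nat (count_list sg True) * s" for sg
    unfolding wweight_low_word by simp
  obtain u where u: "length u = length sg2" "wweight sg3 ?h (high_word sg3) - wweight sg1 ?h (high_word sg1) = wweight sg2 ?h u"
    using weight_right [OF c] by blast
  have "of_int (int ?a3 - int ?a1) * r + of_int (int ?b3 - int ?b1) * s = wweight sg2 ?h u"
    unfolding u(2) [symmetric] high by (simp only: of_int_diff of_int_of_nat_eq) (simp add: algebra_simps)
  from root_separator_weight [OF u(1) this [unfolded r_def s_def]]
  obtain k l :: nat where kl: "k \<le> ?a2 + ?b2" "l \<le> ?a2 + ?b2" "k \<le> l + ?a2" "l \<le> k + ?b2"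
    "3 * int k = 2 * (int ?a2 - (int ?a3 - int ?a1)) + (int ?b2 - (int ?b3 - int ?b1))"
    "3 * int l = (int ?a2 - (int ?a3 - int ?a1)) + 2 * (int ?b2 - (int ?b3 - int ?b1))" by blast
  obtain v where v: "length v = length sg1" "wweight sg3 ?h (high_word sg3) - wweight sg2 ?h (high_word sg2) = wweight sg1 ?h v"
    using weight_left [OF c] by blast
  have "of_int (int ?a3 - int ?a2) * r + of_int (int ?b3 - int ?b2) * s = wweight sg1 ?h v"
    unfolding v(2) [symmetric] high by (simp only: of_int_diff of_int_of_nat_eq) (simp add: algebra_simps)
  from root_separator_weight [OF v(1) this [unfolded r_def s_def]]
  obtain k' l' :: nat where kl': "k' \<le> ?a1 + ?b1" "l' \<le> ?a1 + ?b1" "k' \<le> l' + ?a1" "l' \<le> k' + ?b1"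
    "3 * int k' = 2 * (int ?a1 - (int ?a3 - int ?a2)) + (int ?b1 - (int ?b3 - int ?b2))"
    "3 * int l' = (int ?a1 - (int ?a3 - int ?a2)) + 2 * (int ?b1 - (int ?b3 - int ?b2))" by blast
  obtain w where w: "length w = length sg3" "wweight sg1 ?h (high_word sg1) + wweight sg2 ?h (low_word sg2) = wweight sg3 ?h w"
    using weight_top c by blast
  have "of_int (int ?a1 - int ?b2) * r + of_int (int ?b1 - int ?a2) * s = wweight sg3 ?h w"
    unfolding w(2) [symmetric] high low by (simp only: of_int_diff of_int_of_nat_eq) (simp add: algebra_simps)
  from root_separator_weight [OF w(1) this [unfolded r_def s_def]]
  obtain m n :: nat where mn: "m \<le> ?a3 + ?b3" "n \<le> ?a3 + ?b3" "m \<le> n + ?a3" "n \<le> m + ?b3"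
    "3 * int m = 2 * (int ?a3 - (int ?a1 - int ?b2)) + (int ?b3 - (int ?b1 - int ?a2))"
    "3 * int n = (int ?a3 - (int ?a1 - int ?b2)) + 2 * (int ?b3 - (int ?b1 - int ?a2))" by blast
  have e: "int ?a1 + int ?a2 - int ?a3 = 2 * int k - int l" "int ?b1 + int ?b2 - int ?b3 = 2 * int l - int k"
    using kl(5,6) by simp_all
  \<comment> \<open>Both pairs are the root coordinates of \<lambda> + \<mu> - \<nu>, so the bounds
    in terms of \<lambda> and of \<mu> concern the same numbers.\<close>
  have "int k' = int k" "int l' = int l" using kl(5,6) kl'(5,6) by simp_all
  then have "k \<le> ?a1 + ?b1" "l \<le> ?a1 + ?b1" "k \<le> l + ?a1" "l \<le> k + ?b1"
    using kl'(1-4) by simp_all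
  \<comment> \<open>A highest weight (a, b) exceeds the lowest weight of its module by (a +
    b)(\<alpha>1 + \<alpha>2), so descending from \<nu> to \<lambda> plus the lowest weight of \<mu>
    takes what \<open>k\<close> and \<open>l\<close> leave of \<open>?a2 + ?b2\<close>. Substituting
    for \<nu> turns the excess bounds into the two inequalities below.\<close>
  moreover have "int m = int ?a2 + int ?b2 - int k" "int n = int ?a2 + int ?b2 - int l"
    using kl(5,6) mn(5,6) by simp_all
  then have "int k \<le> int ?a1 + int ?a2" "int l \<le> int ?b1 + int ?b2"
    using mn(3,4) e by simp_all
  ultimately have "0 \<le> int k \<and> 0 \<le> int l \<and>
     int k \<le> int ?a1 + int ?b1 \<and> int k \<le> int ?a2 + int ?b2 \<and> int k \<le> int ?a1 + int ?a2 \<and>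
     int l \<le> int ?a1 + int ?b1 \<and> int l \<le> int ?a2 + int ?b2 \<and> int l \<le> int ?b1 + int ?b2 \<and>
     int k - int l \<le> int ?a1 \<and> int k - int l \<le> int ?a2 \<and> int l - int k \<le> int ?b1 \<and> int l - int k \<le> int ?b2"
    using kl(1-4) by (intro conjI; linarith)
  then show ?thesis
    unfolding horn_def fst_conv snd_conv using e by blast
qed

lemma count_replicate [simp]: "count_list (replicate n c) d = (if c = d then n else 0)"
  by (induction n) auto

lemma tensor_coeff_imp_horn:
  assumes "tensor_coeff lam mu nu \<noteq> 0"
  shows "horn lam mu nu"
proof -
  define sg where "sg lam = replicate (fst lam) True @ replicate (snd lam) False" for lam :: dom_weight
  have sg: "(count_list (sg lam) True, count_list (sg lam) False) = lam" for lam by (simp add: sg_def)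
  obtain b where "bilinear_hom (high_rep (sg lam)) (high_rep (sg mu)) (high_rep (sg nu)) b"
    "\<exists>v\<in>high_space (sg lam). \<exists>w\<in>high_space (sg mu). b v w \<noteq> 0"
    using tensor_coeff_nonzero_iff [of "sg lam" "sg mu" "sg nu"] assms unfolding sg by blast
  then interpret nonzero_bilinear "sg lam" "sg mu" "sg nu" b by unfold_locales
  show ?thesis using horn_bilinear unfolding sg .
qed

section \<open>Integral solutions as sums of elementary invariants\<close>

text \<open>Existence of suitable signatures hides the order of the slots, so that each new
  invariant may be attached at the head.\<close>

definition attained :: "nat \<Rightarrow> nat \<Rightarrow> nat \<Rightarrow> nat \<Rightarrow> nat \<Rightarrow> nat \<Rightarrow> bool" where
  "attained a1 b1 a2 b2 a3 b3 \<longleftrightarrow> (\<exists>sg1 sg2 sg3. linked sg1 sg2 sg3 \<and>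
     count_list sg1 True = a1 \<and> count_list sg1 False = b1 \<and> count_list sg2 True = a2 \<and>
     count_list sg2 False = b2 \<and> count_list sg3 True = a3 \<and> count_list sg3 False = b3)"

lemma attained_0: "attained 0 0 0 0 0 0"
  unfolding attained_def using linked_Nil by (intro exI [of _ "[]"]) simp

lemma attained_step:
  assumes "attained a1 b1 a2 b2 a3 b3"
  shows "attained (Suc a1) b1 a2 b2 (Suc a3) b3" "attained a1 b1 (Suc a2) b2 (Suc a3) b3"
    "attained a1 (Suc b1) a2 b2 a3 (Suc b3)" "attained a1 b1 a2 (Suc b2) a3 (Suc b3)"
    "attained (Suc a1) b1 a2 (Suc b2) a3 b3" "attained a1 (Suc b1) (Suc a2) b2 a3 b3"
    "attained (Suc a1) b1 (Suc a2) b2 a3 (Suc b3)" "attained a1 (Suc b1) a2 (Suc b2) (Suc a3) b3"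
proof -
  obtain sg1 sg2 sg3 where l: "linked sg1 sg2 sg3"
    and c: "count_list sg1 True = a1" "count_list sg1 False = b1" "count_list sg2 True = a2"
      "count_list sg2 False = b2" "count_list sg3 True = a3" "count_list sg3 False = b3"
    using assms unfolding attained_def by blast
  have I: "attained (count_list t1 True) (count_list t1 False) (count_list t2 True) (count_list t2 False)
      (count_list t3 True) (count_list t3 False)" if "linked t1 t2 t3" for t1 t2 t3
    using that unfolding attained_def by blast
  show "attained (Suc a1) b1 a2 b2 (Suc a3) b3" using I [OF linked_13 [OF l, of True]] c by simp
  show "attained a1 b1 (Suc a2) b2 (Suc a3) b3" using I [OF linked_23 [OF l, of True]] c by simp
  show "attained a1 (Suc b1) a2 b2 a3 (Suc b3)" using I [OF linked_13 [OF l, of False]] c by simp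
  show "attained a1 b1 a2 (Suc b2) a3 (Suc b3)" using I [OF linked_23 [OF l, of False]] c by simp
  show "attained (Suc a1) b1 a2 (Suc b2) a3 b3" using I [OF linked_12 [OF l, of True]] c by simp
  show "attained a1 (Suc b1) (Suc a2) b2 a3 b3" using I [OF linked_12 [OF l, of False]] c by simp
  show "attained (Suc a1) b1 (Suc a2) b2 a3 (Suc b3)" using I [OF linked_123 [OF l, of False]] c by simp
  show "attained a1 (Suc b1) a2 (Suc b2) (Suc a3) b3" using I [OF linked_123 [OF l, of True]] c by simp
qed

text \<open>The multiplicities of the generators: n1 to n4 pass a vector or covector slot from one
  factor on to \<nu>, n5 and n6 contract a slot of \<lambda> with one of \<mu>, and n7 and n8 count
  the two determinants.\<close>

lemma attained_all:
  "attained (n1 + n5 + n7) (n3 + n6 + n8) (n2 + n6 + n7) (n4 + n5 + n8) (n1 + n2 + n8) (n3 + n4 + n7)"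
proof -
  have 1: "attained n1 0 0 0 n1 0" by (induction n1) (auto intro: attained_0 attained_step)
  have 2: "attained n1 0 n2 0 (n1 + n2) 0" by (induction n2) (auto intro: 1 attained_step)
  have 3: "attained n1 n3 n2 0 (n1 + n2) n3" by (induction n3) (auto intro: 2 attained_step)
  have 4: "attained n1 n3 n2 n4 (n1 + n2) (n3 + n4)" by (induction n4) (auto intro: 3 attained_step)
  have 5: "attained (n1 + n5) n3 n2 (n4 + n5) (n1 + n2) (n3 + n4)"
    by (induction n5) (auto intro: 4 attained_step)
  have 6: "attained (n1 + n5) (n3 + n6) (n2 + n6) (n4 + n5) (n1 + n2) (n3 + n4)"
    by (induction n6) (auto intro: 5 attained_step)
  have 7: "attained (n1 + n5 + n7) (n3 + n6) (n2 + n6 + n7) (n4 + n5) (n1 + n2) (n3 + n4 + n7)"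
    by (induction n7) (auto intro: 6 attained_step)
  show ?thesis by (induction n8) (auto intro: 7 attained_step)
qed

lemma attained_tensor_coeff: "attained a1 b1 a2 b2 a3 b3 \<Longrightarrow> tensor_coeff (a1, b1) (a2, b2) (a3, b3) \<noteq> 0"
  unfolding attained_def using linked_tensor_coeff by blast

lemma attained_int:
  fixes n1 n2 n3 n4 n5 n6 n7 n8 :: int
  assumes n: "0 \<le> n1" "0 \<le> n2" "0 \<le> n3" "0 \<le> n4" "0 \<le> n5" "0 \<le> n6" "0 \<le> n7" "0 \<le> n8"
    "int a1 = n1 + n5 + n7" "int b1 = n3 + n6 + n8" "int a2 = n2 + n6 + n7" "int b2 = n4 + n5 + n8"
    "int a3 = n1 + n2 + n8" "int b3 = n3 + n4 + n7"
  shows "attained a1 b1 a2 b2 a3 b3"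
proof -
  have "a1 = nat n1 + nat n5 + nat n7" using n(1,5,7,9) by linarith
  moreover have "b1 = nat n3 + nat n6 + nat n8" using n(3,6,8,10) by linarith
  moreover have "a2 = nat n2 + nat n6 + nat n7" using n(2,6,7,11) by linarith
  moreover have "b2 = nat n4 + nat n5 + nat n8" using n(4,5,8,12) by linarith
  moreover have "a3 = nat n1 + nat n2 + nat n8" using n(1,2,8,13) by linarith
  moreover have "b3 = nat n3 + nat n4 + nat n7" using n(3,4,7,14) by linarith
  ultimately show ?thesis by (simp only: attained_all)
qed

lemma horn_imp_tensor_coeff:
  assumes "horn lam mu nu"
  shows "tensor_coeff lam mu nu \<noteq> 0"
proof -
  obtain a1 b1 a2 b2 a3 b3 where w: "lam = (a1, b1)" "mu = (a2, b2)" "nu = (a3, b3)"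
    by (cases lam; cases mu; cases nu)
  obtain k l :: int where kl: "int a1 + int a2 - int a3 = 2 * k - l" "int b1 + int b2 - int b3 = 2 * l - k"
    "0 \<le> k" "0 \<le> l" "k \<le> int a1 + int b1" "k \<le> int a2 + int b2" "k \<le> int a1 + int a2"
    "l \<le> int a1 + int b1" "l \<le> int a2 + int b2" "l \<le> int b1 + int b2"
    "k - l \<le> int a1" "k - l \<le> int a2" "l - k \<le> int b1" "l - k \<le> int b2"
    using assms unfolding horn_def w fst_conv snd_conv by blast
  have "attained a1 b1 a2 b2 a3 b3"
  proof (cases "l \<le> k")
    case True
    \<comment> \<open>For k at least l take k - l determinants of one kind and none of the other;
      the weights then leave one free parameter, the number \<open>t\<close> of vector slots of
      \<lambda> contracted with \<mu>. Nonnegativity of the multiplicities gives three lower and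
      three upper bounds. Every lower bound is at most every upper bound by the inequalities and the
      nonnegativity of the weight coordinates, so the largest lower bound serves.\<close>
    define t where "t = max 0 (max (l - int b1) (k - int a2))"
    have t: "0 \<le> t" "l - int b1 \<le> t" "k - int a2 \<le> t" "t \<le> l" "t \<le> int a1 - k + l" "t \<le> int b2"
      unfolding t_def using kl True by simp_all
    show ?thesis
      by (rule attained_int [of "int a1 - t - (k - l)" "int a2 - k + t" "int b1 - l + t" "int b2 - t" t "l - t" "k - l" 0])
        (use kl True t in linarith)+
  next
    case False
    \<comment> \<open>The mirror image, with l - k determinants of the other kind.\<close>
    define t where "t = max 0 (max (k - int a2) (l - int b1))"
    have t: "0 \<le> t" "k - int a2 \<le> t" "l - int b1 \<le> t" "t \<le> k" "t \<le> int b2 - l + k" "t \<le> int a1"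
      unfolding t_def using kl False by simp_all
    show ?thesis
      by (rule attained_int [of "int a1 - t" "int a2 - k + t" "int b1 - l + t" "int b2 - t - (l - k)" t "k - t" 0 "l - k"])
        (use kl False t in linarith)+
  qed
  then show ?thesis unfolding w by (rule attained_tensor_coeff)
qed

lemma tensor_coeff_iff_horn: "tensor_coeff lam mu nu \<noteq> 0 \<longleftrightarrow> horn lam mu nu"
  using tensor_coeff_imp_horn horn_imp_tensor_coeff by blast

section \<open>Scaling of the inequalities and the role of the congruence\<close>

lemma horn_scale:
  assumes "horn lam mu nu"
  shows "horn (scale_weight N lam) (scale_weight N mu) (scale_weight N nu)"
proof -
  let ?N = "int N"
  obtain a1 b1 a2 b2 a3 b3 where w: "lam = (a1, b1)" "mu = (a2, b2)" "nu = (a3, b3)"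
    by (cases lam; cases mu; cases nu)
  obtain k l :: int where e: "int a1 + int a2 - int a3 = 2 * k - l" "int b1 + int b2 - int b3 = 2 * l - k"
    and ineq: "0 \<le> k" "0 \<le> l" "k \<le> int a1 + int b1" "k \<le> int a2 + int b2" "k \<le> int a1 + int a2"
    "l \<le> int a1 + int b1" "l \<le> int a2 + int b2" "l \<le> int b1 + int b2"
    "k - l \<le> int a1" "k - l \<le> int a2" "l - k \<le> int b1" "l - k \<le> int b2"
    using assms unfolding horn_def w fst_conv snd_conv by blast
  have "?N * (int a1 + int a2 - int a3) = ?N * (2 * k - l)" "?N * (int b1 + int b2 - int b3) = ?N * (2 * l - k)"
    using e by simp_all
  then have e': "?N * int a1 + ?N * int a2 - ?N * int a3 = 2 * (?N * k) - ?N * l"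
    "?N * int b1 + ?N * int b2 - ?N * int b3 = 2 * (?N * l) - ?N * k"
    by (simp_all add: distrib_left right_diff_distrib)
  note ineq [THEN mult_left_mono, of ?N]
  then have ineq': "0 \<le> ?N * k" "0 \<le> ?N * l" "?N * k \<le> ?N * int a1 + ?N * int b1" "?N * k \<le> ?N * int a2 + ?N * int b2"
    "?N * k \<le> ?N * int a1 + ?N * int a2" "?N * l \<le> ?N * int a1 + ?N * int b1" "?N * l \<le> ?N * int a2 + ?N * int b2"
    "?N * l \<le> ?N * int b1 + ?N * int b2" "?N * k - ?N * l \<le> ?N * int a1" "?N * k - ?N * l \<le> ?N * int a2"
    "?N * l - ?N * k \<le> ?N * int b1" "?N * l - ?N * k \<le> ?N * int b2"
    by (simp_all add: distrib_left right_diff_distrib)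
  show ?thesis
    unfolding horn_def scale_weight_def w fst_conv snd_conv of_nat_mult using e' ineq' by blast
qed

lemma horn_unscale:
  assumes N: "N > 0" and h: "horn (scale_weight N lam) (scale_weight N mu) (scale_weight N nu)"
    and c: "[partition_size (weight_partition lam) + partition_size (weight_partition mu)
            = partition_size (weight_partition nu)] (mod 3)"
  shows "horn lam mu nu"
proof -
  let ?N = "int N"
  obtain a1 b1 a2 b2 a3 b3 where w: "lam = (a1, b1)" "mu = (a2, b2)" "nu = (a3, b3)"
    by (cases lam; cases mu; cases nu)
  obtain k l :: int where kl:
    "?N * int a1 + ?N * int a2 - ?N * int a3 = 2 * k - l" "?N * int b1 + ?N * int b2 - ?N * int b3 = 2 * l - k"
    and ineq: "0 \<le> k" "0 \<le> l" "k \<le> ?N * int a1 + ?N * int b1" "k \<le> ?N * int a2 + ?N * int b2" "k \<le> ?N * int a1 + ?N * int a2"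
    "l \<le> ?N * int a1 + ?N * int b1" "l \<le> ?N * int a2 + ?N * int b2" "l \<le> ?N * int b1 + ?N * int b2"
    "k - l \<le> ?N * int a1" "k - l \<le> ?N * int a2" "l - k \<le> ?N * int b1" "l - k \<le> ?N * int b2"
    using h unfolding horn_def scale_weight_def w fst_conv snd_conv of_nat_mult by blast
  have "[a1 + 2 * b1 + (a2 + 2 * b2) = a3 + 2 * b3] (mod 3)"
    using c by (simp add: w partition_size_def weight_partition_def mult_2 add.assoc)
  then have "[int (a1 + 2 * b1 + (a2 + 2 * b2)) = int (a3 + 2 * b3)] (mod (int 3))"
    by (simp only: cong_int_iff)
  then have "(3 :: int) dvd int (a1 + 2 * b1 + (a2 + 2 * b2)) - int (a3 + 2 * b3)"
    by (simp add: cong_iff_dvd_diff)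
  \<comment> \<open>The difference of a + 2b between \<lambda> + \<mu> and \<nu> is three times the
    coefficient of \<alpha>2, so the congruence says exactly that this coefficient is an integer;
    the coefficient of \<alpha>1 is then an integer as well.\<close>
  then obtain l0 where l0: "int (a1 + 2 * b1 + (a2 + 2 * b2)) - int (a3 + 2 * b3) = 3 * l0" by (elim dvdE)
  define k0 where "k0 = 2 * l0 - (int b1 + int b2 - int b3)"
  have e: "int a1 + int a2 - int a3 = 2 * k0 - l0" "int b1 + int b2 - int b3 = 2 * l0 - k0"
    using l0 by (simp_all add: k0_def)
  have "?N * (int a1 + int a2 - int a3) = ?N * (2 * k0 - l0)" "?N * (int b1 + int b2 - int b3) = ?N * (2 * l0 - k0)"
    using e by simp_all
  \<comment> \<open>The root coordinates are determined by the weights, so those of the scaled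
    weights are the multiples of \<open>k0\<close> and \<open>l0\<close>, and every inequality can
    be divided by the positive factor.\<close>
  then have "k = ?N * k0" "l = ?N * l0"
    using kl by (simp_all add: right_diff_distrib distrib_left)
  then have "?N * 0 \<le> ?N * k0" "?N * 0 \<le> ?N * l0" "?N * k0 \<le> ?N * (int a1 + int b1)" "?N * k0 \<le> ?N * (int a2 + int b2)"
    "?N * k0 \<le> ?N * (int a1 + int a2)" "?N * l0 \<le> ?N * (int a1 + int b1)" "?N * l0 \<le> ?N * (int a2 + int b2)"
    "?N * l0 \<le> ?N * (int b1 + int b2)" "?N * (k0 - l0) \<le> ?N * int a1" "?N * (k0 - l0) \<le> ?N * int a2"
    "?N * (l0 - k0) \<le> ?N * int b1" "?N * (l0 - k0) \<le> ?N * int b2"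
    using ineq by (simp_all add: distrib_left right_diff_distrib)
  note this [THEN mult_left_le_imp_le]
  then have "0 \<le> k0" "0 \<le> l0" "k0 \<le> int a1 + int b1" "k0 \<le> int a2 + int b2"
    "k0 \<le> int a1 + int a2" "l0 \<le> int a1 + int b1" "l0 \<le> int a2 + int b2"
    "l0 \<le> int b1 + int b2" "k0 - l0 \<le> int a1" "k0 - l0 \<le> int a2"
    "l0 - k0 \<le> int b1" "l0 - k0 \<le> int b2"
    using N by simp_all
  then show ?thesis
    unfolding horn_def w fst_conv snd_conv using e by blast
qed

theorem theorem8p1:
  fixes lam mu nu :: dom_weight
  assumes "[partition_size (weight_partition lam) + partition_size (weight_partition mu)
            = partition_size (weight_partition nu)] (mod 3)"
  shows "tensor_coeff lam mu nu \<noteq> 0 \<longleftrightarrow>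
    (\<exists>N::nat. N > 1 \<and>
       tensor_coeff (scale_weight N lam) (scale_weight N mu) (scale_weight N nu) \<noteq> 0)"
proof
  assume "tensor_coeff lam mu nu \<noteq> 0"
  then have "horn (scale_weight 2 lam) (scale_weight 2 mu) (scale_weight 2 nu)"
    unfolding tensor_coeff_iff_horn by (rule horn_scale)
  then show "\<exists>N::nat. N > 1 \<and> tensor_coeff (scale_weight N lam) (scale_weight N mu) (scale_weight N nu) \<noteq> 0"
    unfolding tensor_coeff_iff_horn by (intro exI [of _ 2]) simp
next
  assume "\<exists>N::nat. N > 1 \<and> tensor_coeff (scale_weight N lam) (scale_weight N mu) (scale_weight N nu) \<noteq> 0"
  then obtain N :: nat where N: "N > 1" and h: "horn (scale_weight N lam) (scale_weight N mu) (scale_weight N nu)"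
    unfolding tensor_coeff_iff_horn by blast
  from N have "N > 0" by simp
  then show "tensor_coeff lam mu nu \<noteq> 0"
    unfolding tensor_coeff_iff_horn using h assms by (rule horn_unscale)
qed

end
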